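(* Let $a,b$ be non-negative integers such that $\binom{a+b}{a}$ is invertible in $k$. If $\operatorname{reg}^R_{a+b+1}(k)=0$ and $\max\{a,b\}\le m(R)$, then $$t_{a+b}(R)\le\max\{\,t_a(R)+t_b(R),\ t_{a-1}(R)+t_{b-1}(R)+3\,\}.$$ In particular, $$t_{a+1}(R)\le t_a(R)+2\quad\text{when } b=1,$$ $$t_{a+b}(R)\le t_a(R)+t_b(R)+1\quad\text{when } b\ge2.$$
   Context: $k$ is a field and $R=\bigoplus_{i\ge0}R_i$ is a commutative graded $k$-algebra with $R_0=k$, $R=k[R_1]$ and $\operatorname{rank}_kR_1$ finite. $S$ is the symmetric $k$-algebra on $R_1$ (a standard graded polynomial ring), and $S\to R$ is the canonical surjection of graded $k$-algebras. The residue field $k$ is viewed as a module over $R$ and $S$. For a graded vector space $V$, $\operatorname{top}(V)=\sup\{j\mid V_j\ne0\}$ (equal to $-\infty$ if $V=0$). For $A\in\{R,S\}$, a graded $A$-module $N$ and $i\in\mathbb Z$, put $t_i^A(N)=\operatorname{top}(\operatorname{Tor}_i^A(k,N))$ and $\operatorname{reg}_n^A(N)=\max_{i\le n}\{t_i^A(N)-i\}$. Write $t_i(R)=t_i^S(R)$; in particular $t_{i}(R)=-\infty$ for $i<0$. Finally, $m(R)=\min\{i\ge 0\mid t_i(R)\ge t_{i+1}(R)\}$. *)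

theory Defs
  imports
    Complex_Main
    "HOL-Library.Poly_Mapping"
    "HOL-Library.Extended_Real"
    "HOL-Algebra.Coset"
begin

section \<open>Graded algebras and graded modules\<close>

text \<open>
  A graded algebra is given by its scalar multiplication and its homogeneous components; the ring
  operations are those of the type. The algebra itself is the sum of its components, which need not
  exhaust the type (this matters for polynomial rings on a subset of the variables).
\<close>

record ('k, 'a) graded_alg =
  scl :: "'k \<Rightarrow> 'a \<Rightarrow> 'a"
  gr :: "nat \<Rightarrow> 'a set"

definition subalgebra :: "('k::field, 'a::comm_ring_1) graded_alg \<Rightarrow> 'a set \<Rightarrow> bool" where
  "subalgebra R T \<longleftrightarrow> module.subspace (scl R) T \<and> 1 \<in> T \<and> (\<forall>x\<in>T. \<forall>y\<in>T. x * y \<in> T)"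

locale standard_graded_algebra = vector_space "scl R"
  for R :: "('k::field, 'a::comm_ring_1) graded_alg" +
  assumes scl_mult: "scl R c (x * y) = scl R c x * y"
    and gr_subspace: "module.subspace (scl R) (gr R i)"
    and gr_mult: "x \<in> gr R i \<Longrightarrow> y \<in> gr R j \<Longrightarrow> x * y \<in> gr R (i + j)"
    and gr_direct_sum: "\<exists>!f :: nat \<Rightarrow>\<^sub>0 'a.
      (\<forall>i. Poly_Mapping.lookup f i \<in> gr R i) \<and>
      x = (\<Sum>i\<in>Poly_Mapping.keys f. Poly_Mapping.lookup f i)"
    and gr_0: "gr R 0 = range (\<lambda>c. scl R c 1)"
    and gr_1_generates: "subalgebra R hull gr R 1 = UNIV"
    and gr_1_finite_rank: "\<exists>X. finite X \<and> module.span (scl R) X = gr R 1"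

record ('a, 'm) graded_mod =
  hcomp :: "int \<Rightarrow> 'm set"
  act :: "'a \<Rightarrow> 'm \<Rightarrow> 'm"

definition int_gr :: "('k, 'a::zero) graded_alg \<Rightarrow> int \<Rightarrow> 'a set" where
  "int_gr A j = (if 0 \<le> j then gr A (nat j) else {0})"

definition regular_mod :: "('k, 'a::comm_ring_1) graded_alg \<Rightarrow> ('a, 'a) graded_mod" where
  "regular_mod A = \<lparr>hcomp = int_gr A, act = (*)\<rparr>"

text \<open>The canonical map from A to its residue field, whose kernel is the irrelevant ideal.\<close>

definition augmentation :: "('k::field, 'a::comm_ring_1) graded_alg \<Rightarrow> 'a \<Rightarrow> 'k" where
  "augmentation A x = (THE c. x - scl A c 1 \<in> module.span (scl A) (\<Union>i\<in>{0<..}. gr A i))"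

definition residue_mod :: "('k::field, 'a::comm_ring_1) graded_alg \<Rightarrow> ('a, 'k) graded_mod" where
  "residue_mod A = \<lparr>hcomp = (\<lambda>j. if j = 0 then UNIV else {0}), act = (\<lambda>x c. augmentation A x * c)\<rparr>"


section \<open>Graded free complexes and Tor\<close>

text \<open>
  A complex F of graded free modules with an augmentation to k. In homological degree i the free
  module has the basis \<open>gens F i\<close> (a set of labels), whose element x has internal degree
  \<open>gdeg F i x\<close>; the image of x under the differential has the coordinates \<open>dif F i x\<close> in the basis
  \<open>gens F (i - 1)\<close>, and in homological degree 0 the augmentation takes x to \<open>eps F x\<close>.
\<close>

record (overloaded) ('k, 'a::zero) free_complex =
  gens :: "int \<Rightarrow> nat set"
  gdeg :: "int \<Rightarrow> nat \<Rightarrow> int"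
  dif :: "int \<Rightarrow> nat \<Rightarrow> (nat \<Rightarrow>\<^sub>0 'a)"
  eps :: "nat \<Rightarrow> 'k"

text \<open>
  For a free module with basis X, its tensor product with N is the direct sum of copies of N indexed
  by X, the copy at x being shifted by the degree of x: the function f stands for the sum of the
  x \<open>\<otimes>\<close> f(x). \<open>chains F N i j\<close> is the component of internal degree j of the i-th module of the
  complex tensored with N, and \<open>bd F N i\<close> is the induced differential out of it. For N = A this is
  the complex F itself.
\<close>

definition chains ::
  "('k, 'a::zero) free_complex \<Rightarrow> ('a, 'm::zero) graded_mod \<Rightarrow> int \<Rightarrow> int \<Rightarrow> (nat \<Rightarrow>\<^sub>0 'm) set" where
  "chains F N i j = {f. Poly_Mapping.keys f \<subseteq> gens F i \<and>
     (\<forall>x\<in>gens F i. Poly_Mapping.lookup f x \<in> hcomp N (j - gdeg F i x))}"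

definition bd ::
  "('k, 'a::zero) free_complex \<Rightarrow> ('a, 'm::comm_monoid_add) graded_mod \<Rightarrow> int \<Rightarrow>
   (nat \<Rightarrow>\<^sub>0 'm) \<Rightarrow> (nat \<Rightarrow>\<^sub>0 'm)" where
  "bd F N i f = (\<Sum>x\<in>Poly_Mapping.keys f. \<Sum>y\<in>Poly_Mapping.keys (dif F i x).
     Poly_Mapping.single y (act N (Poly_Mapping.lookup (dif F i x) y) (Poly_Mapping.lookup f x)))"

definition eps_map ::
  "('k::field, 'a::comm_ring_1) graded_alg \<Rightarrow> ('k, 'a) free_complex \<Rightarrow> (nat \<Rightarrow>\<^sub>0 'a) \<Rightarrow> 'k" where
  "eps_map A F f =
     (\<Sum>x\<in>Poly_Mapping.keys f. act (residue_mod A) (Poly_Mapping.lookup f x) (eps F x))"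

text \<open>
  F is a resolution of k by graded free A-modules. Exactness is required in each internal degree.
\<close>

definition is_free_resolution ::
  "('k::field, 'a::comm_ring_1) graded_alg \<Rightarrow> ('k, 'a) free_complex \<Rightarrow> bool" where
  "is_free_resolution A F \<longleftrightarrow>
     (\<forall>i<0. gens F i = {}) \<and>
     (\<forall>i. \<forall>x\<in>gens F i. dif F i x \<in> chains F (regular_mod A) (i - 1) (gdeg F i x)) \<and>
     (\<forall>x\<in>gens F 0. eps F x \<in> hcomp (residue_mod A) (gdeg F 0 x)) \<and>
     (\<forall>j. eps_map A F ` chains F (regular_mod A) 0 j = hcomp (residue_mod A) j) \<and>
     (\<forall>j. {f \<in> chains F (regular_mod A) 0 j. eps_map A F f = 0} =
        bd F (regular_mod A) 1 ` chains F (regular_mod A) 1 j) \<and>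
     (\<forall>i>0. \<forall>j. {f \<in> chains F (regular_mod A) i j. bd F (regular_mod A) i f = 0} =
        bd F (regular_mod A) (i + 1) ` chains F (regular_mod A) (i + 1) j)"

text \<open>
  The homology of the complex does not depend on the resolution. For a graded algebra A with
  component k in degree 0 and finite-dimensional components, a resolution with bases labelled by
  natural numbers exists: the kernel to be covered at each stage has countable dimension over k in
  each degree, and hence a countable set of homogeneous generators.
\<close>

definition free_resolution ::
  "('k::field, 'a::comm_ring_1) graded_alg \<Rightarrow> ('k, 'a) free_complex" where
  "free_resolution A = (SOME F. is_free_resolution A F)"

definition additive_monoid :: "'b::monoid_add set \<Rightarrow> 'b monoid" where
  "additive_monoid Z = \<lparr>carrier = Z, monoid.mult = (+), one = 0\<rparr>"

text \<open>
  \<open>Tor A N i j\<close> is the component of internal degree j of the i-th Tor over A of k and N, as an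
  additive group.
\<close>

definition Tor ::
  "('k::field, 'a::comm_ring_1) graded_alg \<Rightarrow> ('a, 'm::ab_group_add) graded_mod \<Rightarrow>
   int \<Rightarrow> int \<Rightarrow> (nat \<Rightarrow>\<^sub>0 'm) set monoid" where
  "Tor A N i j = (let F = free_resolution A in
     additive_monoid {z \<in> chains F N i j. bd F N i z = 0} Mod (bd F N (i + 1) ` chains F N (i + 1) j))"

text \<open>The supremum in \<open>ereal\<close> of the empty set is \<open>-\<infinity>\<close>.\<close>

definition top_degree :: "(int \<Rightarrow> 'b monoid) \<Rightarrow> ereal" where
  "top_degree V = Sup {ereal (of_int j) | j. carrier (V j) \<noteq> {\<one>\<^bsub>V j\<^esub>}}"

definition t_top ::
  "('k::field, 'a::comm_ring_1) graded_alg \<Rightarrow> ('a, 'm::ab_group_add) graded_mod \<Rightarrow> int \<Rightarrow> ereal" where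
  "t_top A N i = top_degree (Tor A N i)"

definition reg_upto ::
  "int \<Rightarrow> ('k::field, 'a::comm_ring_1) graded_alg \<Rightarrow> ('a, 'm::ab_group_add) graded_mod \<Rightarrow> ereal" where
  "reg_upto n A N = (SUP i\<in>{..n}. t_top A N i - ereal (of_int i))"


section \<open>The symmetric algebra on the degree 1 component\<close>

definition is_basis :: "('k::field \<Rightarrow> 'v::ab_group_add \<Rightarrow> 'v) \<Rightarrow> 'v set \<Rightarrow> 'v set \<Rightarrow> bool" where
  "is_basis s V B \<longleftrightarrow> B \<subseteq> V \<and> \<not> module.dependent s B \<and> module.span s B = V"

text \<open>
  The symmetric algebra on a vector space with basis B, as the standard graded polynomial ring
  k[B]: the polynomials all of whose monomials involve only variables in B.
\<close>

definition sym_alg :: "'v set \<Rightarrow> ('k::field, ('v \<Rightarrow>\<^sub>0 nat) \<Rightarrow>\<^sub>0 'k) graded_alg" where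
  "sym_alg B = \<lparr>scl = (\<lambda>c p. Poly_Mapping.single 0 c * p),
     gr = (\<lambda>n. {p. \<forall>m\<in>Poly_Mapping.keys p. Poly_Mapping.keys m \<subseteq> B \<and>
                    (\<Sum>v\<in>Poly_Mapping.keys m. Poly_Mapping.lookup m v) = n})\<rparr>"

text \<open>The canonical map to R takes the variable labelled by an element of B to that element.\<close>

definition canonical_map ::
  "('k::field, 'a::comm_ring_1) graded_alg \<Rightarrow> (('a \<Rightarrow>\<^sub>0 nat) \<Rightarrow>\<^sub>0 'k) \<Rightarrow> 'a" where
  "canonical_map R p = (\<Sum>m\<in>Poly_Mapping.keys p.
     scl R (Poly_Mapping.lookup p m) (\<Prod>v\<in>Poly_Mapping.keys m. v ^ Poly_Mapping.lookup m v))"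

definition sym_mod ::
  "('k::field, 'a::comm_ring_1) graded_alg \<Rightarrow> (('a \<Rightarrow>\<^sub>0 nat) \<Rightarrow>\<^sub>0 'k, 'a) graded_mod" where
  "sym_mod R = \<lparr>hcomp = int_gr R, act = (\<lambda>p r. canonical_map R p * r)\<rparr>"

definition t_syz :: "('k::field, 'a::comm_ring_1) graded_alg \<Rightarrow> 'a set \<Rightarrow> int \<Rightarrow> ereal" where
  "t_syz R B i = t_top (sym_alg B :: ('k, ('a \<Rightarrow>\<^sub>0 nat) \<Rightarrow>\<^sub>0 'k) graded_alg) (sym_mod R) i"

definition m_num :: "('k::field, 'a::comm_ring_1) graded_alg \<Rightarrow> 'a set \<Rightarrow> nat" where
  "m_num R B = (LEAST i. t_syz R B (int i) \<ge> t_syz R B (int i + 1))"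

end

theory Submission
  imports Defs "HOL-Library.Countable_Set" "HOL-Library.Nat_Bijection"
begin

text \<open>
  The degrees \<open>t_syz R B i\<close> are the top degrees of the Koszul homology of R: the Koszul complex over the
  polynomial ring is a resolution of k (\<open>koszul_resolution\<close>), and Tor does not depend on the resolution
  (\<open>tor_vanishes_change_resolution\<close>). Let Z, B and H denote the cycles, boundaries and homology of the
  Koszul complex K over R.

  The exterior algebra structure relates the cycles in degree a + b to those in degrees a and b. The
  comultiplication takes a cycle z of exterior degree a + b to an a-cycle of the complex K with coefficients in
  the module \<open>Z_b\<close>, and multiplication takes it back to binom(a + b, a) z. The product of a cycle and a
  boundary is a boundary. So if every a-cycle with coefficients in \<open>Z_b\<close> of degree d is a sum of tensors
  of elements of \<open>Z_a\<close> and \<open>Z_b\<close>, and \<open>d > t_a + t_b\<close>, then in each summand one factor is a boundary and the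
  homology of K vanishes at (a + b, d).

  The obstruction to the assumption on cycles with coefficients is a change of rings phenomenon: it is bounded
  in terms of the homologies \<open>H_p\<close> with \<open>p < a\<close> and the Tor over R of k and \<open>Z_b\<close> in homological
  degree a - p (\<open>koszul_cycles_tensor\<close>). That Tor in turn is found by dimension shifting along the exact
  sequences with terms \<open>Z_q\<close>, \<open>K_q\<close>, \<open>B_(q-1)\<close> and \<open>B_q\<close>, \<open>Z_q\<close>, \<open>H_q\<close> (\<open>tor_cycles\<close>): the homology \<open>H_q\<close>
  is a sum of shifted copies of k, whose Tor over R is controlled by the assumption on the regularity. As
  the \<open>t_q\<close> increase strictly up to \<open>m(R)\<close>, the largest contributions come from p = a - 1 and q = b - 1,
  and they are of degree at most \<open>t_(a-1) + t_(b-1) + 3\<close>.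

  The bound for b = 1 follows from the case i = 0 of the same dimension shift: \<open>Z_(a+1)\<close> is generated in
  degrees up to \<open>t_a + 2\<close>, and decomposable cycles are boundaries (\<open>irrelevant_annihilates\<close>). For
  \<open>b \<ge> 2\<close> the strict increase of the \<open>t_q\<close> turns the first bound into the second.

  The modules of cycles and boundaries and all syzygy modules are graded submodules of free modules with bases
  labelled by natural numbers, so that induction along syzygies stays within one type. Exact sequences are
  used degree by degree, and only through the vanishing of Tor in single degrees.
\<close>

section \<open>Graded algebras, graded modules and chain complexes\<close>

abbreviation "lookup \<equiv> Poly_Mapping.lookup"
abbreviation "keys \<equiv> Poly_Mapping.keys"
abbreviation "single \<equiv> Poly_Mapping.single"
abbreviation "mapp \<equiv> Poly_Mapping.mapp"

lemma lookup_mapp0: "(\<And>x. x \<in> keys f \<or> h x 0 = 0) \<Longrightarrow> lookup (mapp h f) x = h x (lookup f x)"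
  by (auto simp: Poly_Mapping.lookup_mapp when_def in_keys_iff)

lemma keys_mapp: "keys (mapp h f) \<subseteq> keys f"
  by (rule Poly_Mapping.keys_mapp_subset)

lemma poly_mapping_sum_single: "f = (\<Sum>x\<in>keys f. single x (lookup f x))"
  by (rule poly_mapping_eqI) (simp add: lookup_sum lookup_single when_def in_keys_iff)

lemma poly_mapping_choice:
  assumes "finite X" "\<And>x. x \<in> X \<Longrightarrow> \<exists>m. P x m"
  shows "\<exists>f. keys f \<subseteq> X \<and> (\<forall>x\<in>X. P x (lookup f x))"
proof -
  obtain h where h: "\<And>x. x \<in> X \<Longrightarrow> P x (h x)" using assms(2) by metis
  let ?h = "\<lambda>x. if x \<in> X then h x else 0"
  have "finite {x. ?h x \<noteq> 0}" by (rule finite_subset[OF _ assms(1)]) auto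
  then have "lookup (Abs_poly_mapping ?h) = ?h" by simp
  then show ?thesis using h by (intro exI[of _ "Abs_poly_mapping ?h"]) (auto simp: in_keys_iff split: if_splits)
qed

lemma chainsI:
  "keys f \<subseteq> gens F i \<Longrightarrow> (\<And>x. x \<in> gens F i \<Longrightarrow> lookup f x \<in> hcomp N (j - gdeg F i x)) \<Longrightarrow>
     f \<in> chains F N i j"
  by (simp add: chains_def)

lemma chains_keys: "f \<in> chains F N i j \<Longrightarrow> keys f \<subseteq> gens F i"
  by (simp add: chains_def)

lemma chains_lookup: "f \<in> chains F N i j \<Longrightarrow> x \<in> gens F i \<Longrightarrow> lookup f x \<in> hcomp N (j - gdeg F i x)"
  by (simp add: chains_def)

lemma chains_outside: "f \<in> chains F N i j \<Longrightarrow> x \<notin> gens F i \<Longrightarrow> lookup f x = 0"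
  using chains_keys[of f F N i j] by (auto simp: in_keys_iff)

text \<open>The pure tensor \<open>v \<otimes> m\<close> of a chain v of the free complex and an element m of N.\<close>

definition tensor :: "('a, 'm::zero) graded_mod \<Rightarrow> ('l \<Rightarrow>\<^sub>0 'a::zero) \<Rightarrow> 'm \<Rightarrow> ('l \<Rightarrow>\<^sub>0 'm)" where
  "tensor N v m = mapp (\<lambda>_ a. act N a m) v"

locale graded_module =
  fixes A :: "('k, 'a::comm_ring_1) graded_alg" and N :: "('a, 'm::ab_group_add) graded_mod"
  assumes hcomp_0 [simp]: "0 \<in> hcomp N j"
    and hcomp_add: "m \<in> hcomp N j \<Longrightarrow> m' \<in> hcomp N j \<Longrightarrow> m + m' \<in> hcomp N j"
    and hcomp_uminus: "m \<in> hcomp N j \<Longrightarrow> - m \<in> hcomp N j"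
    and act_add: "act N x (m + m') = act N x m + act N x m'"
    and add_act: "act N (x + y) m = act N x m + act N y m"
    and mult_act: "act N (x * y) m = act N x (act N y m)"
    and one_act [simp]: "act N 1 m = m"
    and act_hcomp: "x \<in> gr A i \<Longrightarrow> m \<in> hcomp N j \<Longrightarrow> act N x m \<in> hcomp N (int i + j)"
begin

lemma hcomp_sum: "(\<And>x. x \<in> X \<Longrightarrow> h x \<in> hcomp N j) \<Longrightarrow> sum h X \<in> hcomp N j"
  by (induction X rule: infinite_finite_induct) (auto intro: hcomp_add)

lemma act_0 [simp]: "act N x 0 = 0"
  using act_add[of x 0 0] by simp

lemma zero_act [simp]: "act N 0 m = 0"
  using add_act[of 0 0 m] by simp

lemma uminus_act: "act N (- x) m = - act N x m"
  using add_act[of x "- x" m] by (simp add: add_eq_0_iff)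

lemma diff_act: "act N (x - y) m = act N x m - act N y m"
  using add_act[of x "- y" m] by (simp add: uminus_act)

lemma act_sum: "act N x (sum h X) = (\<Sum>y\<in>X. act N x (h y))"
  by (induction X rule: infinite_finite_induct) (auto simp: act_add)

lemma sum_act: "act N (sum h X) m = (\<Sum>y\<in>X. act N (h y) m)"
  by (induction X rule: infinite_finite_induct) (auto simp: add_act)

lemma act_int_gr:
  assumes "x \<in> int_gr A i" "m \<in> hcomp N j" shows "act N x m \<in> hcomp N (i + j)"
proof (cases "0 \<le> i")
  case True
  then show ?thesis using assms act_hcomp[of x "nat i" m j] by (simp add: int_gr_def)
next
  case False
  then show ?thesis using assms by (simp add: int_gr_def)
qed

lemma lookup_bd:
  "lookup (bd F N i f) y = (\<Sum>x\<in>keys f. act N (lookup (dif F i x) y) (lookup f x))"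
  by (auto simp: bd_def lookup_sum lookup_single when_def in_keys_iff intro!: sum.cong)

lemma lookup_bd_superset:
  assumes "finite T" "keys f \<subseteq> T"
  shows "lookup (bd F N i f) y = (\<Sum>x\<in>T. act N (lookup (dif F i x) y) (lookup f x))"
  unfolding lookup_bd by (rule sum.mono_neutral_left) (use assms in \<open>auto simp: in_keys_iff\<close>)

lemma bd_0 [simp]: "bd F N i 0 = 0"
  by (simp add: bd_def)

lemma bd_add: "bd F N i (f + g) = bd F N i f + bd F N i g"
proof (rule poly_mapping_eqI)
  fix y
  have "keys (f + g) \<subseteq> keys f \<union> keys g" by (rule Poly_Mapping.keys_add)
  then show "lookup (bd F N i (f + g)) y = lookup (bd F N i f + bd F N i g) y"
    by (simp add: lookup_bd_superset[of "keys f \<union> keys g"] lookup_add act_add sum.distrib)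
qed

lemma bd_uminus: "bd F N i (- f) = - bd F N i f"
  using bd_add[of F i f "- f"] by (simp add: add_eq_0_iff)

lemma bd_diff: "bd F N i (f - g) = bd F N i f - bd F N i g"
  using bd_add[of F i f "- g"] by (simp add: bd_uminus)

lemma bd_sum: "bd F N i (sum h X) = (\<Sum>x\<in>X. bd F N i (h x))"
  by (induction X rule: infinite_finite_induct) (auto simp: bd_add)

lemma chains_0 [simp]: "0 \<in> chains F N i j"
  by (simp add: chains_def)

lemma chains_add: "f \<in> chains F N i j \<Longrightarrow> g \<in> chains F N i j \<Longrightarrow> f + g \<in> chains F N i j"
  using Poly_Mapping.keys_add[of f g] by (auto simp: chains_def lookup_add intro: hcomp_add)

lemma chains_uminus: "f \<in> chains F N i j \<Longrightarrow> - f \<in> chains F N i j"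
  by (auto simp: chains_def in_keys_iff intro: hcomp_uminus)

lemma chains_diff: "f \<in> chains F N i j \<Longrightarrow> g \<in> chains F N i j \<Longrightarrow> f - g \<in> chains F N i j"
  using chains_add[of f F i j "- g"] chains_uminus[of g F i j] by simp

lemma chains_sum: "(\<And>x. x \<in> X \<Longrightarrow> h x \<in> chains F N i j) \<Longrightarrow> sum h X \<in> chains F N i j"
  by (induction X rule: infinite_finite_induct) (auto intro: chains_add)

lemma lookup_tensor [simp]: "lookup (tensor N v m) x = act N (lookup v x) m"
  by (simp add: tensor_def lookup_mapp0)

lemma tensor_0 [simp]: "tensor N 0 m = 0"
  by (rule poly_mapping_eqI) simp

lemma keys_tensor: "keys (tensor N v m) \<subseteq> keys v"
  unfolding tensor_def by (rule keys_mapp)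

lemma bd_tensor: "bd F N i (tensor N v m) = tensor N (bd F (regular_mod A) i v) m"
proof (rule poly_mapping_eqI)
  fix y
  have *: "lookup (bd F (regular_mod A) i v) y = (\<Sum>x\<in>keys v. lookup (dif F i x) y * lookup v x)"
    by (auto simp: bd_def lookup_sum lookup_single when_def in_keys_iff regular_mod_def intro!: sum.cong)
  show "lookup (bd F N i (tensor N v m)) y = lookup (tensor N (bd F (regular_mod A) i v) m) y"
    by (simp add: lookup_bd_superset[OF _ keys_tensor] * sum_act mult_act)
qed

lemma tensor_chains:
  assumes "v \<in> chains F (regular_mod A) i j" "m \<in> hcomp N l"
  shows "tensor N v m \<in> chains F N i (j + l)"
  unfolding chains_def
proof (intro CollectI conjI ballI)
  show "keys (tensor N v m) \<subseteq> gens F i" using keys_tensor[of v m] assms by (auto simp: chains_def)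
  fix x assume "x \<in> gens F i"
  then have "lookup v x \<in> int_gr A (j - gdeg F i x)"
    using assms by (auto simp: chains_def regular_mod_def)
  from act_int_gr[OF this assms(2)]
  show "lookup (tensor N v m) x \<in> hcomp N (j + l - gdeg F i x)"
    by (simp add: algebra_simps)
qed

lemma sum_tensor: "f = (\<Sum>x\<in>keys f. tensor N (single x 1) (lookup f x))"
  by (rule poly_mapping_eqI)
     (simp add: lookup_sum lookup_single when_def in_keys_iff if_distrib[of "\<lambda>a. act N a _"] cong: if_cong)

end

text \<open>The common structure of R and of the polynomial ring. The direct sum decomposition enters through
  the values of the augmentation on homogeneous elements, because the polynomial ring on B does not
  exhaust its type. Countably spanned components make it possible to label generators of modules by
  natural numbers.\<close>

locale graded_connected_algebra = vector_space "scl A"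
  for A :: "('k::field, 'a::comm_ring_1) graded_alg" +
  assumes scl_mult: "scl A c (x * y) = scl A c x * y"
    and gr_subspace: "subspace (gr A i)"
    and gr_mult: "x \<in> gr A i \<Longrightarrow> y \<in> gr A j \<Longrightarrow> x * y \<in> gr A (i + j)"
    and gr_0: "gr A 0 = range (\<lambda>c. scl A c 1)"
    and augmentation_scl: "augmentation A (scl A c 1) = c"
    and augmentation_pos: "0 < i \<Longrightarrow> x \<in> gr A i \<Longrightarrow> augmentation A x = 0"
    and gr_countable: "\<exists>C. countable C \<and> gr A i \<subseteq> span C"
begin

lemma scl_eq: "scl A c x = scl A c 1 * x"
  using scl_mult[of c 1 x] by simp

lemma int_gr_0 [simp]: "0 \<in> int_gr A i"
  using subspace_0[OF gr_subspace] by (simp add: int_gr_def)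

lemma int_gr_add: "x \<in> int_gr A i \<Longrightarrow> y \<in> int_gr A i \<Longrightarrow> x + y \<in> int_gr A i"
  using subspace_add[OF gr_subspace] by (auto simp: int_gr_def split: if_splits)

lemma int_gr_uminus: "x \<in> int_gr A i \<Longrightarrow> - x \<in> int_gr A i"
  using subspace_neg[OF gr_subspace] by (auto simp: int_gr_def split: if_splits)

lemma int_gr_mult: "x \<in> int_gr A i \<Longrightarrow> y \<in> int_gr A j \<Longrightarrow> x * y \<in> int_gr A (i + j)"
  using gr_mult[of x "nat i" y "nat j"] subspace_0[OF gr_subspace]
  by (auto simp: int_gr_def nat_add_distrib split: if_splits)

lemma one_int_gr [simp]: "1 \<in> int_gr A 0"
proof -
  have "1 = scl A 1 1" by simp
  then show ?thesis unfolding int_gr_def using gr_0 by (metis nat_zero_as_int order_refl rangeI nat_0)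
qed

lemma scl_int_gr [simp]: "scl A c 1 \<in> int_gr A 0"
  by (simp add: int_gr_def gr_0)

lemma gr_int_gr: "x \<in> gr A i \<Longrightarrow> x \<in> int_gr A (int i)"
  by (simp add: int_gr_def)

lemma regular_module: "graded_module A (regular_mod A)"
  by unfold_locales
     (auto simp: regular_mod_def distrib_left distrib_right mult.assoc intro: int_gr_add int_gr_uminus
       int_gr_mult[OF gr_int_gr])

sublocale reg: graded_module A "regular_mod A"
  by (rule regular_module)

lemma augmentation_0 [simp]: "augmentation A 0 = 0"
  using augmentation_scl[of 0] by simp

lemma augmentation_int_gr: "x \<in> int_gr A i \<Longrightarrow> i \<noteq> 0 \<Longrightarrow> augmentation A x = 0"
  using augmentation_pos[of "nat i" x] by (auto simp: int_gr_def split: if_splits)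

lemma int_gr_0_cases: "x \<in> int_gr A 0 \<Longrightarrow> \<exists>c. x = scl A c 1"
  by (auto simp: int_gr_def gr_0)

lemma augmentation_add_int_gr:
  assumes "x \<in> int_gr A i" "y \<in> int_gr A i"
  shows "augmentation A (x + y) = augmentation A x + augmentation A y"
proof (cases "i = 0")
  case True
  obtain c d where "x = scl A c 1" "y = scl A d 1" using assms int_gr_0_cases True by metis
  then show ?thesis by (metis augmentation_scl scale_left_distrib)
next
  case False
  then show ?thesis using assms int_gr_add[OF assms] by (simp add: augmentation_int_gr)
qed

lemma augmentation_uminus_int_gr:
  assumes "x \<in> int_gr A i" shows "augmentation A (- x) = - augmentation A x"
  using augmentation_add_int_gr[OF assms int_gr_uminus[OF assms]] by (simp add: add_eq_0_iff)

lemma augmentation_sum_int_gr: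
  "(\<And>x. x \<in> X \<Longrightarrow> h x \<in> int_gr A i) \<Longrightarrow>
    augmentation A (sum h X) = (\<Sum>x\<in>X. augmentation A (h x)) \<and> sum h X \<in> int_gr A i"
proof (induction X rule: infinite_finite_induct)
  case (insert x X)
  then show ?case using augmentation_add_int_gr[of "h x" i "sum h X"] by (simp add: int_gr_add)
qed simp_all

lemma augmentation_scl_mult_int_gr:
  assumes "x \<in> int_gr A i"
  shows "augmentation A (scl A c 1 * x) = c * augmentation A x"
proof (cases "i = 0")
  case True
  obtain d where "x = scl A d 1" using assms int_gr_0_cases True by metis
  then have "scl A c 1 * x = scl A (c * d) 1" by (simp add: scl_eq[symmetric])
  then show ?thesis using \<open>x = _\<close> by (simp add: augmentation_scl)
next
  case False
  have "scl A c 1 * x \<in> int_gr A i" using int_gr_mult[OF scl_int_gr assms, of c] by simp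
  then show ?thesis using assms False by (simp add: augmentation_int_gr)
qed

end

text \<open>A degreewise linear map of graded modules; it need only be defined on homogeneous elements of
  a known degree, so the degree is an argument.\<close>

locale graded_hom = dom: graded_module A G + cod: graded_module A N
  for A :: "('k, 'a::comm_ring_1) graded_alg" and G :: "('a, 'm::ab_group_add) graded_mod"
    and N :: "('a, 'n::ab_group_add) graded_mod" +
  fixes \<phi> :: "int \<Rightarrow> 'm \<Rightarrow> 'n"
  assumes hom_hcomp: "m \<in> hcomp G j \<Longrightarrow> \<phi> j m \<in> hcomp N j"
    and hom_add: "m \<in> hcomp G j \<Longrightarrow> m' \<in> hcomp G j \<Longrightarrow> \<phi> j (m + m') = \<phi> j m + \<phi> j m'"
    and hom_act: "x \<in> gr A i \<Longrightarrow> m \<in> hcomp G j \<Longrightarrow> \<phi> (int i + j) (act G x m) = act N x (\<phi> j m)"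
begin

lemma hom_0 [simp]: "\<phi> j 0 = 0"
  using hom_add[of 0 j 0] by simp

lemma hom_uminus: "m \<in> hcomp G j \<Longrightarrow> \<phi> j (- m) = - \<phi> j m"
  using hom_add[of m j "- m"] by (simp add: dom.hcomp_uminus add_eq_0_iff)

lemma hom_diff: "m \<in> hcomp G j \<Longrightarrow> m' \<in> hcomp G j \<Longrightarrow> \<phi> j (m - m') = \<phi> j m - \<phi> j m'"
  using hom_add[of m j "- m'"] by (simp add: dom.hcomp_uminus hom_uminus)

lemma hom_sum: "(\<And>x. x \<in> X \<Longrightarrow> h x \<in> hcomp G j) \<Longrightarrow> \<phi> j (sum h X) = (\<Sum>x\<in>X. \<phi> j (h x))"
  by (induction X rule: infinite_finite_induct) (auto simp: hom_add dom.hcomp_sum)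

lemma hom_act_int_gr:
  assumes "x \<in> int_gr A i" "m \<in> hcomp G j"
  shows "\<phi> (i + j) (act G x m) = act N x (\<phi> j m)"
proof (cases "0 \<le> i")
  case True
  then show ?thesis using assms hom_act[of x "nat i" m j] by (simp add: int_gr_def)
next
  case False
  then show ?thesis using assms by (simp add: int_gr_def)
qed

definition chain_map :: "('k, 'a) free_complex \<Rightarrow> int \<Rightarrow> int \<Rightarrow> (nat \<Rightarrow>\<^sub>0 'm) \<Rightarrow> (nat \<Rightarrow>\<^sub>0 'n)" where
  "chain_map F i j f = mapp (\<lambda>x. \<phi> (j - gdeg F i x)) f"

lemma lookup_chain_map [simp]: "lookup (chain_map F i j f) x = \<phi> (j - gdeg F i x) (lookup f x)"
  by (simp add: chain_map_def lookup_mapp0)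

lemma chain_map_chains: "f \<in> chains F G i j \<Longrightarrow> chain_map F i j f \<in> chains F N i j"
  using keys_mapp[of "\<lambda>x. \<phi> (j - gdeg F i x)" f]
  by (auto simp: chains_def hom_hcomp) (auto simp: chain_map_def)

lemma chain_map_diff:
  assumes "f \<in> chains F G i j" "g \<in> chains F G i j"
  shows "chain_map F i j (f - g) = chain_map F i j f - chain_map F i j g"
proof (rule poly_mapping_eqI)
  fix x
  show "lookup (chain_map F i j (f - g)) x = lookup (chain_map F i j f - chain_map F i j g) x"
  proof (cases "x \<in> gens F i")
    case True
    then show ?thesis using assms by (simp add: chains_def lookup_minus hom_diff)
  next
    case False
    then have "lookup f x = 0" "lookup g x = 0" using assms by (auto simp: chains_def in_keys_iff)
    then show ?thesis by (simp add: lookup_minus)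
  qed
qed

definition kernel :: "('a, 'm) graded_mod" where
  "kernel = \<lparr>hcomp = (\<lambda>j. {m \<in> hcomp G j. \<phi> j m = 0}), act = act G\<rparr>"

lemma hcomp_kernel: "hcomp kernel j = {m \<in> hcomp G j. \<phi> j m = 0}"
  and act_kernel [simp]: "act kernel = act G"
  by (simp_all add: kernel_def)

lemma bd_kernel [simp]: "bd F kernel = bd F G"
  by (intro ext) (simp add: bd_def)

lemma kernel_module: "graded_module A kernel"
  by unfold_locales
    (auto simp: hcomp_kernel dom.hcomp_add hom_add dom.hcomp_uminus hom_uminus dom.act_add dom.add_act
       dom.mult_act dom.act_hcomp hom_act)

lemma chains_kernel_iff:
  "f \<in> chains F kernel i j \<longleftrightarrow> f \<in> chains F G i j \<and> chain_map F i j f = 0"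
proof
  assume f: "f \<in> chains F kernel i j"
  have "lookup (chain_map F i j f) x = 0" for x
    using chains_outside[OF f, of x] chains_lookup[OF f, of x]
    by (cases "x \<in> gens F i") (auto simp: hcomp_kernel)
  then have "chain_map F i j f = 0" by (intro poly_mapping_eqI) simp
  moreover have "f \<in> chains F G i j"
    using chains_keys[OF f] chains_lookup[OF f] by (intro chainsI) (auto simp: hcomp_kernel)
  ultimately show "f \<in> chains F G i j \<and> chain_map F i j f = 0" by simp
next
  assume f: "f \<in> chains F G i j \<and> chain_map F i j f = 0"
  then have "\<phi> (j - gdeg F i x) (lookup f x) = 0" for x
    by (metis lookup_chain_map lookup_zero)
  then show "f \<in> chains F kernel i j"
    using f chains_keys[of f F G i j] chains_lookup[of f F G i j]
    by (intro chainsI) (auto simp: hcomp_kernel)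
qed

text \<open>Tensoring with a free module is exact: preimages can be chosen separately at each basis element.\<close>

lemma chain_map_lift:
  assumes surj: "\<And>j. hcomp N j \<subseteq> \<phi> j ` hcomp G j" and h: "h \<in> chains F N i j"
  shows "\<exists>g \<in> chains F G i j. chain_map F i j g = h"
proof -
  have "\<exists>m. m \<in> hcomp G (j - gdeg F i x) \<and> \<phi> (j - gdeg F i x) m = lookup h x"
    if "x \<in> keys h" for x
  proof -
    have "lookup h x \<in> hcomp N (j - gdeg F i x)" using h that by (auto simp: chains_def)
    then show ?thesis using surj by fastforce
  qed
  then obtain g where g: "keys g \<subseteq> keys h"
      "\<And>x. x \<in> keys h \<Longrightarrow> lookup g x \<in> hcomp G (j - gdeg F i x) \<and> \<phi> (j - gdeg F i x) (lookup g x) = lookup h x"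
    using poly_mapping_choice[of "keys h" "\<lambda>x m. m \<in> hcomp G (j - gdeg F i x) \<and> \<phi> (j - gdeg F i x) m = lookup h x"]
    by auto
  have g0: "lookup g x = 0" "lookup h x = 0" if "x \<notin> keys h" for x
    using g(1) that by (auto simp: in_keys_iff)
  have "lookup g x \<in> hcomp G (j - gdeg F i x)" for x
    using g(2)[of x] g0(1)[of x] by (cases "x \<in> keys h") auto
  moreover have "keys g \<subseteq> gens F i" using g(1) h by (auto simp: chains_def)
  ultimately have "g \<in> chains F G i j" by (simp add: chains_def)
  moreover have "chain_map F i j g = h"
  proof (rule poly_mapping_eqI)
    fix x show "lookup (chain_map F i j g) x = lookup h x"
      using g(2)[of x] g0[of x] by (cases "x \<in> keys h") auto
  qed
  ultimately show ?thesis by blast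
qed

end

definition free_differential :: "('k, 'a::comm_ring_1) graded_alg \<Rightarrow> ('k, 'a) free_complex \<Rightarrow> bool" where
  "free_differential A F \<longleftrightarrow>
     (\<forall>i. \<forall>x\<in>gens F i. dif F i x \<in> chains F (regular_mod A) (i - 1) (gdeg F i x))"

lemma dif_gr:
  assumes "free_differential A F" "x \<in> gens F i" "y \<in> gens F (i - 1)"
  shows "lookup (dif F i x) y \<in> int_gr A (gdeg F i x - gdeg F (i - 1) y)"
  using assms chains_lookup[of "dif F i x" F "regular_mod A" "i - 1" "gdeg F i x" y]
  by (auto simp: free_differential_def regular_mod_def)

lemma dif_keys:
  assumes "free_differential A F" "x \<in> gens F i" "y \<notin> gens F (i - 1)"
  shows "lookup (dif F i x) y = 0"
  using assms by (auto simp: free_differential_def intro: chains_outside)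

lemma (in graded_module) bd_chains:
  assumes F: "free_differential A F" and f: "f \<in> chains F N i j"
  shows "bd F N i f \<in> chains F N (i - 1) j"
  unfolding chains_def
proof (intro CollectI conjI ballI subsetI)
  fix y assume "y \<in> keys (bd F N i f)"
  then have "(\<Sum>x\<in>keys f. act N (lookup (dif F i x) y) (lookup f x)) \<noteq> 0"
    by (simp add: in_keys_iff lookup_bd)
  then obtain x where "x \<in> keys f" "lookup (dif F i x) y \<noteq> 0"
    by (metis (no_types, lifting) sum.neutral zero_act)
  then show "y \<in> gens F (i - 1)" using dif_keys[OF F, of x i y] f by (auto simp: chains_def)
next
  fix y assume y: "y \<in> gens F (i - 1)"
  show "lookup (bd F N i f) y \<in> hcomp N (j - gdeg F (i - 1) y)"
    unfolding lookup_bd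
  proof (rule hcomp_sum)
    fix x assume "x \<in> keys f"
    then have x: "x \<in> gens F i" and fx: "lookup f x \<in> hcomp N (j - gdeg F i x)"
      using f by (auto simp: chains_def)
    from act_int_gr[OF dif_gr[OF F x y] fx]
    show "act N (lookup (dif F i x) y) (lookup f x) \<in> hcomp N (j - gdeg F (i - 1) y)" by simp
  qed
qed

lemma (in graded_module) bd_chains_Suc:
  "free_differential A F \<Longrightarrow> f \<in> chains F N (i + 1) j \<Longrightarrow> bd F N (i + 1) f \<in> chains F N i j"
  using bd_chains[of F f "i + 1" j] by (simp only: add_diff_cancel_right')

lemma (in graded_hom) chain_map_bd:
  assumes F: "free_differential A F" and f: "f \<in> chains F G i j"
  shows "chain_map F (i - 1) j (bd F G i f) = bd F N i (chain_map F i j f)"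
proof (rule poly_mapping_eqI)
  fix y
  have sub: "keys (chain_map F i j f) \<subseteq> keys f" unfolding chain_map_def by (rule keys_mapp)
  have r: "lookup (bd F N i (chain_map F i j f)) y =
      (\<Sum>x\<in>keys f. act N (lookup (dif F i x) y) (\<phi> (j - gdeg F i x) (lookup f x)))"
    by (simp add: cod.lookup_bd_superset[OF _ sub])
  show "lookup (chain_map F (i - 1) j (bd F G i f)) y = lookup (bd F N i (chain_map F i j f)) y"
  proof (cases "y \<in> gens F (i - 1)")
    case False
    then have "lookup (dif F i x) y = 0" if "x \<in> keys f" for x
      using dif_keys[OF F] f that by (auto simp: chains_def)
    then show ?thesis by (simp add: r dom.lookup_bd)
  next
    case y: True
    have *: "act G (lookup (dif F i x) y) (lookup f x) \<in> hcomp G (j - gdeg F (i - 1) y) \<and>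
         \<phi> (j - gdeg F (i - 1) y) (act G (lookup (dif F i x) y) (lookup f x)) =
         act N (lookup (dif F i x) y) (\<phi> (j - gdeg F i x) (lookup f x))" if "x \<in> keys f" for x
    proof -
      have x: "x \<in> gens F i" and fx: "lookup f x \<in> hcomp G (j - gdeg F i x)"
        using f that by (auto simp: chains_def)
      from dom.act_int_gr[OF dif_gr[OF F x y] fx] hom_act_int_gr[OF dif_gr[OF F x y] fx]
      show ?thesis by simp
    qed
    then show ?thesis by (simp add: r dom.lookup_bd hom_sum)
  qed
qed

lemma (in graded_hom) chain_map_bd_Suc:
  "free_differential A F \<Longrightarrow> f \<in> chains F G (i + 1) j \<Longrightarrow>
     chain_map F i j (bd F G (i + 1) f) = bd F N (i + 1) (chain_map F (i + 1) j f)"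
  using chain_map_bd[of F f "i + 1" j] by (simp only: add_diff_cancel_right')

text \<open>Only the vanishing of Tor groups in given degrees matters below, so the quotient group is avoided.\<close>

definition tor_vanishes ::
  "('k, 'a::zero) free_complex \<Rightarrow> ('a, 'm::ab_group_add) graded_mod \<Rightarrow> int \<Rightarrow> int \<Rightarrow> bool" where
  "tor_vanishes F N i j \<longleftrightarrow>
     (\<forall>f \<in> chains F N i j. bd F N i f = 0 \<longrightarrow> f \<in> bd F N (i + 1) ` chains F N (i + 1) j)"

definition complex :: "('k, 'a::comm_ring_1) graded_alg \<Rightarrow> ('k, 'a) free_complex \<Rightarrow> bool" where
  "complex A F \<longleftrightarrow> free_differential A F \<and>
     (\<forall>i. \<forall>x\<in>gens F (i + 1). bd F (regular_mod A) i (dif F (i + 1) x) = 0)"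

text \<open>Every chain is a sum of pure tensors, on which the differential acts through its values on the basis.\<close>

lemma (in graded_module) bd_bd:
  assumes F: "complex A F" and f: "keys f \<subseteq> gens F (i + 1)"
  shows "bd F N i (bd F N (i + 1) f) = 0"
proof -
  have "bd F N i (bd F N (i + 1) (tensor N (single x 1) m)) = 0" if "x \<in> gens F (i + 1)" for x m
  proof -
    have "bd F (regular_mod A) (i + 1) (single x 1) = dif F (i + 1) x"
      by (rule poly_mapping_eqI) (simp add: bd_def lookup_sum lookup_single when_def in_keys_iff regular_mod_def)
    then show ?thesis using F that by (simp add: bd_tensor complex_def)
  qed
  then have "bd F N i (bd F N (i + 1) (\<Sum>x\<in>keys f. tensor N (single x 1) (lookup f x))) = 0"
    unfolding bd_sum by (intro sum.neutral) (use f in auto)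
  then show ?thesis using sum_tensor[of f] by simp
qed

context graded_hom
begin

text \<open>The kernel of the map from the i-th Tor of the kernel of \<phi> to the i-th Tor of G is the image of the next Tor
  of N under the connecting homomorphism; here that map is injective, because this Tor of N vanishes.\<close>

lemma kernel_boundaries:
  assumes F: "complex A F" and surj: "\<And>j. hcomp N j \<subseteq> \<phi> j ` hcomp G j"
    and N: "tor_vanishes F N (i + 1) j"
    and f: "f \<in> chains F kernel i j" "f \<in> bd F G (i + 1) ` chains F G (i + 1) j"
  shows "f \<in> bd F G (i + 1) ` chains F kernel (i + 1) j"
proof -
  have D: "free_differential A F" using F by (simp add: complex_def)
  obtain g where g: "g \<in> chains F G (i + 1) j" "f = bd F G (i + 1) g" using f by blast
  let ?g = "chain_map F (i + 1) j g"
  have "bd F N (i + 1) ?g = 0"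
    using chain_map_bd_Suc[OF D g(1)] f(1) g(2) by (simp add: chains_kernel_iff)
  then obtain h where h: "h \<in> chains F N (i + 1 + 1) j" "?g = bd F N (i + 1 + 1) h"
    using N chain_map_chains[OF g(1)] by (auto simp: tor_vanishes_def)
  obtain h' where h': "h' \<in> chains F G (i + 1 + 1) j" "chain_map F (i + 1 + 1) j h' = h"
    using chain_map_lift[OF surj h(1)] by blast
  let ?b = "bd F G (i + 1 + 1) h'"
  have b: "?b \<in> chains F G (i + 1) j" using dom.bd_chains_Suc[OF D h'(1)] .
  have "chain_map F (i + 1) j (g - ?b) = 0"
    using chain_map_diff[OF g(1) b] chain_map_bd_Suc[OF D h'(1)] h h' by simp
  then have "g - ?b \<in> chains F kernel (i + 1) j"
    using g b by (simp add: chains_kernel_iff dom.chains_diff)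
  moreover have "bd F G (i + 1) (g - ?b) = f"
    using dom.bd_bd[OF F, of h' "i + 1"] h'(1) g(2) by (simp add: dom.bd_diff chains_def)
  ultimately show ?thesis by blast
qed

text \<open>Conversely, a class in the Tor of N that goes to 0 under the connecting homomorphism comes from G.\<close>

lemma tor_vanishes_cokernel:
  assumes F: "complex A F" and surj: "\<And>j. hcomp N j \<subseteq> \<phi> j ` hcomp G j"
    and G: "tor_vanishes F G (i + 1) j"
    and inj: "\<And>f. f \<in> chains F kernel i j \<Longrightarrow> f \<in> bd F G (i + 1) ` chains F G (i + 1) j \<Longrightarrow>
       f \<in> bd F G (i + 1) ` chains F kernel (i + 1) j"
  shows "tor_vanishes F N (i + 1) j"
  unfolding tor_vanishes_def
proof (intro ballI impI)
  have D: "free_differential A F" using F by (simp add: complex_def)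
  fix f assume f: "f \<in> chains F N (i + 1) j" "bd F N (i + 1) f = 0"
  obtain g where g: "g \<in> chains F G (i + 1) j" "chain_map F (i + 1) j g = f"
    using chain_map_lift[OF surj f(1)] by blast
  let ?b = "bd F G (i + 1) g"
  have "?b \<in> chains F G i j" using dom.bd_chains_Suc[OF D g(1)] .
  moreover have "chain_map F i j ?b = 0"
    using chain_map_bd_Suc[OF D g(1)] g(2) f(2) by simp
  ultimately have "?b \<in> chains F kernel i j" by (simp add: chains_kernel_iff)
  from inj[OF this] obtain g' where g': "g' \<in> chains F kernel (i + 1) j" "?b = bd F G (i + 1) g'"
    using g(1) by blast
  have g'G: "g' \<in> chains F G (i + 1) j" "chain_map F (i + 1) j g' = 0"
    using g'(1) by (auto simp: chains_kernel_iff)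
  have "bd F G (i + 1) (g - g') = 0" using g'(2) by (simp add: dom.bd_diff)
  then obtain h where h: "h \<in> chains F G (i + 1 + 1) j" "g - g' = bd F G (i + 1 + 1) h"
    using G dom.chains_diff[OF g(1) g'G(1)] by (auto simp: tor_vanishes_def)
  have "f = chain_map F (i + 1) j (g - g')"
    using chain_map_diff[OF g(1) g'G(1)] g(2) g'G(2) by simp
  also have "\<dots> = bd F N (i + 1 + 1) (chain_map F (i + 1 + 1) j h)"
    using chain_map_bd_Suc[OF D h(1)] h(2) by simp
  finally show "f \<in> bd F N (i + 1 + 1) ` chains F N (i + 1 + 1) j"
    using chain_map_chains[OF h(1)] by blast
qed

lemma tor_vanishes_kernel:
  assumes F: "complex A F" and surj: "\<And>j. hcomp N j \<subseteq> \<phi> j ` hcomp G j"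
    and N: "tor_vanishes F N (i + 1) j" and G: "tor_vanishes F G i j"
  shows "tor_vanishes F kernel i j"
  unfolding tor_vanishes_def bd_kernel
proof (intro ballI impI)
  fix f assume f: "f \<in> chains F kernel i j" "bd F G i f = 0"
  then have "f \<in> bd F G (i + 1) ` chains F G (i + 1) j"
    using G by (auto simp: tor_vanishes_def chains_kernel_iff)
  then show "f \<in> bd F G (i + 1) ` chains F kernel (i + 1) j"
    by (rule kernel_boundaries[OF F surj N f(1)])
qed

lemma tor_vanishes_quotient:
  assumes F: "complex A F" and surj: "\<And>j. hcomp N j \<subseteq> \<phi> j ` hcomp G j"
    and G: "tor_vanishes F G (i + 1) j" and K: "tor_vanishes F kernel i j"
  shows "tor_vanishes F N (i + 1) j"
proof (rule tor_vanishes_cokernel[OF F surj G])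
  fix f assume f: "f \<in> chains F kernel i j" "f \<in> bd F G (i + 1) ` chains F G (i + 1) j"
  then have "bd F G i f = 0" using dom.bd_bd[OF F] by (auto simp: chains_def)
  then show "f \<in> bd F G (i + 1) ` chains F kernel (i + 1) j"
    using K f(1) by (simp add: tor_vanishes_def)
qed

end

section \<open>Direct sums of shifted copies of a module\<close>

text \<open>With the algebra as the module these are the graded free modules; with the residue field they are
  the graded modules annihilated by the irrelevant ideal.\<close>

definition copower ::
  "'l set \<Rightarrow> ('l \<Rightarrow> int) \<Rightarrow> ('a, 'm::zero) graded_mod \<Rightarrow> ('a, 'l \<Rightarrow>\<^sub>0 'm) graded_mod" where
  "copower X e M = \<lparr>hcomp = (\<lambda>j. {q. keys q \<subseteq> X \<and> (\<forall>x\<in>X. lookup q x \<in> hcomp M (j - e x))}),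
     act = (\<lambda>a q. mapp (\<lambda>_ m. act M a m) q)\<rparr>"

lemma hcomp_copowerI:
  "keys q \<subseteq> X \<Longrightarrow> (\<And>x. x \<in> X \<Longrightarrow> lookup q x \<in> hcomp M (j - e x)) \<Longrightarrow> q \<in> hcomp (copower X e M) j"
  by (simp add: copower_def)

lemma hcomp_copower_keys: "q \<in> hcomp (copower X e M) j \<Longrightarrow> keys q \<subseteq> X"
  by (simp add: copower_def)

lemma hcomp_copower_lookup:
  "q \<in> hcomp (copower X e M) j \<Longrightarrow> x \<in> X \<Longrightarrow> lookup q x \<in> hcomp M (j - e x)"
  by (simp add: copower_def)

lemma hcomp_copower_outside: "q \<in> hcomp (copower X e M) j \<Longrightarrow> x \<notin> X \<Longrightarrow> lookup q x = 0"
  using hcomp_copower_keys[of q X e M j] by (auto simp: in_keys_iff)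

lemma act_regular [simp]: "act (regular_mod A) x y = x * y"
  and hcomp_regular [simp]: "hcomp (regular_mod A) = int_gr A"
  by (simp_all add: regular_mod_def)

context graded_module
begin

lemma lookup_copower_act [simp]: "lookup (act (copower X e N) a q) x = act N a (lookup q x)"
  by (simp add: copower_def lookup_mapp0)

lemma copower_module: "graded_module A (copower X e N)"
proof
  fix q q' j assume q: "q \<in> hcomp (copower X e N) j" "q' \<in> hcomp (copower X e N) j"
  show "q + q' \<in> hcomp (copower X e N) j"
    using Poly_Mapping.keys_add[of q q'] q by (auto simp: copower_def lookup_add intro: hcomp_add)
next
  fix q j assume q: "q \<in> hcomp (copower X e N) j"
  then show "- q \<in> hcomp (copower X e N) j"
    by (auto simp: copower_def in_keys_iff intro: hcomp_uminus)
next
  fix x i q j assume x: "x \<in> gr A i" and q: "q \<in> hcomp (copower X e N) j"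
  show "act (copower X e N) x q \<in> hcomp (copower X e N) (int i + j)"
  proof (rule hcomp_copowerI)
    show "keys (act (copower X e N) x q) \<subseteq> X"
      using hcomp_copower_outside[OF q] by (auto simp: in_keys_iff) (metis act_0)
    show "lookup (act (copower X e N) x q) l \<in> hcomp N (int i + j - e l)" if "l \<in> X" for l
      using act_hcomp[OF x hcomp_copower_lookup[OF q that]] by (simp add: algebra_simps)
  qed
qed (auto intro!: poly_mapping_eqI hcomp_copowerI simp: lookup_add act_add add_act mult_act)

definition coordinate :: "'l \<Rightarrow> ('x \<Rightarrow>\<^sub>0 ('l \<Rightarrow>\<^sub>0 'm)) \<Rightarrow> ('x \<Rightarrow>\<^sub>0 'm)" where
  "coordinate y f = mapp (\<lambda>_ q. lookup q y) f"

lemma lookup_coordinate [simp]: "lookup (coordinate y f) x = lookup (lookup f x) y"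
  by (simp add: coordinate_def lookup_mapp0)

lemma coordinate_bd: "coordinate y (bd F (copower X e N) i f) = bd F N i (coordinate y f)"
proof (rule poly_mapping_eqI)
  fix z
  interpret C: graded_module A "copower X e N" by (rule copower_module)
  have "keys (coordinate y f) \<subseteq> keys f" unfolding coordinate_def by (rule keys_mapp)
  then show "lookup (coordinate y (bd F (copower X e N) i f)) z = lookup (bd F N i (coordinate y f)) z"
    by (simp add: C.lookup_bd lookup_bd_superset[of "keys f"] lookup_sum)
qed

lemma coordinate_chains:
  assumes "f \<in> chains F (copower X e N) i j" "y \<in> X"
  shows "coordinate y f \<in> chains F N i (j - e y)"
proof (rule chainsI)
  have "keys (coordinate y f) \<subseteq> keys f" unfolding coordinate_def by (rule keys_mapp)
  then show "keys (coordinate y f) \<subseteq> gens F i" using chains_keys[OF assms(1)] by blast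
  fix x assume "x \<in> gens F i"
  from hcomp_copower_lookup[OF chains_lookup[OF assms(1) this] assms(2)]
  show "lookup (coordinate y f) x \<in> hcomp N (j - e y - gdeg F i x)" by (simp add: algebra_simps)
qed

text \<open>The differential acts on each coordinate separately, and only finitely many coordinates of a chain are
  nonzero.\<close>

lemma tor_vanishes_copower:
  assumes tor: "\<And>x. x \<in> X \<Longrightarrow> tor_vanishes F N i (j - e x)"
  shows "tor_vanishes F (copower X e N) i j"
  unfolding tor_vanishes_def
proof (intro ballI impI)
  interpret C: graded_module A "copower X e N" by (rule copower_module)
  fix f assume f: "f \<in> chains F (copower X e N) i j" "bd F (copower X e N) i f = 0"
  define Y where "Y = (\<Union>x\<in>keys f. keys (lookup f x))"
  have Y: "finite Y" by (simp add: Y_def)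
  have YX: "Y \<subseteq> X"
    unfolding Y_def using hcomp_copower_keys[OF chains_lookup[OF f(1)]] chains_keys[OF f(1)] by blast
  have "\<exists>g. g \<in> chains F N (i + 1) (j - e y) \<and> bd F N (i + 1) g = coordinate y f" if "y \<in> Y" for y
  proof -
    have "bd F N i (coordinate y f) = 0"
      by (subst coordinate_bd[symmetric, where X = X and e = e], rule poly_mapping_eqI) (simp add: f(2))
    then show ?thesis
      using tor[of y] coordinate_chains[OF f(1), of y] that subsetD[OF YX that]
      unfolding tor_vanishes_def by (metis imageE)
  qed
  then obtain g where g: "\<And>y. y \<in> Y \<Longrightarrow> g y \<in> chains F N (i + 1) (j - e y)"
      "\<And>y. y \<in> Y \<Longrightarrow> bd F N (i + 1) (g y) = coordinate y f"
    by metis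
  define h where "h = (\<Sum>y\<in>Y. mapp (\<lambda>_ m. single y m) (g y))"
  have lh: "lookup (lookup h x) y = (if y \<in> Y then lookup (g y) x else 0)" for x y
    using Y by (simp add: h_def lookup_sum lookup_mapp0 lookup_single when_def)
  have ch: "coordinate y h = (if y \<in> Y then g y else 0)" for y
    by (rule poly_mapping_eqI) (simp add: lh)
  have "h \<in> chains F (copower X e N) (i + 1) j"
  proof (rule chainsI)
    show "keys h \<subseteq> gens F (i + 1)"
    proof
      fix x assume "x \<in> keys h"
      then obtain y where "lookup (lookup h x) y \<noteq> 0"
        by (metis in_keys_iff lookup_zero poly_mapping_eqI)
      then show "x \<in> gens F (i + 1)" using lh[of x y] chains_outside[OF g(1), of y x] by (auto split: if_splits)
    qed
    fix x assume x: "x \<in> gens F (i + 1)"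
    show "lookup h x \<in> hcomp (copower X e N) (j - gdeg F (i + 1) x)"
    proof (rule hcomp_copowerI)
      show "keys (lookup h x) \<subseteq> X" using YX by (auto simp: in_keys_iff lh split: if_splits)
      fix y assume "y \<in> X"
      show "lookup (lookup h x) y \<in> hcomp N (j - gdeg F (i + 1) x - e y)"
        using chains_lookup[OF g(1) x, of y] by (auto simp: lh algebra_simps)
    qed
  qed
  moreover have "bd F (copower X e N) (i + 1) h = f"
  proof (intro poly_mapping_eqI)
    fix z y
    have "lookup (lookup (bd F (copower X e N) (i + 1) h) z) y = lookup (bd F N (i + 1) (coordinate y h)) z"
      by (simp flip: coordinate_bd[where X = X and e = e])
    also have "\<dots> = lookup (lookup f z) y"
    proof (cases "y \<in> Y")
      case True
      then show ?thesis by (simp add: ch g(2))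
    next
      case False
      then have "lookup (lookup f z) y = 0" by (auto simp: Y_def in_keys_iff)
      then show ?thesis using False by (simp add: ch)
    qed
    finally show "lookup (lookup (bd F (copower X e N) (i + 1) h) z) y = lookup (lookup f z) y" .
  qed
  ultimately show "f \<in> bd F (copower X e N) (i + 1) ` chains F (copower X e N) (i + 1) j" by blast
qed

end

section \<open>Tor in terms of a resolution of the residue field\<close>

locale resolution = graded_connected_algebra A
  for A :: "('k::field, 'a::comm_ring_1) graded_alg" +
  fixes F :: "('k, 'a) free_complex"
  assumes res: "is_free_resolution A F"
begin

lemma gens_neg: "i < 0 \<Longrightarrow> gens F i = {}"
  and free_diff: "free_differential A F"
  and eps_hcomp: "x \<in> gens F 0 \<Longrightarrow> eps F x \<in> hcomp (residue_mod A) (gdeg F 0 x)"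
  and eps_onto: "eps_map A F ` chains F (regular_mod A) 0 j = hcomp (residue_mod A) j"
  and exact_0: "{f \<in> chains F (regular_mod A) 0 j. eps_map A F f = 0} =
        bd F (regular_mod A) 1 ` chains F (regular_mod A) 1 j"
  and exact_pos: "0 < i \<Longrightarrow> {f \<in> chains F (regular_mod A) i j. bd F (regular_mod A) i f = 0} =
        bd F (regular_mod A) (i + 1) ` chains F (regular_mod A) (i + 1) j"
  using res by (auto simp: is_free_resolution_def free_differential_def)

lemma single_chains: "x \<in> gens F i \<Longrightarrow> single x 1 \<in> chains F (regular_mod A) i (gdeg F i x)"
  by (intro chainsI) (auto simp: lookup_single when_def regular_mod_def)

lemma bd_single: "bd F (regular_mod A) i (single x 1) = dif F i x"
  by (rule poly_mapping_eqI) (simp add: reg.lookup_bd)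

lemma dif_boundary: "x \<in> gens F i \<Longrightarrow> dif F i x \<in> bd F (regular_mod A) i ` chains F (regular_mod A) i (gdeg F i x)"
  using single_chains bd_single by (metis imageI)

lemma dif_chains: "x \<in> gens F i \<Longrightarrow> dif F i x \<in> chains F (regular_mod A) (i - 1) (gdeg F i x)"
  using free_diff by (simp add: free_differential_def)

lemma complex: "complex A F"
  unfolding complex_def
proof (intro conjI allI ballI free_diff)
  fix i x assume x: "x \<in> gens F (i + 1)"
  consider "0 < i" | "i = 0" | "i < 0" by linarith
  then show "bd F (regular_mod A) i (dif F (i + 1) x) = 0"
  proof cases
    case 1
    then show ?thesis using dif_boundary[OF x] exact_pos[OF 1] by blast
  next
    case 2
    have "bd F (regular_mod A) 0 (dif F 1 x) \<in> chains F (regular_mod A) (0 - 1) (gdeg F 1 x)"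
      by (rule reg.bd_chains[OF free_diff]) (use dif_chains[of x 1] x 2 in simp)
    then show ?thesis using chains_keys gens_neg[of "- 1"] 2 by fastforce
  next
    case 3
    then have "keys (dif F (i + 1) x) \<subseteq> {}"
      using chains_keys[OF dif_chains[OF x]] gens_neg[of i] by simp
    then show ?thesis by simp
  qed
qed

lemma tor_vanishes_regular:
  assumes "0 < i \<or> i = 0 \<and> 0 < j"
  shows "tor_vanishes F (regular_mod A) i j"
proof (cases "0 < i")
  case True
  then show ?thesis unfolding tor_vanishes_def using exact_pos[OF True, of j] by blast
next
  case False
  then have "i = 0" "0 < j" using assms by auto
  have "eps_map A F f = 0" if "f \<in> chains F (regular_mod A) 0 j" for f
    using eps_onto[of j] that \<open>0 < j\<close> by (auto simp: residue_mod_def)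
  then show ?thesis unfolding tor_vanishes_def using exact_0[of j] \<open>i = 0\<close> by auto
qed

lemma tor_vanishes_free:
  assumes "0 < i \<or> i = 0 \<and> (\<forall>x\<in>X. e x < j)"
  shows "tor_vanishes F (copower X e (regular_mod A)) i j"
  by (rule reg.tor_vanishes_copower, rule tor_vanishes_regular) (use assms in auto)

lemma eps_map_eq: "eps_map A F f = (\<Sum>x\<in>keys f. augmentation A (lookup f x) * eps F x)"
  by (simp add: eps_map_def residue_mod_def)

lemma eps_map_superset:
  "finite T \<Longrightarrow> keys f \<subseteq> T \<Longrightarrow> eps_map A F f = (\<Sum>x\<in>T. augmentation A (lookup f x) * eps F x)"
  unfolding eps_map_eq by (rule sum.mono_neutral_left) (auto simp: in_keys_iff)

lemma eps_0: "x \<in> gens F 0 \<Longrightarrow> gdeg F 0 x \<noteq> 0 \<Longrightarrow> eps F x = 0"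
  using eps_hcomp[of x] by (simp add: residue_mod_def)

text \<open>The coefficient of \<open>tensor N v m\<close> under the map from the 0-chains to N that extends the
  augmentation of the resolution; modulo the irrelevant ideal it is \<open>eps_map A F v\<close>.\<close>

definition eps_lift :: "(nat \<Rightarrow>\<^sub>0 'a) \<Rightarrow> 'a" where
  "eps_lift v = (\<Sum>y\<in>keys v. scl A (eps F y) 1 * lookup v y)"

lemma eps_lift:
  assumes v: "v \<in> chains F (regular_mod A) 0 l"
  shows "eps_lift v \<in> int_gr A l" "augmentation A (eps_lift v) = eps_map A F v"
proof -
  have in_l: "scl A (eps F y) 1 * lookup v y \<in> int_gr A l" if "y \<in> keys v" for y
  proof -
    have y: "y \<in> gens F 0" using chains_keys[OF v] that by blast
    have vy: "lookup v y \<in> int_gr A (l - gdeg F 0 y)"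
      using chains_lookup[OF v y] by (simp add: regular_mod_def)
    show ?thesis
    proof (cases "gdeg F 0 y = 0")
      case True
      then show ?thesis using int_gr_mult[OF scl_int_gr vy, of "eps F y"] by simp
    next
      case False
      then show ?thesis using eps_0[OF y] by simp
    qed
  qed
  then show "eps_lift v \<in> int_gr A l" unfolding eps_lift_def
    by (rule conjunct2[OF augmentation_sum_int_gr])
  have "augmentation A (eps_lift v) = (\<Sum>y\<in>keys v. augmentation A (scl A (eps F y) 1 * lookup v y))"
    unfolding eps_lift_def by (rule conjunct1[OF augmentation_sum_int_gr]) (rule in_l)
  also have "\<dots> = (\<Sum>y\<in>keys v. augmentation A (lookup v y) * eps F y)"
  proof (rule sum.cong[OF refl])
    fix y assume "y \<in> keys v"
    then have "y \<in> gens F 0" using chains_keys[OF v] by blast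
    from chains_lookup[OF v this]
    have "lookup v y \<in> int_gr A (l - gdeg F 0 y)" by (simp add: regular_mod_def)
    from augmentation_scl_mult_int_gr[OF this]
    show "augmentation A (scl A (eps F y) 1 * lookup v y) = augmentation A (lookup v y) * eps F y" by simp
  qed
  finally show "augmentation A (eps_lift v) = eps_map A F v" by (simp add: eps_map_eq)
qed

lemma eps_map_diff:
  assumes f: "f \<in> chains F (regular_mod A) 0 l" and g: "g \<in> chains F (regular_mod A) 0 l"
  shows "eps_map A F (f - g) = eps_map A F f - eps_map A F g"
proof -
  let ?T = "keys f \<union> keys g"
  have sub: "keys (f - g) \<subseteq> ?T" by (auto simp: in_keys_iff lookup_minus)
  have "augmentation A (lookup (f - g) x) = augmentation A (lookup f x) - augmentation A (lookup g x)"
    if "x \<in> ?T" for x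
  proof -
    have x: "x \<in> gens F 0" using that chains_keys[OF f] chains_keys[OF g] by blast
    have "lookup f x \<in> int_gr A (l - gdeg F 0 x)" and gx: "lookup g x \<in> int_gr A (l - gdeg F 0 x)"
      using chains_lookup[OF f x] chains_lookup[OF g x] by (simp_all add: regular_mod_def)
    from augmentation_add_int_gr[OF this(1) int_gr_uminus[OF gx]]
    show ?thesis using augmentation_uminus_int_gr[OF gx] by (simp add: lookup_minus)
  qed
  then show ?thesis
    by (simp add: eps_map_superset[OF _ sub] eps_map_superset[of ?T f] eps_map_superset[of ?T g]
        sum_subtractf left_diff_distrib)
qed

lemma scaled_chains:
  assumes u: "u \<in> chains F (regular_mod A) 0 l" and a: "a \<in> int_gr A i"
  shows "tensor (regular_mod A) u a \<in> chains F (regular_mod A) 0 (l + i)"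
  using reg.tensor_chains[OF u] a by (simp add: regular_mod_def)

lemma lookup_regular_tensor [simp]: "lookup (tensor (regular_mod A) u a) x = lookup u x * a"
  by (simp add: regular_mod_def tensor_def lookup_mapp0)

lemma eps_map_scaled:
  assumes u: "u \<in> chains F (regular_mod A) 0 l"
  shows "eps_map A F (tensor (regular_mod A) u (scl A c 1)) = c * eps_map A F u"
proof -
  have "augmentation A (lookup u x * scl A c 1) = c * augmentation A (lookup u x)" if "x \<in> keys u" for x
  proof -
    have "x \<in> gens F 0" using chains_keys[OF u] that by blast
    from chains_lookup[OF u this]
    have "lookup u x \<in> int_gr A (l - gdeg F 0 x)" by (simp add: regular_mod_def)
    from augmentation_scl_mult_int_gr[OF this] show ?thesis by (simp add: mult.commute)
  qed
  then show ?thesis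
    unfolding eps_map_superset[OF finite_keys reg.keys_tensor[of u "scl A c 1"]] eps_map_eq[of u] sum_distrib_left
    by (intro sum.cong) (simp_all add: mult.assoc)
qed

end

text \<open>The component of degree j of the product of the irrelevant ideal with N.\<close>

inductive_set decomposables ::
  "('k, 'a) graded_alg \<Rightarrow> ('a, 'm::ab_group_add) graded_mod \<Rightarrow> int \<Rightarrow> 'm set"
  for A :: "('k, 'a) graded_alg" and N :: "('a, 'm::ab_group_add) graded_mod" and j :: int where
  decomposables_0: "0 \<in> decomposables A N j"
| decomposables_step: "x \<in> gr A i \<Longrightarrow> 0 < i \<Longrightarrow> n \<in> hcomp N (j - int i) \<Longrightarrow> m \<in> decomposables A N j \<Longrightarrow>
     act N x n + m \<in> decomposables A N j"

lemma decomposables_add: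
  "m \<in> decomposables A N j \<Longrightarrow> m' \<in> decomposables A N j \<Longrightarrow> m + m' \<in> decomposables A N j"
  by (induction m rule: decomposables.induct) (auto simp: add.assoc intro: decomposables_step)

lemma decomposables_act:
  "x \<in> gr A i \<Longrightarrow> 0 < i \<Longrightarrow> n \<in> hcomp N (j - int i) \<Longrightarrow> act N x n \<in> decomposables A N j"
  using decomposables_step[OF _ _ _ decomposables_0] by force

lemma decomposables_sum:
  "(\<And>x. x \<in> X \<Longrightarrow> h x \<in> decomposables A N j) \<Longrightarrow> sum h X \<in> decomposables A N j"
  by (induction X rule: infinite_finite_induct) (auto intro: decomposables_0 decomposables_add)

locale resolution_module = resolution A F + N: graded_module A N
  for A :: "('k::field, 'a::comm_ring_1) graded_alg" and F :: "('k, 'a) free_complex"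
    and N :: "('a, 'm::ab_group_add) graded_mod"
begin

text \<open>The augmentation of F tensored with N; it is well defined on the homology up to decomposables.\<close>

definition eps_chain :: "(nat \<Rightarrow>\<^sub>0 'm) \<Rightarrow> 'm" where
  "eps_chain f = (\<Sum>x\<in>keys f. act N (scl A (eps F x) 1) (lookup f x))"

lemma eps_chain_superset:
  "finite T \<Longrightarrow> keys f \<subseteq> T \<Longrightarrow> eps_chain f = (\<Sum>x\<in>T. act N (scl A (eps F x) 1) (lookup f x))"
  unfolding eps_chain_def by (rule sum.mono_neutral_left) (auto simp: in_keys_iff)

lemma eps_chain_add: "eps_chain (f + g) = eps_chain f + eps_chain g"
proof -
  have "keys (f + g) \<subseteq> keys f \<union> keys g" by (rule Poly_Mapping.keys_add)
  then show ?thesis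
    by (simp add: eps_chain_superset[of "keys f \<union> keys g"] lookup_add N.act_add sum.distrib)
qed

lemma eps_chain_sum: "eps_chain (sum h X) = (\<Sum>x\<in>X. eps_chain (h x))"
  by (induction X rule: infinite_finite_induct) (auto simp: eps_chain_add, auto simp: eps_chain_def)

lemma eps_chain_tensor: "eps_chain (tensor N v m) = act N (eps_lift v) m"
  by (simp add: eps_chain_superset[OF _ N.keys_tensor] eps_lift_def N.sum_act N.mult_act)

lemma eps_chain_hcomp:
  assumes f: "f \<in> chains F N 0 j" shows "eps_chain f \<in> hcomp N j"
  unfolding eps_chain_def
proof (rule N.hcomp_sum)
  fix x assume "x \<in> keys f"
  then have x: "x \<in> gens F 0" using chains_keys[OF f] by blast
  show "act N (scl A (eps F x) 1) (lookup f x) \<in> hcomp N j"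
  proof (cases "gdeg F 0 x = 0")
    case True
    then show ?thesis using N.act_int_gr[OF scl_int_gr chains_lookup[OF f x], of "eps F x"] by simp
  next
    case False
    then show ?thesis using eps_0[OF x] by simp
  qed
qed

lemma eps_chain_tensor_decomposable:
  assumes v: "v \<in> chains F (regular_mod A) 0 l" "eps_map A F v = 0" and m: "m \<in> hcomp N (j - l)"
  shows "eps_chain (tensor N v m) \<in> decomposables A N j"
proof -
  have r: "eps_lift v \<in> int_gr A l" "augmentation A (eps_lift v) = 0" using eps_lift[OF v(1)] v(2) by auto
  show ?thesis
  proof (cases "0 < l")
    case True
    then show ?thesis
      using decomposables_act[of "eps_lift v" A "nat l" m N j] r m
      by (simp add: eps_chain_tensor int_gr_def)
  next
    case False
    have "eps_lift v = 0"
    proof (cases "l = 0")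
      case True
      then obtain c where "eps_lift v = scl A c 1" using int_gr_0_cases r(1) by auto
      then show ?thesis using r(2) by (simp add: augmentation_scl)
    next
      case False
      then show ?thesis using \<open>\<not> 0 < l\<close> r(1) by (simp add: int_gr_def)
    qed
    then show ?thesis by (simp add: eps_chain_tensor decomposables_0)
  qed
qed

lemma tensor_boundary:
  assumes v: "v \<in> chains F (regular_mod A) 0 l" "eps_map A F v = 0" and m: "m \<in> hcomp N (j - l)"
  shows "tensor N v m \<in> bd F N 1 ` chains F N 1 j"
proof -
  obtain w where w: "w \<in> chains F (regular_mod A) 1 l" "v = bd F (regular_mod A) 1 w"
    using v exact_0[of l] by blast
  then show ?thesis using N.bd_tensor[of F 1 w m, symmetric] N.tensor_chains[OF w(1) m] by simp
qed

lemma boundaries_add: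
  assumes "f \<in> bd F N i ` chains F N i j" "g \<in> bd F N i ` chains F N i j"
  shows "f + g \<in> bd F N i ` chains F N i j"
proof -
  obtain f' g' where "f = bd F N i f'" "g = bd F N i g'" "f' \<in> chains F N i j" "g' \<in> chains F N i j"
    using assms by blast
  then show ?thesis using N.chains_add[of f' F i j g'] by (auto simp flip: N.bd_add)
qed

lemma boundaries_sum:
  "(\<And>x. x \<in> X \<Longrightarrow> h x \<in> bd F N i ` chains F N i j) \<Longrightarrow> sum h X \<in> bd F N i ` chains F N i j"
proof (induction X rule: infinite_finite_induct)
  case (insert x X)
  then show ?case by (simp add: boundaries_add)
qed (auto intro!: image_eqI[of _ _ 0])

text \<open>The 0-th Tor is the quotient of N by its decomposables. Let u be a 0-chain of augmentation 1.
  Each 0-chain f differs from \<open>u \<otimes> eps_chain f\<close> by tensors of 0-chains of augmentation 0, and these are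
  boundaries by the exactness of F; likewise \<open>u \<otimes> d\<close> is a boundary for every decomposable d.\<close>

lemma boundary_iff_decomposable:
  assumes f: "f \<in> chains F N 0 j"
  shows "f \<in> bd F N 1 ` chains F N 1 j \<longleftrightarrow> eps_chain f \<in> decomposables A N j"
proof
  assume "f \<in> bd F N 1 ` chains F N 1 j"
  then obtain g where g: "g \<in> chains F N 1 j" "f = bd F N 1 g" by blast
  have "f = bd F N 1 (\<Sum>x\<in>keys g. tensor N (single x 1) (lookup g x))"
    using g(2) N.sum_tensor[of g] by simp
  then have "eps_chain f = (\<Sum>x\<in>keys g. eps_chain (tensor N (dif F 1 x) (lookup g x)))"
    by (simp add: N.bd_sum N.bd_tensor bd_single eps_chain_sum)
  moreover have "eps_chain (tensor N (dif F 1 x) (lookup g x)) \<in> decomposables A N j" if "x \<in> keys g" for x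
  proof (rule eps_chain_tensor_decomposable)
    have x: "x \<in> gens F 1" using chains_keys[OF g(1)] that by blast
    then have "dif F 1 x \<in> {f \<in> chains F (regular_mod A) 0 (gdeg F 1 x). eps_map A F f = 0}"
      using dif_boundary[OF x] by (simp add: exact_0)
    then show "dif F 1 x \<in> chains F (regular_mod A) 0 (gdeg F 1 x)" "eps_map A F (dif F 1 x) = 0" by auto
    show "lookup g x \<in> hcomp N (j - gdeg F 1 x)" by (rule chains_lookup[OF g(1) x])
  qed
  ultimately show "eps_chain f \<in> decomposables A N j" by (simp add: decomposables_sum)
next
  assume dec: "eps_chain f \<in> decomposables A N j"
  obtain u where u: "u \<in> chains F (regular_mod A) 0 0" "eps_map A F u = 1"
    using eps_onto[of 0] by (auto simp: residue_mod_def) (metis UNIV_I imageE)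
  have u_dec: "tensor N u d \<in> bd F N 1 ` chains F N 1 j" if "d \<in> decomposables A N j" for d
    using that
  proof (induction d rule: decomposables.induct)
    case decomposables_0
    have "tensor N u 0 = 0" by (rule poly_mapping_eqI) simp
    then show ?case by (auto intro!: image_eqI[of _ _ 0])
  next
    case (decomposables_step x i n m)
    let ?v = "tensor (regular_mod A) u x"
    have v: "?v \<in> chains F (regular_mod A) 0 (int i)"
      using scaled_chains[OF u(1) gr_int_gr[OF decomposables_step.hyps(1)]] by simp
    have "eps_map A F ?v \<in> hcomp (residue_mod A) (int i)" using eps_onto v by blast
    then have "eps_map A F ?v = 0" using \<open>0 < i\<close> by (simp add: residue_mod_def)
    from tensor_boundary[OF v this decomposables_step.hyps(3)]
    have "tensor N ?v n \<in> bd F N 1 ` chains F N 1 j" .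
    moreover have "tensor N u (act N x n + m) = tensor N ?v n + tensor N u m"
      by (rule poly_mapping_eqI) (simp add: lookup_add N.act_add N.mult_act)
    ultimately show ?case using decomposables_step.IH by (simp add: boundaries_add)
  qed
  have "f - tensor N u (eps_chain f) \<in> bd F N 1 ` chains F N 1 j"
  proof -
    let ?c = "\<lambda>x. tensor (regular_mod A) u (scl A (eps F x) 1)"
    have eq: "f - tensor N u (eps_chain f) = (\<Sum>x\<in>keys f. tensor N (single x 1 - ?c x) (lookup f x))"
    proof (rule poly_mapping_eqI)
      fix y
      have "lookup f y = (\<Sum>x\<in>keys f. act N (lookup (single x 1) y) (lookup f x))"
        using arg_cong[OF N.sum_tensor[of f], of "\<lambda>f. lookup f y"] by (simp add: lookup_sum)
      moreover have "act N (lookup u y) (eps_chain f) =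
          (\<Sum>x\<in>keys f. act N (lookup (?c x) y) (lookup f x))"
        by (simp add: eps_chain_def N.act_sum N.mult_act)
      ultimately show "lookup (f - tensor N u (eps_chain f)) y =
          lookup (\<Sum>x\<in>keys f. tensor N (single x 1 - ?c x) (lookup f x)) y"
        by (simp only: lookup_minus lookup_sum N.lookup_tensor N.diff_act sum_subtractf)
    qed
    show ?thesis unfolding eq
    proof (rule boundaries_sum)
      fix x assume "x \<in> keys f"
      then have x: "x \<in> gens F 0" using chains_keys[OF f] by blast
      have c: "?c x \<in> chains F (regular_mod A) 0 (gdeg F 0 x)"
      proof (cases "gdeg F 0 x = 0")
        case True
        then show ?thesis using scaled_chains[OF u(1) scl_int_gr[of "eps F x"]] by simp
      next
        case False
        have "?c x = 0" by (rule poly_mapping_eqI) (use eps_0[OF x False] in simp)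
        then show ?thesis by simp
      qed
      have "eps_map A F (single x 1) = eps F x"
        using augmentation_scl[of 1] by (simp add: eps_map_eq)
      then have "eps_map A F (single x 1 - ?c x) = 0"
        using eps_map_diff[OF single_chains[OF x] c] eps_map_scaled[OF u(1)] u(2) by simp
      from tensor_boundary[OF _ this chains_lookup[OF f x]]
      show "tensor N (single x 1 - ?c x) (lookup f x) \<in> bd F N 1 ` chains F N 1 j"
        using reg.chains_diff[OF single_chains[OF x] c] by blast
    qed
  qed
  from boundaries_add[OF this u_dec[OF dec]] show "f \<in> bd F N 1 ` chains F N 1 j" by simp
qed

lemma eps_chain_onto:
  assumes n: "n \<in> hcomp N j"
  shows "\<exists>f \<in> chains F N 0 j. eps_chain f = n"
proof -
  obtain u where u: "u \<in> chains F (regular_mod A) 0 0" "eps_map A F u = 1"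
    using eps_onto[of 0] by (auto simp: residue_mod_def) (metis UNIV_I imageE)
  obtain c where c: "eps_lift u = scl A c 1" using eps_lift(1)[OF u(1)] int_gr_0_cases by blast
  have "c = 1" using eps_lift(2)[OF u(1)] u(2) by (simp add: c augmentation_scl)
  then have "eps_chain (tensor N u n) = n" by (simp add: eps_chain_tensor c)
  then show ?thesis using N.tensor_chains[OF u(1) n] by auto
qed

lemma bd_chains_0: "f \<in> chains F N 0 j \<Longrightarrow> bd F N 0 f = 0"
  using chains_keys[OF N.bd_chains[OF free_diff, of f 0 j]] gens_neg[of "- 1"] by simp

lemma tor_vanishes_0_iff: "tor_vanishes F N 0 j \<longleftrightarrow> hcomp N j \<subseteq> decomposables A N j"
proof
  assume "tor_vanishes F N 0 j"
  then show "hcomp N j \<subseteq> decomposables A N j"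
    using eps_chain_onto boundary_iff_decomposable bd_chains_0
    unfolding tor_vanishes_def by (metis add_0 subsetI)
next
  assume "hcomp N j \<subseteq> decomposables A N j"
  then show "tor_vanishes F N 0 j"
    unfolding tor_vanishes_def using boundary_iff_decomposable eps_chain_hcomp by auto
qed

end

text \<open>The first Tor of N is the kernel of the map from the 0-th Tor of the kernel of \<phi> to that of G. Both are
  quotients by decomposables, so that the condition obtained does not mention the resolution.\<close>

lemma tor_vanishes_1_iff:
  fixes A :: "('k::field, 'a::comm_ring_1) graded_alg"
  assumes "resolution A F" and "graded_hom A G N \<phi>" and surj: "\<And>j. hcomp N j \<subseteq> \<phi> j ` hcomp G j"
    and G1: "tor_vanishes F G 1 j"
  shows "tor_vanishes F N 1 j \<longleftrightarrow>
    decomposables A G j \<inter> hcomp (graded_hom.kernel G \<phi>) j \<subseteq> decomposables A (graded_hom.kernel G \<phi>) j"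
proof -
  interpret resolution A F by fact
  interpret H: graded_hom A G N \<phi> by fact
  let ?K = "H.kernel"
  interpret G: resolution_module A F G by unfold_locales
  interpret K: resolution_module A F ?K
    by (intro resolution_module.intro resolution_axioms H.kernel_module)
  have eps: "K.eps_chain f = G.eps_chain f" for f
    by (simp add: K.eps_chain_def G.eps_chain_def)
  have sub: "f \<in> chains F G 0 j" if "f \<in> chains F ?K 0 j" for f
    using that by (simp add: H.chains_kernel_iff)
  show ?thesis
  proof
    assume N: "tor_vanishes F N 1 j"
    show "decomposables A G j \<inter> hcomp ?K j \<subseteq> decomposables A ?K j"
    proof
      fix n assume n: "n \<in> decomposables A G j \<inter> hcomp ?K j"
      then obtain f where f: "f \<in> chains F ?K 0 j" "K.eps_chain f = n" using K.eps_chain_onto by blast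
      have "f \<in> bd F G 1 ` chains F G 1 j"
        using G.boundary_iff_decomposable[OF sub[OF f(1)]] n f(2) by (simp add: eps)
      then have "f \<in> bd F G 1 ` chains F ?K 1 j"
        using H.kernel_boundaries[OF complex surj, of 0 j f] N f(1) by simp
      then show "n \<in> decomposables A ?K j"
        using K.boundary_iff_decomposable[OF f(1)] f(2) by simp
    qed
  next
    assume *: "decomposables A G j \<inter> hcomp ?K j \<subseteq> decomposables A ?K j"
    have "f \<in> bd F G 1 ` chains F ?K 1 j"
      if f: "f \<in> chains F ?K 0 j" "f \<in> bd F G 1 ` chains F G 1 j" for f
    proof -
      have "G.eps_chain f \<in> decomposables A G j"
        using G.boundary_iff_decomposable[OF sub[OF f(1)]] f(2) by blast
      then have "K.eps_chain f \<in> decomposables A ?K j"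
        using * K.eps_chain_hcomp[OF f(1)] by (auto simp: eps)
      then show ?thesis using K.boundary_iff_decomposable[OF f(1)] by simp
    qed
    then show "tor_vanishes F N 1 j"
      using H.tor_vanishes_cokernel[OF complex surj, of 0 j] G1 by simp
  qed
qed

section \<open>Countable free covers\<close>

text \<open>The set C is the union of an increasing sequence of finite sets, and X has only finitely many elements in
  the span of each of them.\<close>

lemma (in vector_space) countable_independent:
  assumes C: "countable C" and X: "independent X" "X \<subseteq> span C"
  shows "countable X"
proof -
  have "\<exists>D::nat \<Rightarrow> 'b set. (\<forall>n. finite (D n)) \<and> (\<forall>t. finite t \<longrightarrow> t \<subseteq> C \<longrightarrow> (\<exists>n. t \<subseteq> D n))"
  proof (rule exI[of _ "\<lambda>n. from_nat_into C ` {..n}"], intro conjI allI impI)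
    fix n :: nat show "finite (from_nat_into C ` {..n})" by simp
  next
    fix t assume t: "finite t" "t \<subseteq> C"
    have "t \<subseteq> from_nat_into C ` {..Max (to_nat_on C ` t)}"
    proof
      fix x assume "x \<in> t"
      then show "x \<in> from_nat_into C ` {..Max (to_nat_on C ` t)}"
        using t C by (intro image_eqI[of _ _ "to_nat_on C x"]) auto
    qed
    then show "\<exists>n. t \<subseteq> from_nat_into C ` {..n}" by blast
  qed
  then obtain D :: "nat \<Rightarrow> 'b set" where D: "\<And>n. finite (D n)"
      "\<And>t. finite t \<Longrightarrow> t \<subseteq> C \<Longrightarrow> \<exists>n. t \<subseteq> D n" by blast
  have "X \<subseteq> (\<Union>n. X \<inter> span (D n))"
  proof
    fix x assume x: "x \<in> X"
    then have "x \<in> span C" using X by blast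
    then obtain t r where t: "finite t" "t \<subseteq> C" "x = (\<Sum>a\<in>t. r a *s a)"
      unfolding span_explicit by blast
    obtain n where n: "t \<subseteq> D n" using D(2) t by blast
    have "x \<in> span (D n)" unfolding t(3)
      by (intro span_sum span_scale span_base) (use n in blast)
    then show "x \<in> (\<Union>n. X \<inter> span (D n))" using x by blast
  qed
  moreover have "countable (X \<inter> span (D n))" for n
  proof -
    have "independent (X \<inter> span (D n))" using X(1) by (rule independent_mono) blast
    then have "finite (X \<inter> span (D n))" using independent_span_bound[OF D(1)[of n]] by blast
    then show ?thesis by (rule countable_finite)
  qed
  then have "countable (\<Union>n. X \<inter> span (D n))" by (intro countable_UN) simp_all
  ultimately show ?thesis by (rule countable_subset)
qed

definition smul :: "'a::comm_ring_1 \<Rightarrow> ('l \<Rightarrow>\<^sub>0 'a) \<Rightarrow> ('l \<Rightarrow>\<^sub>0 'a)" where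
  "smul a q = mapp (\<lambda>_ b. a * b) q"

lemma lookup_smul [simp]: "lookup (smul a q) x = a * lookup q x"
  by (simp add: smul_def lookup_mapp0)

lemma act_free [simp]: "act (copower X e (regular_mod A)) = smul"
  by (intro ext) (simp add: copower_def smul_def)

text \<open>Graded submodules of a free module, given by their homogeneous components. Repeated passage to
  syzygies stays within the single type of finitely supported families indexed by the natural numbers.\<close>

locale graded_submodule = graded_connected_algebra A
  for A :: "('k::field, 'a::comm_ring_1) graded_alg" +
  fixes X :: "nat set" and e :: "nat \<Rightarrow> int" and H :: "int \<Rightarrow> (nat \<Rightarrow>\<^sub>0 'a) set"
  assumes sub_free: "H j \<subseteq> hcomp (copower X e (regular_mod A)) j"
    and sub_0: "0 \<in> H j"
    and sub_add: "q \<in> H j \<Longrightarrow> q' \<in> H j \<Longrightarrow> q + q' \<in> H j"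
    and sub_uminus: "q \<in> H j \<Longrightarrow> - q \<in> H j"
    and sub_smul: "x \<in> gr A i \<Longrightarrow> q \<in> H j \<Longrightarrow> smul x q \<in> H (int i + j)"

definition submodule_mod :: "(int \<Rightarrow> (nat \<Rightarrow>\<^sub>0 'a) set) \<Rightarrow> ('a::comm_ring_1, nat \<Rightarrow>\<^sub>0 'a) graded_mod" where
  "submodule_mod H = \<lparr>hcomp = H, act = smul\<rparr>"

lemma submodule_mod_simps [simp]: "hcomp (submodule_mod H) = H" "act (submodule_mod H) = smul"
  by (simp_all add: submodule_mod_def)

lemma (in graded_submodule) submodule_module: "graded_module A (submodule_mod H)"
  by unfold_locales
    (auto simp: sub_0 sub_add sub_uminus sub_smul lookup_add distrib_left distrib_right mult.assoc
      intro!: poly_mapping_eqI)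

lemma (in graded_connected_algebra) free_submodule:
  "graded_submodule A X e (hcomp (copower X e (regular_mod A)))"
proof -
  interpret C: graded_module A "copower X e (regular_mod A)" by (rule reg.copower_module)
  show ?thesis
    by unfold_locales (use C.act_hcomp in \<open>auto intro: C.hcomp_add C.hcomp_uminus\<close>)
qed

text \<open>The homomorphism from the free module on the labels that takes the label x to \<open>\<nu> x\<close>.\<close>

definition combination :: "('a, 'm::ab_group_add) graded_mod \<Rightarrow> (nat \<Rightarrow> 'm) \<Rightarrow> (nat \<Rightarrow>\<^sub>0 'a::comm_ring_1) \<Rightarrow> 'm" where
  "combination N \<nu> g = (\<Sum>x\<in>keys g. act N (lookup g x) (\<nu> x))"

context graded_module
begin

lemma combination_superset:
  "finite T \<Longrightarrow> keys g \<subseteq> T \<Longrightarrow> combination N \<nu> g = (\<Sum>x\<in>T. act N (lookup g x) (\<nu> x))"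
  unfolding combination_def by (rule sum.mono_neutral_left) (auto simp: in_keys_iff)

lemma combination_0 [simp]: "combination N \<nu> 0 = 0"
  by (simp add: combination_def)

lemma combination_add: "combination N \<nu> (f + g) = combination N \<nu> f + combination N \<nu> g"
proof -
  have "keys (f + g) \<subseteq> keys f \<union> keys g" by (rule Poly_Mapping.keys_add)
  then show ?thesis
    by (simp add: combination_superset[of "keys f \<union> keys g"] lookup_add add_act sum.distrib)
qed

lemma combination_sum: "combination N \<nu> (sum h T) = (\<Sum>x\<in>T. combination N \<nu> (h x))"
  by (induction T rule: infinite_finite_induct) (auto simp: combination_add)

lemma combination_single: "combination N \<nu> (single x a) = act N a (\<nu> x)"
  by (simp add: combination_superset[of "{x}"])

lemma combination_smul: "combination N \<nu> (smul a g) = act N a (combination N \<nu> g)"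
proof -
  have "keys (smul a g) \<subseteq> keys g" unfolding smul_def by (rule keys_mapp)
  then show ?thesis by (simp add: combination_superset[of "keys g"] act_sum mult_act)
qed

end

context graded_connected_algebra
begin

lemma free_module: "graded_module A (copower X e (regular_mod A))"
  by (rule reg.copower_module)

lemma combination_hom:
  assumes N: "graded_module A N" and \<nu>: "\<And>x. x \<in> X \<Longrightarrow> \<nu> x \<in> hcomp N (e x)"
  shows "graded_hom A (copower X e (regular_mod A)) N (\<lambda>_. combination N \<nu>)"
proof -
  interpret N: graded_module A N by fact
  interpret C: graded_module A "copower X e (regular_mod A)" by (rule free_module)
  show ?thesis
  proof unfold_locales
    fix g j assume g: "g \<in> hcomp (copower X e (regular_mod A)) j"
    show "combination N \<nu> g \<in> hcomp N j" unfolding combination_def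
    proof (rule N.hcomp_sum)
      fix x assume "x \<in> keys g"
      then have x: "x \<in> X" using hcomp_copower_keys[OF g] by blast
      have "lookup g x \<in> int_gr A (j - e x)" using hcomp_copower_lookup[OF g x] by simp
      from N.act_int_gr[OF this \<nu>[OF x]] show "act N (lookup g x) (\<nu> x) \<in> hcomp N j" by simp
    qed
  qed (simp_all add: N.combination_add N.combination_smul)
qed

lemma kernel_submodule:
  assumes "graded_hom A (copower X e (regular_mod A)) N \<phi>"
  shows "\<exists>H. graded_hom.kernel (copower X e (regular_mod A)) \<phi> = submodule_mod H \<and> graded_submodule A X e H \<and>
     H = (\<lambda>j. {m \<in> hcomp (copower X e (regular_mod A)) j. \<phi> j m = 0})"
proof -
  interpret h: graded_hom A "copower X e (regular_mod A)" N \<phi> by fact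
  interpret K: graded_module A h.kernel by (rule h.kernel_module)
  let ?H = "\<lambda>j. {m \<in> hcomp (copower X e (regular_mod A)) j. \<phi> j m = 0}"
  have k: "h.kernel = submodule_mod ?H" by (simp add: h.kernel_def submodule_mod_def)
  have "graded_submodule A X e ?H"
    using K.hcomp_0 K.hcomp_add K.hcomp_uminus K.act_hcomp by unfold_locales (auto simp: k)
  then show ?thesis using k by blast
qed

definition scale_free :: "'k \<Rightarrow> (nat \<Rightarrow>\<^sub>0 'a) \<Rightarrow> (nat \<Rightarrow>\<^sub>0 'a)" where
  "scale_free c q = smul (scl A c 1) q"

lemma scale_free_vector_space: "vector_space scale_free"
  unfolding scale_free_def
proof unfold_locales
  fix a b :: 'k and q q' :: "nat \<Rightarrow>\<^sub>0 'a"
  show "smul (scl A (a + b) 1) q = smul (scl A a 1) q + smul (scl A b 1) q"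
    by (rule poly_mapping_eqI) (simp add: lookup_add scale_left_distrib distrib_right)
  have "scl A (a * b) 1 = scl A a 1 * scl A b 1" using scl_eq[of a "scl A b 1"] by simp
  then show "smul (scl A a 1) (smul (scl A b 1) q) = smul (scl A (a * b) 1) q"
    by (intro poly_mapping_eqI) simp
qed (auto intro!: poly_mapping_eqI simp: lookup_add distrib_left)

sublocale free: vector_space scale_free
  by (rule scale_free_vector_space)

lemma countable_span_free:
  "\<exists>D. countable D \<and> (\<forall>X e j. hcomp (copower X e (regular_mod A)) j \<subseteq> free.span D)"
proof -
  obtain C where C: "\<And>i. countable (C i)" "\<And>i. gr A i \<subseteq> span (C i)" using gr_countable by metis
  define D where "D = (\<lambda>(x, m). single x m) ` ((UNIV :: nat set) \<times> (\<Union>i. C i))"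
  have "countable D" unfolding D_def using C(1) by (intro countable_image countable_SIGMA countable_UN) auto
  moreover have single: "single x m \<in> free.span D" if "m \<in> span (C i)" for x :: nat and m i
    using that
  proof (induction rule: span_induct_alt)
    case base
    show ?case by (simp add: free.span_zero)
  next
    case (step c m m')
    have "single x (scl A c m + m') = scale_free c (single x m) + single x m'"
      unfolding scale_free_def by (rule poly_mapping_eqI)
        (auto simp: lookup_add lookup_single when_def scl_mult[symmetric])
    moreover have "single x m \<in> free.span D" using step by (intro free.span_base) (auto simp: D_def)
    ultimately show ?case using step by (simp add: free.span_add free.span_scale)
  qed
  moreover have "q \<in> free.span D" if q: "q \<in> hcomp (copower X e (regular_mod A)) j" for X e j q
  proof -
    have "single x (lookup q x) \<in> free.span D" if "x \<in> keys q" for x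
    proof (cases "0 \<le> j - e x")
      case True
      have "x \<in> X" using hcomp_copower_keys[OF q] that by blast
      from hcomp_copower_lookup[OF q this] True show ?thesis
        using C(2) single[of "lookup q x" "nat (j - e x)" x] by (auto simp: int_gr_def)
    next
      case False
      have "x \<in> X" using hcomp_copower_keys[OF q] that by blast
      from hcomp_copower_lookup[OF q this] False show ?thesis
        by (simp add: int_gr_def free.span_zero)
    qed
    then have "(\<Sum>x\<in>keys q. single x (lookup q x)) \<in> free.span D" by (intro free.span_sum)
    then show ?thesis by (subst poly_mapping_sum_single)
  qed
  ultimately show ?thesis by (intro exI[of _ D] conjI allI subsetI)
qed

end

context graded_submodule
begin

lemma sub_subspace: "free.subspace (H j)"
proof (rule free.subspaceI)
  fix c q assume "q \<in> H j"
  then show "scale_free c q \<in> H j"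
    using sub_smul[of "scl A c 1" 0 q j] by (simp add: scale_free_def gr_0)
qed (auto intro: sub_0 sub_add)

text \<open>A submodule of a free module of countable rank has countable dimension in each degree, so a
  basis of the components with degree in L provides countably many generators.\<close>

lemma free_cover:
  obtains X' e' \<nu> where "\<And>x. x \<in> X' \<Longrightarrow> e' x \<in> L" "\<And>x. x \<in> X' \<Longrightarrow> \<nu> x \<in> H (e' x)"
    "\<And>l. l \<in> L \<Longrightarrow> H l \<subseteq> combination (submodule_mod H) \<nu> ` hcomp (copower X' e' (regular_mod A)) l"
proof -
  interpret M: graded_module A "submodule_mod H" by (rule submodule_module)
  obtain D where D: "countable D" "\<And>X e j. hcomp (copower X e (regular_mod A)) j \<subseteq> free.span D"
    using countable_span_free by blast
  have "\<exists>E. E \<subseteq> H l \<and> free.independent E \<and> H l \<subseteq> free.span E" for l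
    by (rule free.maximal_independent_subset[of "H l"]) (intro exI conjI)
  then obtain E where E: "\<And>l. E l \<subseteq> H l" "\<And>l. free.independent (E l)" "\<And>l. H l \<subseteq> free.span (E l)"
    by metis
  have cE: "countable (E l)" for l
    by (rule free.countable_independent[OF D(1) E(2)]) (use E(1)[of l] sub_free D(2) in blast)
  define P where "P = Sigma L E"
  have P: "countable P" unfolding P_def by (intro countable_SIGMA cE) simp
  let ?X = "to_nat_on P ` P" and ?e = "\<lambda>x. fst (from_nat_into P x)" and ?\<nu> = "\<lambda>x. snd (from_nat_into P x)"
  have code: "from_nat_into P (to_nat_on P p) = p" if "p \<in> P" for p using P that by simp
  show thesis
  proof (rule that[of ?X ?e ?\<nu>])
    fix x assume "x \<in> ?X"
    then obtain p where "p \<in> P" "x = to_nat_on P p" by blast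
    then show "?e x \<in> L" "?\<nu> x \<in> H (?e x)" using code[of p] E(1)[of "fst p"] by (auto simp: P_def)
  next
    fix l assume l: "l \<in> L"
    show "H l \<subseteq> combination (submodule_mod H) ?\<nu> ` hcomp (copower ?X ?e (regular_mod A)) l"
    proof
      fix q assume "q \<in> H l"
      then have "q \<in> free.span (E l)" using E(3) by blast
      then obtain t r where t: "finite t" "t \<subseteq> E l" "q = (\<Sum>b\<in>t. scale_free (r b) b)"
        unfolding free.span_explicit by blast
      interpret C: graded_module A "copower ?X ?e (regular_mod A)" by (rule free_module)
      have tP: "(l, b) \<in> P" if "b \<in> t" for b using that t(2) l by (auto simp: P_def)
      let ?g = "\<Sum>b\<in>t. single (to_nat_on P (l, b)) (scl A (r b) 1)"
      have "?g \<in> hcomp (copower ?X ?e (regular_mod A)) l"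
      proof (rule C.hcomp_sum)
        fix b assume b: "b \<in> t"
        show "single (to_nat_on P (l, b)) (scl A (r b) 1) \<in> hcomp (copower ?X ?e (regular_mod A)) l"
          using tP[OF b] code[OF tP[OF b]] by (intro hcomp_copowerI) (auto simp: lookup_single when_def)
      qed
      moreover have "combination (submodule_mod H) ?\<nu> ?g = q"
        unfolding t(3) M.combination_sum
        by (rule sum.cong) (use code[OF tP] in \<open>auto simp: M.combination_single scale_free_def\<close>)
      ultimately show "q \<in> combination (submodule_mod H) ?\<nu> ` hcomp (copower ?X ?e (regular_mod A)) l"
        by blast
    qed
  qed
qed

end

section \<open>Tor does not depend on the resolution\<close>

lemma tor_vanishes_change_step:
  fixes A :: "('k::field, 'a::comm_ring_1) graded_alg"
  assumes F: "resolution A F" "resolution A F'"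
    and "graded_hom A (copower X e (regular_mod A)) N \<phi>"
    and surj: "\<And>j. hcomp N j \<subseteq> \<phi> j ` hcomp (copower X e (regular_mod A)) j"
    and K: "tor_vanishes F (graded_hom.kernel (copower X e (regular_mod A)) \<phi>) (int i) j \<Longrightarrow>
       tor_vanishes F' (graded_hom.kernel (copower X e (regular_mod A)) \<phi>) (int i) j"
    and N: "tor_vanishes F N (int i + 1) j"
  shows "tor_vanishes F' N (int i + 1) j"
proof -
  interpret F: resolution A F by fact
  interpret F': resolution A F' by fact
  interpret h: graded_hom A "copower X e (regular_mod A)" N \<phi> by fact
  show ?thesis
  proof (cases "i = 0")
    case True
    then show ?thesis
      using tor_vanishes_1_iff[OF F(1) h.graded_hom_axioms surj F.tor_vanishes_free]
        tor_vanishes_1_iff[OF F(2) h.graded_hom_axioms surj F'.tor_vanishes_free] N by simp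
  next
    case False
    then have "tor_vanishes F h.kernel (int i) j"
      using h.tor_vanishes_kernel[OF F.complex surj N] F.tor_vanishes_free[of "int i" X e j] by simp
    then have "tor_vanishes F' h.kernel (int i) j" by (rule K)
    then show ?thesis
      using h.tor_vanishes_quotient[OF F'.complex surj, of "int i" j] F'.tor_vanishes_free[of "int i + 1" X e j] by simp
  qed
qed

text \<open>Dimension shifting along free covers reduces the claim to the first and the 0-th Tor of a syzygy module, where
  \<open>tor_vanishes_1_iff\<close> and \<open>tor_vanishes_0_iff\<close> describe the vanishing without the resolution.\<close>

lemma tor_vanishes_change_resolution:
  fixes A :: "('k::field, 'a::comm_ring_1) graded_alg"
  assumes F: "resolution A F" "resolution A F'" and "graded_submodule A X e H"
    and "tor_vanishes F (submodule_mod H) (int i) j"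
  shows "tor_vanishes F' (submodule_mod H) (int i) j"
  using assms(3-)
proof (induction i arbitrary: X e H)
  case (0 X e H)
  interpret graded_submodule A X e H by fact
  interpret F: resolution_module A F "submodule_mod H"
    by (intro resolution_module.intro F submodule_module)
  interpret F': resolution_module A F' "submodule_mod H"
    by (intro resolution_module.intro F submodule_module)
  show ?case using 0 F.tor_vanishes_0_iff F'.tor_vanishes_0_iff by simp
next
  case (Suc i X e H)
  interpret graded_submodule A X e H by fact
  obtain X' e' \<nu> where c: "\<And>x. x \<in> X' \<Longrightarrow> \<nu> x \<in> H (e' x)"
      "\<And>l. H l \<subseteq> combination (submodule_mod H) \<nu> ` hcomp (copower X' e' (regular_mod A)) l"
    using free_cover[of UNIV] by (metis UNIV_I)
  let ?\<phi> = "\<lambda>_::int. combination (submodule_mod H) \<nu>"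
  have h: "graded_hom A (copower X' e' (regular_mod A)) (submodule_mod H) ?\<phi>"
    by (rule combination_hom) (use c in \<open>auto intro: submodule_module\<close>)
  obtain H' where H': "graded_hom.kernel (copower X' e' (regular_mod A)) ?\<phi> = submodule_mod H'"
     "graded_submodule A X' e' H'"
    using kernel_submodule[OF h] by blast
  have "tor_vanishes F' (submodule_mod H) (int i + 1) j"
    by (rule tor_vanishes_change_step[OF F h]) (use c H' Suc in \<open>auto simp: add.commute\<close>)
  then show ?case by (simp add: add.commute)
qed

section \<open>Existence of resolutions\<close>

context graded_connected_algebra
begin

text \<open>The irrelevant ideal is covered by a free module, then the kernel of this cover, and so on. All the
  kernels are submodules of free modules with labels in the natural numbers, to which \<open>free_cover\<close> applies.\<close>

lemma exists_resolution: "\<exists>F. is_free_resolution A F"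
proof -
  let ?free = "\<lambda>X e. hcomp (copower X e (regular_mod A))"
  let ?comb = "combination (submodule_mod (\<lambda>_. UNIV)) :: (nat \<Rightarrow> (nat \<Rightarrow>\<^sub>0 'a)) \<Rightarrow> (nat \<Rightarrow>\<^sub>0 'a) \<Rightarrow> (nat \<Rightarrow>\<^sub>0 'a)"
  define H0 where "H0 j = {f \<in> ?free {0::nat} (\<lambda>_. 0) j. augmentation A (lookup f 0) = 0}" for j
  \<comment> \<open>A state consists of the labels and degrees of the basis, the images of the basis, and the kernel.\<close>
  define P where "P n s = (case s of (X, e, \<nu>, H) \<Rightarrow> graded_submodule A X e H \<and>
      (n = 0 \<longrightarrow> X = {0} \<and> e = (\<lambda>_. 0) \<and> H = H0))"
    for n :: nat and s :: "nat set \<times> (nat \<Rightarrow> int) \<times> (nat \<Rightarrow> (nat \<Rightarrow>\<^sub>0 'a)) \<times> (int \<Rightarrow> (nat \<Rightarrow>\<^sub>0 'a) set)"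
  define Q where "Q s s' = (case s of (X, e, \<nu>, H) \<Rightarrow> case s' of (X', e', \<nu>', H') \<Rightarrow>
      (\<forall>x\<in>X'. \<nu>' x \<in> H (e' x)) \<and> (\<forall>j. ?comb \<nu>' ` ?free X' e' j = H j) \<and>
      H' = (\<lambda>j. {g \<in> ?free X' e' j. ?comb \<nu>' g = 0}))"
    for s s' :: "nat set \<times> (nat \<Rightarrow> int) \<times> (nat \<Rightarrow> (nat \<Rightarrow>\<^sub>0 'a)) \<times> (int \<Rightarrow> (nat \<Rightarrow>\<^sub>0 'a) set)"
  have "graded_submodule A {0} (\<lambda>_. 0) H0"
  proof -
    interpret C: graded_submodule A "{0}" "\<lambda>_. 0" "?free {0} (\<lambda>_. 0)" by (rule free_submodule)
    have gr: "lookup f 0 \<in> int_gr A j" if "f \<in> ?free {0} (\<lambda>_. 0) j" for f j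
      using hcomp_copower_lookup[OF that, of 0] by simp
    show ?thesis
    proof unfold_locales
      fix x i q j assume x: "x \<in> gr A i" and q: "q \<in> H0 j"
      have q': "q \<in> ?free {0} (\<lambda>_. 0) j" "augmentation A (lookup q 0) = 0" using q by (auto simp: H0_def)
      have "augmentation A (x * lookup q 0) = 0"
      proof (cases "i = 0")
        case True
        then obtain c where "x = scl A c 1" using x by (auto simp: gr_0)
        then show ?thesis using augmentation_scl_mult_int_gr[OF gr[OF q'(1)]] q'(2) by simp
      next
        case False
        show ?thesis
        proof (cases "j < 0")
          case True
          then have "lookup q 0 = 0" using gr[OF q'(1)] by (simp add: int_gr_def)
          then show ?thesis by simp
        next
          case False
          then have "int i + j \<noteq> 0" using \<open>i \<noteq> 0\<close> by simp
          then show ?thesis using int_gr_mult[OF gr_int_gr[OF x] gr[OF q'(1)]] augmentation_int_gr by blast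
        qed
      qed
      then show "smul x q \<in> H0 (int i + j)" using C.sub_smul[OF x q'(1)] by (simp add: H0_def)
    next
      fix q q' j assume "q \<in> H0 j" "q' \<in> H0 j"
      then show "q + q' \<in> H0 j"
        using C.sub_add[of q j q'] augmentation_add_int_gr[OF gr gr, of q j q'] by (auto simp: H0_def lookup_add)
    next
      fix q j assume "q \<in> H0 j"
      then show "- q \<in> H0 j"
        using C.sub_uminus[of q j] augmentation_uminus_int_gr[OF gr, of q j] by (auto simp: H0_def)
    qed (use C.sub_0 in \<open>auto simp: H0_def\<close>)
  qed
  then have P0: "\<exists>s. P 0 s" by (auto simp: P_def)
  have PS: "\<exists>s'. P (Suc n) s' \<and> Q s s'" if "P n s" for s n
  proof -
    obtain X e \<nu> H where s: "s = (X, e, \<nu>, H)" by (cases s) auto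
    interpret graded_submodule A X e H using that by (simp add: P_def s)
    obtain X' e' \<nu>' where c: "\<And>x. x \<in> X' \<Longrightarrow> \<nu>' x \<in> H (e' x)"
        "\<And>l. H l \<subseteq> combination (submodule_mod H) \<nu>' ` ?free X' e' l"
      using free_cover[of UNIV] by (metis UNIV_I)
    have comb: "combination (submodule_mod H) \<nu>' = ?comb \<nu>'"
      by (intro ext) (simp add: combination_def)
    interpret h: graded_hom A "copower X' e' (regular_mod A)" "submodule_mod H" "\<lambda>_. combination (submodule_mod H) \<nu>'"
      by (rule combination_hom) (use c in \<open>auto intro: submodule_module\<close>)
    obtain H' where H': "graded_submodule A X' e' H'" "H' = (\<lambda>j. {g \<in> ?free X' e' j. combination (submodule_mod H) \<nu>' g = 0})"
      using kernel_submodule[OF h.graded_hom_axioms] by blast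
    have "P (Suc n) (X', e', \<nu>', H') \<and> Q s (X', e', \<nu>', H')"
      using H' c(1) c(2) h.hom_hcomp by (auto simp: P_def Q_def s comb)
    then show ?thesis by blast
  qed
  obtain s where s: "\<And>n. P n (s n)" "\<And>n. Q (s n) (s (Suc n))"
    using dependent_nat_choice[of P "\<lambda>_. Q"] P0 PS by blast
  define X where "X n = fst (s n)" for n
  define e where "e n = fst (snd (s n))" for n
  define \<nu> where "\<nu> n = fst (snd (snd (s n)))" for n
  define H where "H n = snd (snd (snd (s n)))" for n
  have X0: "X 0 = {0}" and e0: "e 0 = (\<lambda>_. 0)" and HH: "H 0 = H0"
    using s(1)[of 0] by (auto simp: P_def X_def e_def H_def)
  have sub: "graded_submodule A (X n) (e n) (H n)" for n
    using s(1)[of n] by (auto simp: P_def X_def e_def H_def)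
  have \<nu>H: "x \<in> X (Suc n) \<Longrightarrow> \<nu> (Suc n) x \<in> H n (e (Suc n) x)" for n x
    using s(2)[of n] by (auto simp: Q_def X_def e_def H_def \<nu>_def split: prod.splits)
  have img: "?comb (\<nu> (Suc n)) ` ?free (X (Suc n)) (e (Suc n)) j = H n j" for n j
    using s(2)[of n] by (auto simp: Q_def X_def e_def H_def \<nu>_def split: prod.splits)
  have ker: "H (Suc n) j = {g \<in> ?free (X (Suc n)) (e (Suc n)) j. ?comb (\<nu> (Suc n)) g = 0}" for n j
    using s(2)[of n] by (auto simp: Q_def X_def e_def H_def \<nu>_def split: prod.splits)
  define F :: "('k, 'a) free_complex" where "F = \<lparr>gens = (\<lambda>i. if i < 0 then {} else X (nat i)),
     gdeg = (\<lambda>i. e (nat i)), dif = (\<lambda>i x. if i \<le> 0 then 0 else \<nu> (nat i) x), eps = (\<lambda>_. 1)\<rparr>"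
  have ch: "chains F (regular_mod A) (int n) j = ?free (X n) (e n) j" for n j
    by (auto simp: chains_def F_def copower_def)
  have bd: "bd F (regular_mod A) (int (Suc n)) f = ?comb (\<nu> (Suc n)) f" for n f
    by (rule poly_mapping_eqI)
      (simp add: reg.lookup_bd combination_def lookup_sum F_def mult.commute del: of_nat_Suc)
  have nn: "\<exists>n. i = int (Suc n)" if "0 < i" for i using that zero_less_imp_eq_int[of i] gr0_implies_Suc by blast
  have epsF: "eps_map A F f = augmentation A (lookup f 0)" if "f \<in> chains F (regular_mod A) 0 j" for f j
  proof -
    have "keys f \<subseteq> {0}" using chains_keys[OF that] X0 by (simp add: F_def)
    then have "eps_map A F f = (\<Sum>x\<in>{0}. act (residue_mod A) (lookup f x) (eps F x))"
      unfolding eps_map_def by (intro sum.mono_neutral_left) (auto simp: in_keys_iff residue_mod_def)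
    then show ?thesis by (simp add: residue_mod_def F_def)
  qed
  have "is_free_resolution A F"
    unfolding is_free_resolution_def
  proof (intro conjI allI impI ballI)
    fix i :: int assume "i < 0" then show "gens F i = {}" by (simp add: F_def)
  next
    fix i x assume x: "x \<in> gens F i"
    show "dif F i x \<in> chains F (regular_mod A) (i - 1) (gdeg F i x)"
    proof (cases "0 < i")
      case True
      then obtain n where n: "i = int (Suc n)" using nn by blast
      interpret graded_submodule A "X n" "e n" "H n" by (rule sub)
      have "dif F i x \<in> ?free (X n) (e n) (gdeg F i x)"
        using \<nu>H[of x n] x n sub_free[of "e (Suc n) x"] by (auto simp: F_def simp del: of_nat_Suc)
      then show ?thesis using ch[of n] n by simp
    next
      case False
      then show ?thesis by (simp add: F_def chains_def)
    qed
  next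
    fix x assume "x \<in> gens F 0"
    then show "eps F x \<in> hcomp (residue_mod A) (gdeg F 0 x)" by (simp add: F_def residue_mod_def e0)
  next
    fix j
    show "eps_map A F ` chains F (regular_mod A) 0 j = hcomp (residue_mod A) j" (is "?l = ?r")
    proof (intro equalityI subsetI)
      fix c assume "c \<in> ?l"
      then obtain f where f: "f \<in> chains F (regular_mod A) 0 j" "c = augmentation A (lookup f 0)" using epsF by auto
      have "lookup f 0 \<in> int_gr A j" using chains_lookup[OF f(1), of 0] X0 e0 by (simp add: F_def)
      then show "c \<in> ?r" using f(2) augmentation_int_gr by (auto simp: residue_mod_def)
    next
      fix c assume c: "c \<in> ?r"
      show "c \<in> ?l"
      proof (cases "j = 0")
        case True
        let ?f = "single 0 (scl A c 1)"
        have f: "?f \<in> chains F (regular_mod A) 0 j"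
          using True X0 e0 by (intro chainsI) (auto simp: F_def)
        then show ?thesis using epsF[OF f] augmentation_scl[of c] by (intro image_eqI[of _ _ ?f]) auto
      next
        case False
        have z: "0 \<in> chains F (regular_mod A) 0 j" by simp
        have "eps_map A F 0 = 0" using epsF[OF z] by simp
        then show ?thesis using False c z by (intro image_eqI[of _ _ 0]) (auto simp: residue_mod_def)
      qed
    qed
  next
    fix j
    have "{f \<in> chains F (regular_mod A) 0 j. eps_map A F f = 0} = H 0 j"
    proof -
      have "chains F (regular_mod A) 0 j = ?free {0} (\<lambda>_. 0) j" using ch[of 0 j] by (simp add: X0 e0)
      then show ?thesis using epsF[of _ j] unfolding HH H0_def by (metis (no_types, lifting))
    qed
    also have "\<dots> = bd F (regular_mod A) 1 ` chains F (regular_mod A) 1 j"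
      using img[of 0 j] ch[of 1 j] bd[of 0] by simp
    finally show "{f \<in> chains F (regular_mod A) 0 j. eps_map A F f = 0} =
        bd F (regular_mod A) 1 ` chains F (regular_mod A) 1 j" .
  next
    fix i j :: int assume "0 < i"
    then obtain n where n: "i = int (Suc n)" using nn by blast
    have "{f \<in> chains F (regular_mod A) (int (Suc n)) j. bd F (regular_mod A) (int (Suc n)) f = 0} = H (Suc n) j"
      unfolding ch bd ker ..
    also have "\<dots> = bd F (regular_mod A) (int (Suc (Suc n))) ` chains F (regular_mod A) (int (Suc (Suc n))) j"
      unfolding ch bd img ..
    finally show "{f \<in> chains F (regular_mod A) i j. bd F (regular_mod A) i f = 0} =
        bd F (regular_mod A) (i + 1) ` chains F (regular_mod A) (i + 1) j"
      by (simp add: n add.commute)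
  qed
  then show ?thesis by blast
qed

lemma free_resolution: "resolution A (free_resolution A)"
proof unfold_locales
  show "is_free_resolution A (free_resolution A)"
    unfolding free_resolution_def using exists_resolution by (rule someI_ex)
qed

end

section \<open>Signs of shuffles\<close>

text \<open>The sign that reorders \<open>e_J e_L\<close> into increasing order in the exterior algebra, for disjoint J and L.\<close>

definition shuffle_sign :: "nat set \<Rightarrow> nat set \<Rightarrow> 'r::comm_ring_1" where
  "shuffle_sign J L = (- 1) ^ card {(j, l). j \<in> J \<and> l \<in> L \<and> l < j}"

lemma finite_inversions: "finite J \<Longrightarrow> finite L \<Longrightarrow> finite {(j, l). j \<in> J \<and> l \<in> L \<and> l < (j::nat)}"
  by (rule finite_subset[of _ "J \<times> L"]) auto

lemma shuffle_sign_empty [simp]: "shuffle_sign {} L = 1" "shuffle_sign J {} = 1"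
  by (simp_all add: shuffle_sign_def)

lemma shuffle_sign_Un_left:
  assumes "finite J" "finite J'" "finite L" "J \<inter> J' = {}"
  shows "shuffle_sign (J \<union> J') L = shuffle_sign J L * shuffle_sign J' L"
proof -
  have "{(j, l). j \<in> J \<union> J' \<and> l \<in> L \<and> l < j} =
      {(j, l). j \<in> J \<and> l \<in> L \<and> l < j} \<union> {(j, l). j \<in> J' \<and> l \<in> L \<and> l < j}" by auto
  moreover have "{(j, l). j \<in> J \<and> l \<in> L \<and> l < j} \<inter> {(j, l). j \<in> J' \<and> l \<in> L \<and> l < j} = {}"
    using assms(4) by auto
  ultimately show ?thesis
    using assms by (simp add: shuffle_sign_def card_Un_disjoint finite_inversions power_add)
qed

lemma shuffle_sign_Un_right:
  assumes "finite J" "finite L" "finite L'" "L \<inter> L' = {}"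
  shows "shuffle_sign J (L \<union> L') = shuffle_sign J L * shuffle_sign J L'"
proof -
  have "{(j, l). j \<in> J \<and> l \<in> L \<union> L' \<and> l < j} =
      {(j, l). j \<in> J \<and> l \<in> L \<and> l < j} \<union> {(j, l). j \<in> J \<and> l \<in> L' \<and> l < j}" by auto
  moreover have "{(j, l). j \<in> J \<and> l \<in> L \<and> l < j} \<inter> {(j, l). j \<in> J \<and> l \<in> L' \<and> l < j} = {}"
    using assms(4) by auto
  ultimately show ?thesis
    using assms by (simp add: shuffle_sign_def card_Un_disjoint finite_inversions power_add)
qed

lemma shuffle_sign_insert_left:
  "finite J \<Longrightarrow> finite L \<Longrightarrow> u \<notin> J \<Longrightarrow> shuffle_sign (insert u J) L = shuffle_sign {u} L * shuffle_sign J L"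
  using shuffle_sign_Un_left[of "{u}" J L] by simp

lemma shuffle_sign_insert_right:
  "finite J \<Longrightarrow> finite L \<Longrightarrow> u \<notin> L \<Longrightarrow> shuffle_sign J (insert u L) = shuffle_sign J {u} * shuffle_sign J L"
  using shuffle_sign_Un_right[of J "{u}" L] by simp

lemma shuffle_sign_square: "shuffle_sign J L * shuffle_sign J L = (1::'r::comm_ring_1)"
proof -
  have "(- 1 :: 'r) ^ n * (- 1) ^ n = 1" for n :: nat
    by (metis minus_one_mult_self)
  then show ?thesis by (simp add: shuffle_sign_def)
qed

lemma shuffle_sign_square_left: "shuffle_sign J L * (shuffle_sign J L * x) = x"
  by (simp add: mult.assoc[symmetric] shuffle_sign_square)

lemma shuffle_sign_swap_single:
  "u \<noteq> w \<Longrightarrow> shuffle_sign {u} {w} = - (shuffle_sign {w} {u} :: 'r::comm_ring_1)"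
proof -
  have *: "{(j, l). j \<in> {u} \<and> l \<in> {w} \<and> l < j} = (if w < u then {(u, w)} else {})" for u w :: nat by auto
  show "u \<noteq> w \<Longrightarrow> ?thesis" unfolding shuffle_sign_def * by (cases "w < u") auto
qed

lemma shuffle_sign_swap:
  assumes "finite J" "u \<notin> J"
  shows "shuffle_sign {u} J = (- 1) ^ card J * (shuffle_sign J {u} :: 'r::comm_ring_1)"
  using assms
proof (induction J rule: finite_induct)
  case (insert w J)
  then have "shuffle_sign {u} (insert w J) = shuffle_sign {u} {w} * (shuffle_sign {u} J :: 'r)"
    by (intro shuffle_sign_insert_right) auto
  also have "\<dots> = - shuffle_sign {w} {u} * ((- 1) ^ card J * shuffle_sign J {u})"
    using insert shuffle_sign_swap_single[of u w, where ?'r = 'r] by simp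
  also have "\<dots> = (- 1) ^ card (insert w J) * (shuffle_sign {w} {u} * shuffle_sign J {u})"
    using insert by simp
  also have "shuffle_sign {w} {u} * shuffle_sign J {u} = (shuffle_sign (insert w J) {u} :: 'r)"
    using insert by (intro shuffle_sign_insert_left[symmetric]) auto
  finally show ?case .
qed simp

lemma shuffle_sign_min:
  assumes "\<And>l. l \<in> L \<Longrightarrow> u < l" shows "shuffle_sign {u} L = 1"
proof -
  have e: "{(j, l). j \<in> {u} \<and> l \<in> L \<and> l < j} = {}" using assms by fastforce
  show ?thesis unfolding shuffle_sign_def e by simp
qed

lemma shuffle_sign_less: "v < u \<Longrightarrow> shuffle_sign {u} {v} = - 1"
proof -
  assume "v < u"
  then have e: "{(j, l). j \<in> {u} \<and> l \<in> {v} \<and> l < j} = {(u, v)}" by auto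
  show ?thesis unfolding shuffle_sign_def e by simp
qed

section \<open>The polynomial ring as a graded algebra\<close>

definition monomial_degree :: "('v \<Rightarrow>\<^sub>0 nat) \<Rightarrow> nat" where
  "monomial_degree m = (\<Sum>v\<in>keys m. lookup m v)"

lemma monomial_degree_superset:
  "finite T \<Longrightarrow> keys m \<subseteq> T \<Longrightarrow> monomial_degree m = (\<Sum>v\<in>T. lookup m v)"
  unfolding monomial_degree_def by (rule sum.mono_neutral_left) (auto simp: in_keys_iff)

lemma monomial_degree_add: "monomial_degree (m + m') = monomial_degree m + monomial_degree m'"
proof -
  have "keys (m + m') \<subseteq> keys m \<union> keys m'" by (rule Poly_Mapping.keys_add)
  then show ?thesis
    by (simp add: monomial_degree_superset[of "keys m \<union> keys m'"] lookup_add sum.distrib)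
qed

lemma monomial_degree_single [simp]: "monomial_degree (single v k) = k"
  by (simp add: monomial_degree_superset[of "{v}"])

lemma monomial_degree_0_iff: "monomial_degree m = 0 \<longleftrightarrow> m = 0"
  by (auto simp: monomial_degree_def in_keys_iff intro!: poly_mapping_eqI)

lemma keys_add_nat: "keys (m + m') = keys m \<union> keys (m' :: 'v \<Rightarrow>\<^sub>0 nat)"
  by (auto simp: in_keys_iff lookup_add)

lemma lookup_single_mult:
  fixes p :: "('v \<Rightarrow>\<^sub>0 nat) \<Rightarrow>\<^sub>0 'k::field"
  shows "lookup (single a c * p) k = (\<Sum>m\<in>keys p. if a + m = k then c * lookup p m else 0)"
proof -
  have "single a c * p = (\<Sum>m\<in>keys p. single (a + m) (c * lookup p m))"
    by (subst poly_mapping_sum_single[of p]) (simp add: sum_distrib_left mult_single)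
  then show ?thesis by (simp add: lookup_sum lookup_single when_def)
qed

lemma lookup_single_mult_add:
  fixes p :: "('v \<Rightarrow>\<^sub>0 nat) \<Rightarrow>\<^sub>0 'k::field"
  shows "lookup (single a c * p) (a + m) = c * lookup p m"
  unfolding lookup_single_mult by (simp add: in_keys_iff)

lemma lookup_single_mult_0 [simp]:
  fixes p :: "('v \<Rightarrow>\<^sub>0 nat) \<Rightarrow>\<^sub>0 'k::field"
  shows "lookup (single 0 c * p) m = c * lookup p m"
  using lookup_single_mult_add[of 0 c p m] by simp

definition indeterminate :: "'v \<Rightarrow> (('v \<Rightarrow>\<^sub>0 nat) \<Rightarrow>\<^sub>0 'k::field)" where
  "indeterminate v = single (single v 1) 1"

lemma lookup_indeterminate_mult:
  fixes p :: "('v \<Rightarrow>\<^sub>0 nat) \<Rightarrow>\<^sub>0 'k::field"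
  shows "lookup (indeterminate v * p) m = (if v \<in> keys m then lookup p (m - single v 1) else 0)"
proof (cases "v \<in> keys m")
  case True
  have "m = single v 1 + (m - single v 1)"
    using True by (intro poly_mapping_eqI) (auto simp: lookup_add lookup_minus lookup_single when_def in_keys_iff)
  then have "lookup (indeterminate v * p) m = lookup (single (single v 1) 1 * p) (single v 1 + (m - single v 1))"
    unfolding indeterminate_def by simp
  then show ?thesis using True by (simp only: lookup_single_mult_add) simp
next
  case False
  then have "single v 1 + m' \<noteq> m" for m' by (auto simp: in_keys_iff lookup_add)
  then show ?thesis using False by (simp add: indeterminate_def lookup_single_mult)
qed

context
  fixes B :: "'v set" assumes B: "finite B"
begin

abbreviation S :: "('k::field, ('v \<Rightarrow>\<^sub>0 nat) \<Rightarrow>\<^sub>0 'k) graded_alg" where "S \<equiv> sym_alg B"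

lemma sym_vector_space: "vector_space (scl (S :: ('k::field, ('v \<Rightarrow>\<^sub>0 nat) \<Rightarrow>\<^sub>0 'k) graded_alg))"
  by unfold_locales
    (simp_all add: sym_alg_def single_add distrib_left distrib_right mult_single mult.assoc[symmetric])

lemma gr_sym: "p \<in> gr S n \<longleftrightarrow> (\<forall>m\<in>keys p. keys m \<subseteq> B \<and> monomial_degree m = n)"
  by (simp add: sym_alg_def monomial_degree_def)

lemma int_gr_sym: "p \<in> int_gr S l \<longleftrightarrow> (\<forall>m\<in>keys p. keys m \<subseteq> B \<and> int (monomial_degree m) = l)"
proof (cases "0 \<le> l")
  case False
  have "p = 0 \<longleftrightarrow> keys p = {}" by simp
  then show ?thesis using False by (auto simp: int_gr_def)
qed (auto simp: int_gr_def gr_sym)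

lemma gr_sym_constant:
  assumes "0 < i" "p \<in> gr S i" shows "lookup p 0 = 0"
proof (rule ccontr)
  assume "lookup p 0 \<noteq> 0"
  then have "0 \<in> keys p" by (simp add: in_keys_iff)
  then have "monomial_degree (0 :: 'v \<Rightarrow>\<^sub>0 nat) = i" using assms by (simp add: gr_sym)
  then show False using assms(1) by (simp add: monomial_degree_def)
qed

lemma gr_sym_subspace:
  "module.subspace (scl S) (gr (S :: ('k::field, ('v \<Rightarrow>\<^sub>0 nat) \<Rightarrow>\<^sub>0 'k) graded_alg) i)"
proof -
  interpret vector_space "scl (S :: ('k::field, ('v \<Rightarrow>\<^sub>0 nat) \<Rightarrow>\<^sub>0 'k) graded_alg)" by (rule sym_vector_space)
  show ?thesis
  proof (rule subspaceI)
    fix p q :: "('v \<Rightarrow>\<^sub>0 nat) \<Rightarrow>\<^sub>0 'k" assume "p \<in> gr S i" "q \<in> gr S i"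
    then show "p + q \<in> gr S i" using Poly_Mapping.keys_add[of p q] by (auto simp: gr_sym)
  next
    fix c and p :: "('v \<Rightarrow>\<^sub>0 nat) \<Rightarrow>\<^sub>0 'k" assume "p \<in> gr S i"
    then show "scl S c p \<in> gr S i" unfolding gr_sym by (auto simp: sym_alg_def in_keys_iff)
  next
    show "0 \<in> gr S i" by (simp add: gr_sym)
  qed
qed

lemma augmentation_sym:
  assumes "p \<in> gr (S :: ('k::field, ('v \<Rightarrow>\<^sub>0 nat) \<Rightarrow>\<^sub>0 'k) graded_alg) i" shows "augmentation S p = lookup p 0"
proof -
  let ?S = "S :: ('k::field, ('v \<Rightarrow>\<^sub>0 nat) \<Rightarrow>\<^sub>0 'k) graded_alg"
  interpret vector_space "scl ?S" by (rule sym_vector_space)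
  have pos: "lookup q 0 = 0" if "q \<in> span (\<Union>i\<in>{0<..}. gr ?S i)" for q
    using that
  proof (induction rule: span_induct_alt)
    case (step c x y)
    then have "lookup x 0 = 0" using gr_sym_constant by auto
    then show ?case using step by (simp add: lookup_add sym_alg_def)
  qed simp
  show ?thesis unfolding augmentation_def
  proof (rule the_equality)
    show "p - scl ?S (lookup p 0) 1 \<in> span (\<Union>i\<in>{0<..}. gr ?S i)"
    proof (cases "i = 0")
      case True
      then have "m = 0" if "m \<in> keys p" for m using assms that by (auto simp: gr_sym monomial_degree_0_iff)
      then have "p = scl ?S (lookup p 0) 1"
        by (intro poly_mapping_eqI) (auto simp: sym_alg_def lookup_single when_def in_keys_iff)
      then show ?thesis by (simp add: span_zero)
    next
      case False
      then have "lookup p 0 = 0" using assms gr_sym_constant[of i p] by simp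
      then show ?thesis using assms False by (intro span_base) auto
    qed
  next
    fix c assume "p - scl ?S c 1 \<in> span (\<Union>i\<in>{0<..}. gr ?S i)"
    from pos[OF this] show "c = lookup p 0" by (simp add: lookup_minus sym_alg_def)
  qed
qed

lemma countable_monomials: "countable {m :: 'v \<Rightarrow>\<^sub>0 nat. keys m \<subseteq> B}"
proof -
  obtain bs where bs: "set bs = B" using finite_list[OF B] by blast
  have "inj_on (\<lambda>m. to_nat (map (lookup m) bs)) {m :: 'v \<Rightarrow>\<^sub>0 nat. keys m \<subseteq> B}"
  proof (rule inj_onI, rule poly_mapping_eqI)
    fix m m' :: "'v \<Rightarrow>\<^sub>0 nat" and v
    assume m: "m \<in> {m. keys m \<subseteq> B}" "m' \<in> {m. keys m \<subseteq> B}" "to_nat (map (lookup m) bs) = to_nat (map (lookup m') bs)"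
    then have "\<forall>v\<in>B. lookup m v = lookup m' v" using bs by simp
    then show "lookup m v = lookup m' v"
      using m by (cases "v \<in> B") (auto, metis in_keys_iff subsetD)
  qed
  then show ?thesis by (rule countableI')
qed

lemma sym_algebra: "graded_connected_algebra (S :: ('k::field, ('v \<Rightarrow>\<^sub>0 nat) \<Rightarrow>\<^sub>0 'k) graded_alg)"
proof -
  let ?S = "S :: ('k::field, ('v \<Rightarrow>\<^sub>0 nat) \<Rightarrow>\<^sub>0 'k) graded_alg"
  interpret vector_space "scl ?S" by (rule sym_vector_space)
  have scl1: "scl ?S c 1 \<in> gr ?S 0" for c
    by (auto simp: gr_sym sym_alg_def in_keys_iff lookup_single when_def monomial_degree_def)
  show ?thesis
  proof unfold_locales
    show "scl ?S c (x * y) = scl ?S c x * y" for c x y by (simp add: sym_alg_def mult.assoc)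
    show "subspace (gr ?S i)" for i by (rule gr_sym_subspace)
    show "x * y \<in> gr ?S (i + j)" if "x \<in> gr ?S i" "y \<in> gr ?S j" for x y i j
      using that Poly_Mapping.keys_mult[of x y] unfolding gr_sym
      by (fastforce simp: monomial_degree_add keys_add_nat)
    show "gr ?S 0 = range (\<lambda>c. scl ?S c 1)"
    proof (intro equalityI subsetI)
      fix p assume "p \<in> gr ?S 0"
      then have "m = 0" if "m \<in> keys p" for m using that by (auto simp: gr_sym monomial_degree_0_iff)
      then have "p = scl ?S (lookup p 0) 1"
        by (intro poly_mapping_eqI) (auto simp: sym_alg_def lookup_single when_def in_keys_iff)
      then show "p \<in> range (\<lambda>c. scl ?S c 1)" by blast
    qed (use scl1 in auto)
    show "augmentation ?S (scl ?S c 1) = c" for c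
      using augmentation_sym[OF scl1, of c] by (simp add: sym_alg_def)
    show "augmentation ?S x = 0" if "0 < i" "x \<in> gr ?S i" for x i
      using augmentation_sym[OF that(2)] gr_sym_constant[OF that] by simp
    show "\<exists>C. countable C \<and> gr ?S i \<subseteq> span C" for i
    proof (intro exI conjI subsetI)
      show "countable ((\<lambda>m. single m 1) ` {m :: 'v \<Rightarrow>\<^sub>0 nat. keys m \<subseteq> B})"
        by (intro countable_image countable_monomials)
      fix p assume p: "p \<in> gr ?S i"
      have "p = (\<Sum>m\<in>keys p. scl ?S (lookup p m) (single m 1))"
        by (subst poly_mapping_sum_single[of p]) (simp add: sym_alg_def mult_single)
      also have "\<dots> \<in> span ((\<lambda>m. single m 1) ` {m :: 'v \<Rightarrow>\<^sub>0 nat. keys m \<subseteq> B})"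
        by (intro span_sum span_scale span_base) (use p in \<open>auto simp: gr_sym\<close>)
      finally show "p \<in> span ((\<lambda>m. single m 1) ` {m :: 'v \<Rightarrow>\<^sub>0 nat. keys m \<subseteq> B})" .
    qed
  qed
qed

lemma augmentation_int_gr_sym:
  assumes "p \<in> int_gr (S :: ('k::field, ('v \<Rightarrow>\<^sub>0 nat) \<Rightarrow>\<^sub>0 'k) graded_alg) l" shows "augmentation S p = lookup p 0"
proof (cases "0 \<le> l")
  case True
  then show ?thesis using assms augmentation_sym[of p "nat l"] by (simp add: int_gr_def)
next
  case False
  interpret graded_connected_algebra "S :: ('k::field, ('v \<Rightarrow>\<^sub>0 nat) \<Rightarrow>\<^sub>0 'k) graded_alg" by (rule sym_algebra)
  show ?thesis using assms False augmentation_0 by (simp add: int_gr_def)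
qed

end

section \<open>The Koszul complex\<close>

text \<open>The exterior monomial on a set of indices is labelled by the binary code of the set; the
  variable with index u is \<open>indeterminate (b u)\<close>.\<close>

definition koszul :: "(nat \<Rightarrow> 'v) \<Rightarrow> nat \<Rightarrow> ('k::field, ('v \<Rightarrow>\<^sub>0 nat) \<Rightarrow>\<^sub>0 'k) free_complex" where
  "koszul b n = \<lparr>gens = (\<lambda>i. set_encode ` {I. I \<subseteq> {..<n} \<and> int (card I) = i}),
     gdeg = (\<lambda>i _. i),
     dif = (\<lambda>i c. \<Sum>u\<in>set_decode c. single (set_encode (set_decode c - {u}))
         (shuffle_sign {u} (set_decode c - {u}) * indeterminate (b u))),
     eps = (\<lambda>_. 1)\<rparr>"

lemma gens_koszul: "gens (koszul b n) i = set_encode ` {I. I \<subseteq> {..<n} \<and> int (card I) = i}"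
  and gdeg_koszul [simp]: "gdeg (koszul b n) i x = i"
  and eps_koszul [simp]: "eps (koszul b n) x = 1"
  by (simp_all add: koszul_def)

lemma set_encode_eq_iff: "finite I \<Longrightarrow> finite J \<Longrightarrow> set_encode I = set_encode J \<longleftrightarrow> I = J"
  by (metis set_encode_inverse)

lemma subset_lessThan_finite: "I \<subseteq> {..<n::nat} \<Longrightarrow> finite I"
  by (rule finite_subset) auto

lemma lookup_sum_faces:
  fixes h :: "nat set \<Rightarrow> 'm::comm_monoid_add"
  assumes "I \<subseteq> {..<n}"
  shows "lookup (\<Sum>I\<in>Pow {..<n}. single (set_encode I) (h I)) (set_encode I) = h I"
proof -
  have "lookup (\<Sum>I\<in>Pow {..<n}. single (set_encode I) (h I)) (set_encode I) =
      (\<Sum>J\<in>Pow {..<n}. if J = I then h J else 0)"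
    unfolding lookup_sum lookup_single when_def
  proof (rule sum.cong[OF refl])
    fix J assume "J \<in> Pow {..<n}"
    then have "set_encode J = set_encode I \<longleftrightarrow> J = I"
      using set_encode_eq_iff[of J I] subset_lessThan_finite[of J n] subset_lessThan_finite[OF assms] by simp
    then show "(if set_encode J = set_encode I then h J else 0) = (if J = I then h J else 0)" by simp
  qed
  then show ?thesis using assms by simp
qed

lemma keys_sum_faces:
  fixes h :: "nat set \<Rightarrow> 'm::comm_monoid_add"
  shows "keys (\<Sum>I\<in>Pow {..<n}. single (set_encode I) (h I)) \<subseteq> set_encode ` {I. I \<subseteq> {..<n} \<and> h I \<noteq> 0}"
proof
  fix c assume c: "c \<in> keys (\<Sum>I\<in>Pow {..<n}. single (set_encode I) (h I))"
  then have "(\<Sum>I\<in>Pow {..<n}. lookup (single (set_encode I) (h I)) c) \<noteq> 0"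
    by (simp add: in_keys_iff lookup_sum)
  then obtain I where "I \<in> Pow {..<n}" "lookup (single (set_encode I) (h I)) c \<noteq> 0" by (meson sum.neutral)
  then show "c \<in> set_encode ` {I. I \<subseteq> {..<n} \<and> h I \<noteq> 0}" by (auto simp: lookup_single when_def split: if_splits)
qed

lemma set_encode_gens: "finite I \<Longrightarrow> set_encode I \<in> gens (koszul b n) i \<longleftrightarrow> I \<subseteq> {..<n} \<and> int (card I) = i"
  by (auto simp: gens_koszul set_encode_eq_iff subset_lessThan_finite)

lemma gens_cases:
  assumes "c \<in> gens (koszul b n) i"
  obtains I where "I \<subseteq> {..<n}" "finite I" "int (card I) = i" "c = set_encode I"
  using assms by (auto simp: gens_koszul subset_lessThan_finite)

lemma koszul_chain_eqI:
  assumes "f \<in> chains (koszul b n) N i j" "g \<in> chains (koszul b n) N i j"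
    and "\<And>I. I \<subseteq> {..<n} \<Longrightarrow> finite I \<Longrightarrow> int (card I) = i \<Longrightarrow> lookup f (set_encode I) = lookup g (set_encode I)"
  shows "f = g"
proof (rule poly_mapping_eqI)
  fix c show "lookup f c = lookup g c"
  proof (cases "c \<in> set_encode ` {I. I \<subseteq> {..<n} \<and> int (card I) = i}")
    case True
    then show ?thesis using assms(3) subset_lessThan_finite by auto
  next
    case False
    then show ?thesis
      using chains_outside[OF assms(1), unfolded gens_koszul] chains_outside[OF assms(2), unfolded gens_koszul]
      by metis
  qed
qed

lemma lookup_dif_koszul:
  assumes I: "finite I" and J: "finite J"
  shows "lookup (dif (koszul b n) i (set_encode I)) (set_encode J) =
    (\<Sum>u\<in>I. if I - {u} = J then shuffle_sign {u} J * indeterminate (b u) else 0)"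
proof -
  have "lookup (dif (koszul b n) i (set_encode I)) (set_encode J) =
     (\<Sum>u\<in>I. if set_encode (I - {u}) = set_encode J
        then shuffle_sign {u} (I - {u}) * indeterminate (b u) else 0)"
    using I by (simp add: koszul_def set_encode_inverse lookup_sum lookup_single when_def)
  also have "\<dots> = (\<Sum>u\<in>I. if I - {u} = J then shuffle_sign {u} J * indeterminate (b u) else 0)"
    using I J by (intro sum.cong) (auto simp: set_encode_eq_iff)
  finally show ?thesis .
qed

lemma lookup_bd_koszul:
  assumes "graded_module A N" and J: "finite J" and f: "keys f \<subseteq> set_encode ` Pow {..<n}"
  shows "lookup (bd (koszul b n) N i f) (set_encode J) =
     (\<Sum>u\<in>{..<n} - J. act N (shuffle_sign {u} J * indeterminate (b u)) (lookup f (set_encode (insert u J))))"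
proof -
  interpret graded_module A N by fact
  have inj: "inj_on set_encode (Pow {..<n})"
    by (auto intro!: inj_onI simp: set_encode_eq_iff subset_lessThan_finite)
  let ?t = "\<lambda>u. act N (shuffle_sign {u} J * indeterminate (b u)) (lookup f (set_encode (insert u J)))"
  have "lookup (bd (koszul b n) N i f) (set_encode J) =
     (\<Sum>I\<in>Pow {..<n}. act N (lookup (dif (koszul b n) i (set_encode I)) (set_encode J)) (lookup f (set_encode I)))"
    by (subst lookup_bd_superset[OF _ f]) (simp_all add: sum.reindex[OF inj])
  also have "\<dots> = (\<Sum>I\<in>Pow {..<n}. \<Sum>u\<in>{..<n} - J. if I = insert u J then ?t u else 0)"
  proof (rule sum.cong[OF refl])
    fix I assume I: "I \<in> Pow {..<n}"
    then have fI: "finite I" by (auto intro: subset_lessThan_finite)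
    have "act N (lookup (dif (koszul b n) i (set_encode I)) (set_encode J)) (lookup f (set_encode I)) =
        (\<Sum>u\<in>I. if I - {u} = J then act N (shuffle_sign {u} J * indeterminate (b u)) (lookup f (set_encode I)) else 0)"
      by (simp add: lookup_dif_koszul[OF fI J] sum_act if_distrib[of "\<lambda>x. act N x _"] cong: if_cong)
    also have "\<dots> = (\<Sum>u\<in>{..<n} - J. if I = insert u J then ?t u else 0)"
      using I by (intro sum.mono_neutral_cong) (auto simp: fI)
    finally show "act N (lookup (dif (koszul b n) i (set_encode I)) (set_encode J)) (lookup f (set_encode I)) =
        (\<Sum>u\<in>{..<n} - J. if I = insert u J then ?t u else 0)" .
  qed
  also have "\<dots> = (\<Sum>u\<in>{..<n} - J. \<Sum>I\<in>Pow {..<n}. if I = insert u J then ?t u else 0)"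
    by (rule sum.swap)
  also have "\<dots> = (\<Sum>u\<in>{..<n} - J. ?t u)"
  proof (rule sum.cong[OF refl])
    fix u assume u: "u \<in> {..<n} - J"
    show "(\<Sum>I\<in>Pow {..<n}. if I = insert u J then ?t u else 0) = ?t u"
    proof (cases "insert u J \<in> Pow {..<n}")
      case True
      then show ?thesis by (simp add: sum.delta')
    next
      case False
      then have "set_encode (insert u J) \<notin> set_encode ` Pow {..<n}"
        using J by (auto simp: set_encode_eq_iff subset_lessThan_finite)
      then have "lookup f (set_encode (insert u J)) = 0" using f by (auto simp: in_keys_iff)
      then show ?thesis using False by (simp add: sum.delta')
    qed
  qed
  finally show ?thesis .
qed

lemma chains_koszul_keys: "f \<in> chains (koszul b n) N i j \<Longrightarrow> keys f \<subseteq> set_encode ` Pow {..<n}"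
  by (drule chains_keys, unfold gens_koszul, erule subset_trans) (intro image_mono, auto)

lemma lookup_shuffle_sign_mult:
  fixes p :: "('v \<Rightarrow>\<^sub>0 nat) \<Rightarrow>\<^sub>0 'k::field"
  shows "lookup (shuffle_sign J L * p) m = shuffle_sign J L * lookup p m"
  by (cases "even (card {(j, l). j \<in> J \<and> l \<in> L \<and> l < j})") (simp_all add: shuffle_sign_def)

text \<open>Pairing the summands, instead of comparing the sum with its negative, covers characteristic 2.\<close>

lemma sum_antisymmetric:
  fixes g :: "nat \<Rightarrow> nat \<Rightarrow> 'b::ab_group_add"
  assumes "finite T" and "\<And>u w. u \<in> T \<Longrightarrow> w \<in> T \<Longrightarrow> u \<noteq> w \<Longrightarrow> g u w = - g w u"
  shows "(\<Sum>u\<in>T. \<Sum>w\<in>T - {u}. g u w) = 0"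
  using assms
proof (induction T rule: finite_induct)
  case (insert x T)
  note fin = insert(1,2)
  have "(\<Sum>w\<in>insert x T - {u}. g u w) = g u x + (\<Sum>w\<in>T - {u}. g u w)" if "u \<in> T" for u
  proof -
    have "insert x T - {u} = insert x (T - {u})" using that fin by auto
    then show ?thesis using fin by simp
  qed
  then have "(\<Sum>u\<in>insert x T. \<Sum>w\<in>insert x T - {u}. g u w) =
      (\<Sum>w\<in>T. g x w) + ((\<Sum>u\<in>T. g u x) + (\<Sum>u\<in>T. \<Sum>w\<in>T - {u}. g u w))"
    using fin by (simp add: sum.distrib)
  also have "(\<Sum>u\<in>T. g u x) = (\<Sum>u\<in>T. - g x u)"
    by (rule sum.cong[OF refl]) (rule insert.prems, use fin in auto)
  also have "(\<Sum>u\<in>T. \<Sum>w\<in>T - {u}. g u w) = 0" by (rule insert.IH) (rule insert.prems, auto)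
  finally show ?case by (simp add: sum_negf)
qed simp

locale koszul_polynomial =
  fixes B :: "'v set" and b :: "nat \<Rightarrow> 'v" and n :: nat
    and T :: "('k::field, ('v \<Rightarrow>\<^sub>0 nat) \<Rightarrow>\<^sub>0 'k) graded_alg"
  assumes bij: "bij_betw b {..<n} B" and T: "T = sym_alg B"
begin

abbreviation K :: "('k, ('v \<Rightarrow>\<^sub>0 nat) \<Rightarrow>\<^sub>0 'k) free_complex" where "K \<equiv> koszul b n"

lemma finite_B: "finite B"
  using bij bij_betw_finite by auto

sublocale graded_connected_algebra T
  unfolding T by (rule sym_algebra[OF finite_B])

lemma b_in: "u < n \<Longrightarrow> b u \<in> B"
  using bij by (auto simp: bij_betw_def)

lemma b_inj: "u < n \<Longrightarrow> w < n \<Longrightarrow> b u = b w \<longleftrightarrow> u = w"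
  using bij by (auto simp: bij_betw_def inj_on_def)

lemma b_surj: "v \<in> B \<Longrightarrow> \<exists>u<n. b u = v"
  using bij by (auto simp: bij_betw_def)

lemma int_gr_iff: "p \<in> int_gr T l \<longleftrightarrow> (\<forall>m\<in>keys p. keys m \<subseteq> B \<and> int (monomial_degree m) = l)"
  unfolding T by (rule int_gr_sym[OF finite_B])

lemma indeterminate_gr: "u < n \<Longrightarrow> shuffle_sign J L * indeterminate (b u) \<in> int_gr T 1"
  unfolding int_gr_iff using b_in
  by (auto simp: in_keys_iff lookup_shuffle_sign_mult indeterminate_def lookup_single when_def split: if_splits)

lemma koszul_free: "free_differential T K"
  unfolding free_differential_def
proof (intro allI ballI chainsI)
  fix i x assume "x \<in> gens K i"
  then obtain I where I: "I \<subseteq> {..<n}" "finite I" "int (card I) = i" "x = set_encode I" by (rule gens_cases)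
  have face: "set_encode (I - {u}) \<in> gens K (i - 1)" if "u \<in> I" for u
  proof -
    have "card I = Suc (card (I - {u}))" using card.remove[OF I(2) that] .
    then show ?thesis using I by (subst set_encode_gens) auto
  qed
  show "keys (dif K i x) \<subseteq> gens K (i - 1)"
  proof
    fix c assume "c \<in> keys (dif K i x)"
    then have "(\<Sum>u\<in>I. lookup (single (set_encode (I - {u})) (shuffle_sign {u} (I - {u}) * indeterminate (b u) :: ('v \<Rightarrow>\<^sub>0 nat) \<Rightarrow>\<^sub>0 'k)) c) \<noteq> 0"
      using I by (simp add: koszul_def in_keys_iff lookup_sum set_encode_inverse)
    then obtain u where "u \<in> I" "lookup (single (set_encode (I - {u})) (shuffle_sign {u} (I - {u}) * indeterminate (b u) :: ('v \<Rightarrow>\<^sub>0 nat) \<Rightarrow>\<^sub>0 'k)) c \<noteq> 0"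
      by (meson sum.neutral)
    then show "c \<in> gens K (i - 1)" using face by (auto simp: lookup_single when_def split: if_splits)
  qed
  fix c assume "c \<in> gens K (i - 1)"
  then obtain J where J: "J \<subseteq> {..<n}" "finite J" "int (card J) = i - 1" "c = set_encode J" by (rule gens_cases)
  have "lookup (dif K i x) c \<in> int_gr T 1"
    unfolding I(4) J(4) lookup_dif_koszul[OF I(2) J(2)]
    by (rule reg.hcomp_sum[of _ _ 1, simplified hcomp_regular]) (use indeterminate_gr I(1) in auto)
  then show "lookup (dif K i x) c \<in> hcomp (regular_mod T) (gdeg K i x - gdeg K (i - 1) c)" by simp
qed

lemma lookup_bd:
  assumes "finite J" "f \<in> chains K (regular_mod T) i j"
  shows "lookup (bd K (regular_mod T) i f) (set_encode J) =
     (\<Sum>u\<in>{..<n} - J. shuffle_sign {u} J * indeterminate (b u) * lookup f (set_encode (insert u J)))"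
  using lookup_bd_koszul[OF regular_module assms(1) chains_koszul_keys[OF assms(2)]] by simp

lemma bd_bd_koszul:
  assumes f: "f \<in> chains K (regular_mod T) (i + 1) j"
  shows "bd K (regular_mod T) i (bd K (regular_mod T) (i + 1) f) = 0"
proof (rule koszul_chain_eqI)
  let ?d = "bd K (regular_mod T)"
  have df: "?d (i + 1) f \<in> chains K (regular_mod T) i j" by (rule reg.bd_chains_Suc[OF koszul_free f])
  show "?d i (?d (i + 1) f) \<in> chains K (regular_mod T) (i - 1) j" by (rule reg.bd_chains[OF koszul_free df])
  show "0 \<in> chains K (regular_mod T) (i - 1) j" by simp
  fix J :: "nat set" assume J: "finite J"
  let ?g = "\<lambda>u w. shuffle_sign {u} J * indeterminate (b u) *
     (shuffle_sign {w} (insert u J) * indeterminate (b w) * lookup f (set_encode (insert w (insert u J))))"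
  have "lookup (?d i (?d (i + 1) f)) (set_encode J) = (\<Sum>u\<in>{..<n} - J. \<Sum>w\<in>{..<n} - J - {u}. ?g u w)"
    unfolding lookup_bd[OF J df]
  proof (rule sum.cong[OF refl])
    fix u
    have "lookup (?d (i + 1) f) (set_encode (insert u J)) = (\<Sum>w\<in>{..<n} - insert u J.
        shuffle_sign {w} (insert u J) * indeterminate (b w) * lookup f (set_encode (insert w (insert u J))))"
      using lookup_bd[OF _ f, of "insert u J"] J by simp
    moreover have "{..<n} - insert u J = {..<n} - J - {u}" by auto
    ultimately show "shuffle_sign {u} J * indeterminate (b u) * lookup (?d (i + 1) f) (set_encode (insert u J)) =
        (\<Sum>w\<in>{..<n} - J - {u}. ?g u w)" by (simp add: sum_distrib_left)
  qed
  also have "\<dots> = 0"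
  proof (rule sum_antisymmetric)
    fix u w assume uw: "u \<in> {..<n} - J" "w \<in> {..<n} - J" "u \<noteq> w"
    have "shuffle_sign {w} (insert u J) = shuffle_sign {w} {u} * (shuffle_sign {w} J :: ('v \<Rightarrow>\<^sub>0 nat) \<Rightarrow>\<^sub>0 'k)"
      "shuffle_sign {u} (insert w J) = shuffle_sign {u} {w} * (shuffle_sign {u} J :: ('v \<Rightarrow>\<^sub>0 nat) \<Rightarrow>\<^sub>0 'k)"
      using uw J by (auto intro!: shuffle_sign_insert_right)
    then show "?g u w = - ?g w u"
      using shuffle_sign_swap_single[OF uw(3), where ?'r = "('v \<Rightarrow>\<^sub>0 nat) \<Rightarrow>\<^sub>0 'k"]
      by (simp add: insert_commute algebra_simps)
  qed simp
  finally show "lookup (?d i (?d (i + 1) f)) (set_encode J) = lookup 0 (set_encode J)" by simp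
qed

lemma lookup_bd_coeff:
  assumes "finite J" "f \<in> chains K (regular_mod T) i j"
  shows "lookup (lookup (bd K (regular_mod T) i f) (set_encode J)) m =
     (\<Sum>u\<in>{u \<in> {..<n} - J. b u \<in> keys m}. shuffle_sign {u} J *
        lookup (lookup f (set_encode (insert u J))) (m - single (b u) 1))"
proof -
  have "lookup (lookup (bd K (regular_mod T) i f) (set_encode J)) m =
     (\<Sum>u\<in>{..<n} - J. shuffle_sign {u} J * (if b u \<in> keys m
        then lookup (lookup f (set_encode (insert u J))) (m - single (b u) 1) else 0))"
    by (simp add: lookup_bd[OF assms] lookup_sum mult.assoc lookup_shuffle_sign_mult lookup_indeterminate_mult)
  also have "\<dots> = (\<Sum>u\<in>{u \<in> {..<n} - J. b u \<in> keys m}. shuffle_sign {u} J *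
        lookup (lookup f (set_encode (insert u J))) (m - single (b u) 1))"
    by (rule sum.mono_neutral_cong_right) auto
  finally show ?thesis .
qed

text \<open>A contracting homotopy of the Koszul complex in terms of the basis of the products of a monomial
  m with an exterior monomial on I: if the least index v that occurs in m or I occurs in m only, one
  factor of the variable v is moved to the exterior monomial. The differential moves factors in the other direction, so
  that the union of the indices occurring, and hence v, never changes. This works in all
  characteristics.\<close>

definition indices :: "('v \<Rightarrow>\<^sub>0 nat) \<Rightarrow> nat set \<Rightarrow> nat set" where
  "indices m I = {u \<in> {..<n}. b u \<in> keys m} \<union> I"

definition homotopy_coeff ::
  "(nat \<Rightarrow>\<^sub>0 (('v \<Rightarrow>\<^sub>0 nat) \<Rightarrow>\<^sub>0 'k)) \<Rightarrow> nat set \<Rightarrow> ('v \<Rightarrow>\<^sub>0 nat) \<Rightarrow> 'k" where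
  "homotopy_coeff f I m = (let v = Min (indices m I) in
     if I \<subseteq> {..<n} \<and> v \<in> I then lookup (lookup f (set_encode (I - {v}))) (m + single (b v) 1) else 0)"

definition homotopy ::
  "(nat \<Rightarrow>\<^sub>0 (('v \<Rightarrow>\<^sub>0 nat) \<Rightarrow>\<^sub>0 'k)) \<Rightarrow> (nat \<Rightarrow>\<^sub>0 (('v \<Rightarrow>\<^sub>0 nat) \<Rightarrow>\<^sub>0 'k))" where
  "homotopy f = (\<Sum>I\<in>Pow {..<n}. single (set_encode I) (Abs_poly_mapping (homotopy_coeff f I)))"

lemma finite_homotopy_coeff: "finite {m. homotopy_coeff f I m \<noteq> 0}"
proof (rule finite_subset)
  show "{m. homotopy_coeff f I m \<noteq> 0} \<subseteq>
     (\<Union>v\<in>{..<n}. {m. m + single (b v) 1 \<in> keys (lookup f (set_encode (I - {v})))})"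
    by (auto simp: homotopy_coeff_def Let_def in_keys_iff split: if_splits)
  have "finite {m. m + single (b v) 1 \<in> M}" if "finite M" for v and M :: "('v \<Rightarrow>\<^sub>0 nat) set"
    using finite_vimageI[OF that, of "\<lambda>m. m + single (b v) 1"] by (simp add: vimage_def inj_def)
  then show "finite (\<Union>v\<in>{..<n}. {m. m + single (b v) 1 \<in> keys (lookup f (set_encode (I - {v})))})"
    by simp
qed

lemma lookup_homotopy:
  "I \<subseteq> {..<n} \<Longrightarrow> lookup (lookup (homotopy f) (set_encode I)) m = homotopy_coeff f I m"
  by (simp add: homotopy_def lookup_sum_faces finite_homotopy_coeff)

lemma homotopy_chains:
  assumes f: "f \<in> chains K (regular_mod T) i j"
  shows "homotopy f \<in> chains K (regular_mod T) (i + 1) j"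
proof (rule chainsI)
  have face: "I - {v} \<subseteq> {..<n} \<and> finite (I - {v}) \<and> card I = Suc (card (I - {v}))"
    if "I \<subseteq> {..<n}" "v \<in> I" for I v
    using that card.remove[of I v] subset_lessThan_finite by auto
  show "keys (homotopy f) \<subseteq> gens K (i + 1)"
  proof
    fix c assume c: "c \<in> keys (homotopy f)"
    then have "c \<in> set_encode ` {I. I \<subseteq> {..<n} \<and> Abs_poly_mapping (homotopy_coeff f I) \<noteq> 0}"
      unfolding homotopy_def by (rule subsetD[OF keys_sum_faces])
    then obtain I where I: "I \<subseteq> {..<n}" "c = set_encode I" by blast
    obtain m where "homotopy_coeff f I m \<noteq> 0"
      using c lookup_homotopy[OF I(1)] unfolding I(2) in_keys_iff by (metis lookup_zero poly_mapping_eqI)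
    then have "Min (indices m I) \<in> I" "lookup f (set_encode (I - {Min (indices m I)})) \<noteq> 0"
      by (auto simp: homotopy_coeff_def Let_def split: if_splits)
    then obtain v where v: "v \<in> I" "lookup f (set_encode (I - {v})) \<noteq> 0" by blast
    then have "set_encode (I - {v}) \<in> gens K i" using chains_outside[OF f] by blast
    then show "c \<in> gens K (i + 1)"
      using face[OF I(1) v(1)] I subset_lessThan_finite[OF I(1)] by (auto simp: set_encode_gens)
  qed
next
  fix c assume "c \<in> gens K (i + 1)"
  then obtain I where I: "I \<subseteq> {..<n}" "finite I" "int (card I) = i + 1" "c = set_encode I" by (rule gens_cases)
  have "lookup (homotopy f) c \<in> int_gr T (j - (i + 1))"
    unfolding int_gr_iff
  proof
    fix m assume "m \<in> keys (lookup (homotopy f) c)"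
    then have "homotopy_coeff f I m \<noteq> 0" using lookup_homotopy[OF I(1)] I(4) by (simp add: in_keys_iff)
    then obtain v where v: "v \<in> I" "m + single (b v) 1 \<in> keys (lookup f (set_encode (I - {v})))"
      by (auto simp: homotopy_coeff_def Let_def in_keys_iff split: if_splits)
    then have "set_encode (I - {v}) \<in> gens K i" using chains_outside[OF f] by fastforce
    from chains_lookup[OF f this] v(2)
    have "keys (m + single (b v) 1) \<subseteq> B \<and> int (monomial_degree (m + single (b v) 1)) = j - i"
      unfolding int_gr_iff hcomp_regular gdeg_koszul by blast
    then show "keys m \<subseteq> B \<and> int (monomial_degree m) = j - (i + 1)"
      unfolding keys_add_nat monomial_degree_add by simp
  qed
  then show "lookup (homotopy f) c \<in> hcomp (regular_mod T) (j - gdeg K (i + 1) c)" by simp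
qed

lemma homotopy:
  assumes f: "f \<in> chains K (regular_mod T) i j" "0 \<le> i"
    and cycle: "0 < i \<Longrightarrow> bd K (regular_mod T) i f = 0"
    and aug: "i = 0 \<Longrightarrow> lookup (lookup f (set_encode {})) 0 = 0"
  shows "bd K (regular_mod T) (i + 1) (homotopy f) = f"
proof (rule koszul_chain_eqI)
  let ?d = "bd K (regular_mod T)" and ?E = "\<lambda>u. single (b u) (1::nat)"
  let ?c = "\<lambda>I m. lookup (lookup f (set_encode I)) m"
  let ?c' = "\<lambda>I m. lookup (lookup (homotopy f) (set_encode I)) m"
  have h: "homotopy f \<in> chains K (regular_mod T) (i + 1) j" by (rule homotopy_chains[OF f(1)])
  show "?d (i + 1) (homotopy f) \<in> chains K (regular_mod T) i j" by (rule reg.bd_chains_Suc[OF koszul_free h])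
  show "f \<in> chains K (regular_mod T) i j" by fact
  fix I assume I: "I \<subseteq> {..<n}" "finite I" "int (card I) = i"
  show "lookup (?d (i + 1) (homotopy f)) (set_encode I) = lookup f (set_encode I)"
  proof (rule poly_mapping_eqI)
    fix m
    let ?V = "indices m I"
    let ?U = "{u \<in> {..<n} - I. b u \<in> keys m}"
    have V: "finite ?V" "?V \<subseteq> {..<n}" using I by (auto simp: indices_def)
    have split: "m - ?E u + ?E u = m" if "b u \<in> keys m" for u
      using that by (intro poly_mapping_eqI) (auto simp: lookup_add lookup_minus lookup_single when_def in_keys_iff)
    have Vu: "indices (m - ?E u) (insert u I) = ?V" if "u \<in> ?U" for u
    proof -
      have "keys m = keys (m - ?E u) \<union> {b u}"
        using split[of u] keys_add_nat[of "m - ?E u" "?E u"] that by simp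
      then show ?thesis using that b_inj[of _ u] by (auto simp: indices_def)
    qed
    have L: "lookup (lookup (?d (i + 1) (homotopy f)) (set_encode I)) m =
        (\<Sum>u\<in>?U. shuffle_sign {u} I * homotopy_coeff f (insert u I) (m - ?E u))"
      unfolding lookup_bd_coeff[OF I(2) h]
    proof (rule sum.cong[OF refl])
      fix u assume "u \<in> ?U"
      then have "insert u I \<subseteq> {..<n}" using I by simp
      then show "shuffle_sign {u} I * ?c' (insert u I) (m - ?E u) =
          shuffle_sign {u} I * homotopy_coeff f (insert u I) (m - ?E u)"
        by (simp only: lookup_homotopy)
    qed
    consider (empty) "?V = {}" | (inner) "?V \<noteq> {}" "Min ?V \<in> I" | (outer) "?V \<noteq> {}" "Min ?V \<notin> I" by blast
    then show "lookup (lookup (?d (i + 1) (homotopy f)) (set_encode I)) m = ?c I m"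
    proof cases
      case empty
      then have "I = {}" "i = 0" "?U = {}" using I by (auto simp: indices_def)
      have "?c I m = 0"
      proof (rule ccontr)
        assume "?c I m \<noteq> 0"
        then have m: "m \<in> keys (lookup f (set_encode I))" by (simp add: in_keys_iff)
        have "set_encode I \<in> gens K i" using I by (simp add: set_encode_gens)
        from chains_lookup[OF f(1) this] m have "keys m \<subseteq> B" by (auto simp: int_gr_iff)
        then have "keys m = {}" using empty b_surj by (fastforce simp: indices_def)
        then have "m = 0" by simp
        then show False using aug \<open>i = 0\<close> \<open>I = {}\<close> \<open>?c I m \<noteq> 0\<close> by simp
      qed
      then show ?thesis unfolding L \<open>?U = {}\<close> by simp
    next
      \<comment> \<open>Here the summand with index v of the differential takes the coefficient back, and the others are 0.\<close>
      case outer
      let ?v = "Min ?V"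
      have v: "?v \<in> ?V" using Min_in[OF V(1) outer(1)] .
      then have vU: "?v \<in> ?U" using outer by (auto simp: indices_def)
      have min: "?v < l" if "l \<in> I" for l
        using Min_le[OF V(1), of l] that outer by (auto simp: indices_def less_le)
      have "(\<Sum>u\<in>?U. shuffle_sign {u} I * homotopy_coeff f (insert u I) (m - ?E u)) =
          (\<Sum>u\<in>?U. if u = ?v then ?c I m else 0)"
      proof (rule sum.cong[OF refl])
        fix u assume u: "u \<in> ?U"
        show "shuffle_sign {u} I * homotopy_coeff f (insert u I) (m - ?E u) = (if u = ?v then ?c I m else 0)"
        proof (cases "u = ?v")
          case True
          have "homotopy_coeff f (insert u I) (m - ?E u) =
              lookup (lookup f (set_encode (insert u I - {u}))) (m - ?E u + ?E u)"
            unfolding homotopy_coeff_def Vu[OF u] Let_def True[symmetric] using u I by simp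
          moreover have "insert u I - {u} = I" using u by auto
          moreover have "m - ?E u + ?E u = m" using split[of u] u by blast
          moreover have "shuffle_sign {u} I = (1 :: 'k)" by (rule shuffle_sign_min) (use min True in simp)
          ultimately show ?thesis using True by simp
        next
          case False
          have "homotopy_coeff f (insert u I) (m - ?E u) = 0"
            unfolding homotopy_coeff_def Vu[OF u] Let_def using outer False by simp
          then show ?thesis using False by simp
        qed
      qed
      then show ?thesis unfolding L using vU V by simp
    next
      case inner
      let ?v = "Min ?V"
      have vn: "?v < n" using inner I by auto
      have i: "0 < i" using inner I by (metis card_gt_0_iff empty_iff of_nat_0_less_iff)
      let ?J = "I - {?v}" and ?m = "m + ?E ?v"
      have min: "?v < l" if "l \<in> ?V" "l \<noteq> ?v" for l
        using Min_le[OF V(1) that(1)] that(2) by simp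
      \<comment> \<open>The coefficient of the cycle condition at the exterior monomial without v and the monomial times the variable v.\<close>
      have "0 = lookup (lookup (?d i f) (set_encode ?J)) ?m" using cycle[OF i] by simp
      also have "\<dots> = (\<Sum>u\<in>{u \<in> {..<n} - ?J. b u \<in> keys ?m}. shuffle_sign {u} ?J * ?c (insert u ?J) (?m - ?E u))"
        by (rule lookup_bd_coeff[OF _ f(1)]) (use I in simp)
      also have "{u \<in> {..<n} - ?J. b u \<in> keys ?m} = insert ?v ?U"
        using vn b_inj[OF _ vn] inner by (auto simp: keys_add_nat)
      also have "(\<Sum>u\<in>insert ?v ?U. shuffle_sign {u} ?J * ?c (insert u ?J) (?m - ?E u)) =
          ?c I m + (\<Sum>u\<in>?U. shuffle_sign {u} ?J * ?c (insert u ?J) (?m - ?E u))"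
      proof -
        have "shuffle_sign {?v} ?J = (1 :: 'k)" by (rule shuffle_sign_min) (use min in \<open>auto simp: indices_def\<close>)
        moreover have "insert ?v ?J = I" using inner by auto
        ultimately show ?thesis using inner by simp
      qed
      also have "(\<Sum>u\<in>?U. shuffle_sign {u} ?J * ?c (insert u ?J) (?m - ?E u)) =
          (\<Sum>u\<in>?U. - (shuffle_sign {u} I * homotopy_coeff f (insert u I) (m - ?E u)))"
      proof (rule sum.cong[OF refl])
        fix u assume u: "u \<in> ?U"
        have uv: "?v < u" using u inner by (intro min) (auto simp: indices_def)
        have "shuffle_sign {u} I = shuffle_sign {u} (insert ?v ?J)" using inner by (simp add: insert_absorb)
        also have "\<dots> = (shuffle_sign {u} {?v} * shuffle_sign {u} ?J :: 'k)"
          using I by (intro shuffle_sign_insert_right) auto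
        also have "\<dots> = - shuffle_sign {u} ?J" using shuffle_sign_less[OF uv, where ?'a = 'k] by simp
        finally have s: "shuffle_sign {u} I = (- shuffle_sign {u} ?J :: 'k)" .
        have "?m - ?E u = m - ?E u + ?E ?v"
          using u by (intro poly_mapping_eqI) (auto simp: lookup_add lookup_minus lookup_single when_def in_keys_iff)
        moreover have "insert u ?J = insert u I - {?v}" using uv by auto
        ultimately have "homotopy_coeff f (insert u I) (m - ?E u) = ?c (insert u ?J) (?m - ?E u)"
          unfolding homotopy_coeff_def Vu[OF u] Let_def using u I inner by simp
        then show "shuffle_sign {u} ?J * ?c (insert u ?J) (?m - ?E u) =
            - (shuffle_sign {u} I * homotopy_coeff f (insert u I) (m - ?E u))" by (simp add: s)
      qed
      finally show ?thesis unfolding L by (simp add: sum_negf)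
    qed
  qed
qed

lemma koszul_gens_0: "gens K 0 = {set_encode {}}"
  by (auto simp: gens_koszul card_eq_0_iff subset_lessThan_finite intro!: image_eqI[of _ _ "{}"])

lemma koszul_resolution: "resolution T K"
proof unfold_locales
  let ?c = "chains K (regular_mod T)" and ?d = "bd K (regular_mod T)" and ?o = "set_encode {}"
  have gr0: "lookup f ?o \<in> int_gr T j" if "f \<in> ?c 0 j" for f j
    using chains_lookup[OF that, of ?o] by (simp add: koszul_gens_0)
  have eps: "eps_map T K f = lookup (lookup f ?o) 0" if "f \<in> ?c 0 j" for f j
  proof -
    have "keys f \<subseteq> {?o}" using chains_keys[OF that] by (simp add: koszul_gens_0)
    then have "eps_map T K f = (\<Sum>x\<in>{?o}. augmentation T (lookup f x))"
      unfolding eps_map_def by (intro sum.mono_neutral_cong_left) (auto simp: in_keys_iff residue_mod_def)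
    then show ?thesis using augmentation_int_gr_sym[OF finite_B gr0[OF that, unfolded T]] by (simp add: T)
  qed
  show "is_free_resolution T K"
    unfolding is_free_resolution_def
  proof (intro conjI allI impI ballI)
    fix i :: int assume "i < 0" then show "gens K i = {}" by (auto simp: gens_koszul)
  next
    fix i x assume "x \<in> gens K i"
    then show "dif K i x \<in> ?c (i - 1) (gdeg K i x)" using koszul_free by (simp add: free_differential_def)
  next
    fix x assume "x \<in> gens K 0"
    show "eps K x \<in> hcomp (residue_mod T) (gdeg K 0 x)" by (simp add: residue_mod_def)
  next
    fix j show "eps_map T K ` ?c 0 j = hcomp (residue_mod T) j"
    proof (intro equalityI subsetI)
      fix c assume "c \<in> eps_map T K ` ?c 0 j"
      then obtain f where f: "f \<in> ?c 0 j" "c = lookup (lookup f ?o) 0" using eps by auto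
      have "c = 0" if "j \<noteq> 0"
      proof (rule ccontr)
        assume "c \<noteq> 0"
        then have "0 \<in> keys (lookup f ?o)" using f(2) by (simp add: in_keys_iff)
        then have "int (monomial_degree (0 :: 'v \<Rightarrow>\<^sub>0 nat)) = j" using gr0[OF f(1)] unfolding int_gr_iff by blast
        then show False using that by (simp add: monomial_degree_def)
      qed
      then show "c \<in> hcomp (residue_mod T) j" by (simp add: residue_mod_def)
    next
      fix c assume c: "c \<in> hcomp (residue_mod T) j"
      let ?f = "if j = 0 then single ?o (scl T c 1) else 0"
      have f: "?f \<in> ?c 0 j"
      proof (cases "j = 0")
        case True
        then show ?thesis by (auto intro!: chainsI simp: koszul_gens_0 split: if_splits)
      qed simp
      have e: "eps_map T K ?f = c"
        using eps[OF f] c by (auto simp: T sym_alg_def residue_mod_def)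
      show "c \<in> eps_map T K ` ?c 0 j" by (rule image_eqI[where x = ?f]) (rule e[symmetric], rule f)
    qed
  next
    fix j show "{f \<in> ?c 0 j. eps_map T K f = 0} = ?d 1 ` ?c 1 j"
    proof (intro equalityI subsetI)
      fix f assume "f \<in> {f \<in> ?c 0 j. eps_map T K f = 0}"
      then have f: "f \<in> ?c 0 j" "eps_map T K f = 0" by auto
      have "?d (0 + 1) (homotopy f) = f" by (rule homotopy[OF f(1)]) (use eps[OF f(1)] f(2) in auto)
      then show "f \<in> ?d 1 ` ?c 1 j" using homotopy_chains[OF f(1)] by force
    next
      fix f assume "f \<in> ?d 1 ` ?c 1 j"
      then obtain g where g: "g \<in> ?c (0 + 1) j" "f = ?d (0 + 1) g" by auto
      have f: "f \<in> ?c 0 j" using reg.bd_chains_Suc[OF koszul_free g(1)] g(2) by simp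
      have "lookup (lookup f ?o) 0 = 0" unfolding g(2) lookup_bd_coeff[OF finite.emptyI g(1)] by simp
      then show "f \<in> {f \<in> ?c 0 j. eps_map T K f = 0}" using f eps by auto
    qed
  next
    fix i j :: int assume i: "0 < i"
    show "{f \<in> ?c i j. ?d i f = 0} = ?d (i + 1) ` ?c (i + 1) j"
    proof (intro equalityI subsetI)
      fix f assume "f \<in> {f \<in> ?c i j. ?d i f = 0}"
      then have f: "f \<in> ?c i j" "?d i f = 0" by auto
      have "?d (i + 1) (homotopy f) = f" by (rule homotopy[OF f(1)]) (use f(2) i in auto)
      then show "f \<in> ?d (i + 1) ` ?c (i + 1) j" using homotopy_chains[OF f(1)] by force
    next
      fix f assume "f \<in> ?d (i + 1) ` ?c (i + 1) j"
      then show "f \<in> {f \<in> ?c i j. ?d i f = 0}"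
        using reg.bd_chains_Suc[OF koszul_free] bd_bd_koszul by auto
    qed
  qed
qed

end

section \<open>Standard graded algebras as quotients of polynomial rings\<close>

definition monomial_value :: "('a::comm_ring_1 \<Rightarrow>\<^sub>0 nat) \<Rightarrow> 'a" where
  "monomial_value m = (\<Prod>v\<in>keys m. v ^ lookup m v)"

lemma monomial_value_superset:
  "finite T \<Longrightarrow> keys m \<subseteq> T \<Longrightarrow> monomial_value m = (\<Prod>v\<in>T. v ^ lookup m v)"
  unfolding monomial_value_def by (rule prod.mono_neutral_left) (auto simp: in_keys_iff)

lemma monomial_value_add: "monomial_value (m + m') = monomial_value m * monomial_value m'"
proof -
  have "keys (m + m') \<subseteq> keys m \<union> keys m'" by (rule Poly_Mapping.keys_add)
  then show ?thesis
    by (simp add: monomial_value_superset[of "keys m \<union> keys m'"] lookup_add power_add prod.distrib)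
qed

lemma monomial_value_0 [simp]: "monomial_value 0 = 1"
  by (simp add: monomial_value_def)

lemma monomial_value_single [simp]: "monomial_value (single v k) = v ^ k"
  by (simp add: monomial_value_superset[of "{v}"])

context standard_graded_algebra
begin

abbreviation \<pi> :: "(('a \<Rightarrow>\<^sub>0 nat) \<Rightarrow>\<^sub>0 'k) \<Rightarrow> 'a" where "\<pi> \<equiv> canonical_map R"

lemma canonical_map_eq: "\<pi> p = (\<Sum>m\<in>keys p. scl R (lookup p m) (monomial_value m))"
  by (simp add: canonical_map_def monomial_value_def)

lemma canonical_map_superset:
  "finite T \<Longrightarrow> keys p \<subseteq> T \<Longrightarrow> \<pi> p = (\<Sum>m\<in>T. scl R (lookup p m) (monomial_value m))"
  unfolding canonical_map_eq by (rule sum.mono_neutral_left) (auto simp: in_keys_iff)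

lemma canonical_map_add: "\<pi> (p + q) = \<pi> p + \<pi> q"
proof -
  have "keys (p + q) \<subseteq> keys p \<union> keys q" by (rule Poly_Mapping.keys_add)
  then show ?thesis
    by (simp add: canonical_map_superset[of "keys p \<union> keys q"] lookup_add scale_left_distrib sum.distrib)
qed

lemma canonical_map_0 [simp]: "\<pi> 0 = 0"
  by (simp add: canonical_map_def)

lemma canonical_map_uminus: "\<pi> (- p) = - \<pi> p"
  using canonical_map_add[of p "- p"] by (simp add: add_eq_0_iff)

lemma canonical_map_sum: "\<pi> (sum h X) = (\<Sum>x\<in>X. \<pi> (h x))"
  by (induction X rule: infinite_finite_induct) (simp_all add: canonical_map_add)

lemma canonical_map_single: "\<pi> (single m c) = scl R c (monomial_value m)"
  by (simp add: canonical_map_superset[of "{m}"])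

lemma scl_mult_scl: "scl R c x * scl R d y = scl R (c * d) (x * y)"
  by (metis mult.commute scale_scale scl_mult)

lemma canonical_map_mult: "\<pi> (p * q) = \<pi> p * \<pi> q"
proof -
  have "p * q = (\<Sum>m\<in>keys p. single m (lookup p m)) * (\<Sum>m'\<in>keys q. single m' (lookup q m'))"
    using poly_mapping_sum_single[of p] poly_mapping_sum_single[of q] by simp
  also have "\<dots> = (\<Sum>m\<in>keys p. \<Sum>m'\<in>keys q. single (m + m') (lookup p m * lookup q m'))"
    by (simp add: sum_product mult_single)
  finally have "\<pi> (p * q) = (\<Sum>m\<in>keys p. \<Sum>m'\<in>keys q.
      scl R (lookup p m) (monomial_value m) * scl R (lookup q m') (monomial_value m'))"
    by (simp add: canonical_map_sum canonical_map_single monomial_value_add scl_mult_scl)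
  then show ?thesis by (simp add: canonical_map_eq sum_product)
qed

lemma canonical_map_scalar: "\<pi> (single 0 c) = scl R c 1"
  by (simp add: canonical_map_single)

lemma canonical_map_1 [simp]: "\<pi> 1 = 1"
  using canonical_map_scalar[of 1] by simp

lemma canonical_map_indeterminate [simp]: "\<pi> (indeterminate v) = v"
  by (simp add: indeterminate_def canonical_map_single)

lemma canonical_map_shuffle_sign [simp]: "\<pi> (shuffle_sign J L) = shuffle_sign J L"
  using canonical_map_uminus[of 1]
  by (cases "even (card {(j, l). j \<in> J \<and> l \<in> L \<and> l < j})") (simp_all add: shuffle_sign_def)

lemma one_gr: "1 \<in> gr R 0"
  unfolding gr_0 by (metis rangeI scale_one)

lemma monomial_value_gr:
  assumes "keys m \<subseteq> gr R 1" shows "monomial_value m \<in> gr R (monomial_degree m)"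
proof -
  have pow: "v ^ k \<in> gr R k" if "v \<in> gr R 1" for v k
    by (induction k) (use one_gr gr_mult[OF that] in auto)
  have "(\<Prod>v\<in>T. v ^ lookup m v) \<in> gr R (\<Sum>v\<in>T. lookup m v)" if "finite T" "T \<subseteq> gr R 1" for T
    using that
  proof (induction T rule: finite_induct)
    case (insert v T)
    then show ?case using gr_mult[OF pow[of v "lookup m v"], of "\<Prod>v\<in>T. v ^ lookup m v" "\<Sum>v\<in>T. lookup m v"] by simp
  qed (simp add: one_gr)
  then show ?thesis using assms by (simp add: monomial_value_def monomial_degree_def)
qed

lemma homogeneous_decomposition_unique:
  assumes "\<And>i. lookup f i \<in> gr R i" "\<And>i. lookup g i \<in> gr R i"
    and "(\<Sum>i\<in>keys f. lookup f i) = (\<Sum>i\<in>keys g. lookup g i)"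
  shows "f = (g :: nat \<Rightarrow>\<^sub>0 'a)"
  using gr_direct_sum[of "\<Sum>i\<in>keys f. lookup f i"] assms by blast

definition irrelevant :: "'a set" where
  "irrelevant = span (\<Union>i\<in>{0<..}. gr R i)"

lemma irrelevant_decomposition:
  assumes "y \<in> irrelevant"
  shows "\<exists>f. lookup f 0 = 0 \<and> (\<forall>i. lookup f i \<in> gr R i) \<and> y = (\<Sum>i\<in>keys f. lookup f i)"
  using assms unfolding irrelevant_def
proof (induction rule: span_induct_alt)
  case base
  show ?case using subspace_0[OF gr_subspace] by (intro exI[of _ 0]) simp
next
  case (step c x y)
  obtain i where i: "0 < i" "x \<in> gr R i" using step by auto
  obtain f where f: "lookup f 0 = 0" "\<And>i. lookup f i \<in> gr R i" "y = (\<Sum>i\<in>keys f. lookup f i)"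
    using step by blast
  let ?g = "single i (scl R c x) + f"
  have "scl R c x \<in> gr R i" using subspace_scale[OF gr_subspace i(2)] .
  then have g: "\<forall>j. lookup ?g j \<in> gr R j"
    using f(2) subspace_add[OF gr_subspace, of "scl R c x"] by (auto simp: lookup_add lookup_single when_def)
  have "keys ?g \<subseteq> insert i (keys f)"
    using Poly_Mapping.keys_add[of "single i (scl R c x)" f] by (auto split: if_splits)
  then have "(\<Sum>j\<in>keys ?g. lookup ?g j) = (\<Sum>j\<in>insert i (keys f). lookup ?g j)"
    by (intro sum.mono_neutral_left) (auto simp: in_keys_iff)
  also have "\<dots> = scl R c x + (\<Sum>j\<in>insert i (keys f). lookup f j)"
    by (simp add: lookup_add sum.distrib lookup_single when_def)
  also have "(\<Sum>j\<in>insert i (keys f). lookup f j) = y"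
    unfolding f(3) by (intro sum.mono_neutral_right) (auto simp: in_keys_iff)
  finally have "scl R c x + y = (\<Sum>j\<in>keys ?g. lookup ?g j)" by simp
  then show ?case using i f(1) g by (intro exI[of _ ?g]) (auto simp: lookup_add lookup_single when_def)
qed

lemma irrelevant_scalar:
  assumes "scl R c 1 \<in> irrelevant" shows "c = 0"
proof -
  obtain f where f: "lookup f 0 = 0" "\<And>i. lookup f i \<in> gr R i" "scl R c 1 = (\<Sum>i\<in>keys f. lookup f i)"
    using irrelevant_decomposition[OF assms] by blast
  have "f = single 0 (scl R c 1)"
    by (rule homogeneous_decomposition_unique)
      (use f(2) subspace_0[OF gr_subspace] rangeI[of "\<lambda>c. scl R c 1" c] in
        \<open>simp_all add: lookup_single when_def gr_0 flip: f(3)\<close>)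
  then have "scl R c 1 = 0" using f(1) by simp
  then show "c = 0" by simp
qed

lemma augmentation_eqI:
  assumes "x - scl R c 1 \<in> irrelevant" shows "augmentation R x = c"
  unfolding augmentation_def
proof (rule the_equality)
  show "x - scl R c 1 \<in> span (\<Union>i\<in>{0<..}. gr R i)" using assms by (simp add: irrelevant_def)
  fix d assume "x - scl R d 1 \<in> span (\<Union>i\<in>{0<..}. gr R i)"
  then have "(x - scl R d 1) - (x - scl R c 1) \<in> irrelevant"
    using assms span_diff unfolding irrelevant_def by blast
  then have "c - d = 0" by (intro irrelevant_scalar) (simp add: scale_left_diff_distrib)
  then show "d = c" by simp
qed

lemma irrelevant_gr: "0 < i \<Longrightarrow> x \<in> gr R i \<Longrightarrow> x \<in> irrelevant"
  unfolding irrelevant_def by (intro span_base) auto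

lemma augmentation_irrelevant: "x - scl R (augmentation R x) 1 \<in> irrelevant"
proof -
  obtain f where f: "\<And>i. lookup f i \<in> gr R i" "x = (\<Sum>i\<in>keys f. lookup f i)"
    using gr_direct_sum[of x] by blast
  obtain c where c: "lookup f 0 = scl R c 1" using f(1)[of 0] by (auto simp: gr_0)
  have "x = (\<Sum>i\<in>insert 0 (keys f). lookup f i)"
    unfolding f(2) by (rule sum.mono_neutral_left) (auto simp: in_keys_iff)
  also have "\<dots> = scl R c 1 + (\<Sum>i\<in>keys f - {0}. lookup f i)"
    by (subst sum.insert_remove) (simp_all add: c)
  finally have x: "x - scl R c 1 = (\<Sum>i\<in>keys f - {0}. lookup f i)" by simp
  have "x - scl R c 1 \<in> irrelevant"
    unfolding x irrelevant_def by (intro span_sum span_base) (use f(1) in auto)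
  then show ?thesis using augmentation_eqI by blast
qed

lemma irrelevant_mult:
  assumes "z \<in> irrelevant" shows "z * y \<in> irrelevant"
proof -
  obtain g where g: "\<And>i. lookup g i \<in> gr R i" "y = (\<Sum>i\<in>keys g. lookup g i)"
    using gr_direct_sum[of y] by blast
  show ?thesis using assms unfolding irrelevant_def
  proof (induction rule: span_induct_alt)
    case (step c x z)
    then obtain i where "0 < i" "x \<in> gr R i" by auto
    then have "x * lookup g j \<in> irrelevant" for j
      using gr_mult[OF _ g(1)[of j], of x i] by (intro irrelevant_gr[of "i + j"]) auto
    then have "x * y \<in> irrelevant" unfolding g(2) sum_distrib_left irrelevant_def by (intro span_sum)
    then show ?case using step span_add span_scale
      by (simp add: distrib_right irrelevant_def flip: scl_mult)
  qed (simp add: span_zero)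
qed

lemma augmentation_add: "augmentation R (x + y) = augmentation R x + augmentation R y"
proof (rule augmentation_eqI)
  have "x + y - scl R (augmentation R x + augmentation R y) 1 =
      (x - scl R (augmentation R x) 1) + (y - scl R (augmentation R y) 1)"
    by (simp add: scale_left_distrib)
  then show "x + y - scl R (augmentation R x + augmentation R y) 1 \<in> irrelevant"
    using augmentation_irrelevant[of x] augmentation_irrelevant[of y] span_add unfolding irrelevant_def by metis
qed

lemma augmentation_mult: "augmentation R (x * y) = augmentation R x * augmentation R y"
proof (rule augmentation_eqI)
  let ?c = "augmentation R x" and ?d = "augmentation R y"
  have "scl R (?c * ?d) 1 = scl R ?c 1 * scl R ?d 1" using scl_mult_scl[of ?c 1 ?d 1] by simp
  then have "x * y - scl R (?c * ?d) 1 = (x - scl R ?c 1) * y + (y - scl R ?d 1) * scl R ?c 1"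
    by (simp add: algebra_simps)
  then show "x * y - scl R (?c * ?d) 1 \<in> irrelevant"
    using irrelevant_mult[OF augmentation_irrelevant[of x], of y]
      irrelevant_mult[OF augmentation_irrelevant[of y], of "scl R ?c 1"] span_add
    unfolding irrelevant_def by metis
qed

lemma augmentation_1: "augmentation R 1 = 1"
  by (rule augmentation_eqI) (simp add: irrelevant_def span_zero)

lemma residue_module: "graded_module R (residue_mod R)"
proof unfold_locales
  fix x i m j assume x: "x \<in> gr R i" and m: "m \<in> hcomp (residue_mod R) j"
  have "augmentation R x = 0" if "0 < i" using augmentation_eqI[of x 0] irrelevant_gr[OF that x] by simp
  then show "act (residue_mod R) x m \<in> hcomp (residue_mod R) (int i + j)"
    using m by (auto simp: residue_mod_def split: if_splits)
qed (auto simp: residue_mod_def augmentation_add augmentation_mult augmentation_1 algebra_simps split: if_splits)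

context
  fixes B assumes B: "is_basis (scl R) (gr R 1) B"
begin

lemma basis_gr: "B \<subseteq> gr R 1" and basis_independent: "independent B" and basis_span: "span B = gr R 1"
  using B by (auto simp: is_basis_def)

lemma basis_finite: "finite B"
proof -
  obtain X where "finite X" "span X = gr R 1" using gr_1_finite_rank by blast
  then show ?thesis using independent_span_bound[of X B] basis_gr basis_independent by simp
qed

lemma canonical_map_gr:
  assumes "p \<in> gr (sym_alg B) i" shows "\<pi> p \<in> gr R i"
  unfolding canonical_map_eq
proof (rule subspace_sum[OF gr_subspace])
  fix m assume "m \<in> keys p"
  then have "keys m \<subseteq> B" "monomial_degree m = i" using assms gr_sym[OF basis_finite] by blast+
  then have "monomial_value m \<in> gr R i" using monomial_value_gr[of m] basis_gr by auto
  then show "scl R (lookup p m) (monomial_value m) \<in> gr R i" by (rule subspace_scale[OF gr_subspace])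
qed

text \<open>The image of the polynomials in the variables B is a subalgebra that contains the component of degree 1.\<close>

lemma canonical_map_surj: "\<exists>p. (\<forall>m\<in>keys p. keys m \<subseteq> B) \<and> \<pi> p = x"
proof -
  let ?P = "{p :: ('a \<Rightarrow>\<^sub>0 nat) \<Rightarrow>\<^sub>0 'k. \<forall>m\<in>keys p. keys m \<subseteq> B}"
  have add: "p + q \<in> ?P" if "p \<in> ?P" "q \<in> ?P" for p q
    using that Poly_Mapping.keys_add[of p q] by blast
  have mult: "p * q \<in> ?P" if "p \<in> ?P" "q \<in> ?P" for p q
  proof -
    have "keys m \<subseteq> B" if m: "m \<in> keys (p * q)" for m
    proof -
      obtain r s where "m = r + s" "r \<in> keys p" "s \<in> keys q" using Poly_Mapping.keys_mult[of p q] m by blast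
      then show ?thesis using \<open>p \<in> ?P\<close> \<open>q \<in> ?P\<close> by (simp add: keys_add_nat)
    qed
    then show ?thesis by blast
  qed
  have scalar: "single 0 c \<in> ?P" for c by simp
  have sub: "subspace (\<pi> ` ?P)"
  proof (rule subspaceI)
    show "0 \<in> \<pi> ` ?P" by (rule image_eqI[of _ _ 0]) auto
    fix x y assume "x \<in> \<pi> ` ?P" "y \<in> \<pi> ` ?P"
    then obtain p q where "p \<in> ?P" "q \<in> ?P" "x = \<pi> p" "y = \<pi> q" by blast
    then show "x + y \<in> \<pi> ` ?P" using imageI[OF add[of p q], of \<pi>] by (simp only: canonical_map_add)
  next
    fix c x assume "x \<in> \<pi> ` ?P"
    then obtain p where p: "p \<in> ?P" "x = \<pi> p" by blast
    have "\<pi> (single 0 c * p) = scl R c x"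
      using scl_mult[of c 1 x] by (simp add: canonical_map_mult canonical_map_scalar p)
    then show "scl R c x \<in> \<pi> ` ?P" using imageI[OF mult[OF scalar p(1), of c], of \<pi>] by simp
  qed
  have "subalgebra R (\<pi> ` ?P)"
    unfolding subalgebra_def
  proof (intro conjI ballI)
    show "module.subspace (scl R) (\<pi> ` ?P)" by (rule sub)
    show "1 \<in> \<pi> ` ?P" by (rule image_eqI[of _ _ 1]) auto
    fix x y assume "x \<in> \<pi> ` ?P" "y \<in> \<pi> ` ?P"
    then obtain p q where "p \<in> ?P" "q \<in> ?P" "x = \<pi> p" "y = \<pi> q" by blast
    then show "x * y \<in> \<pi> ` ?P" using imageI[OF mult[of p q], of \<pi>] by (simp only: canonical_map_mult)
  qed
  moreover have BP: "B \<subseteq> \<pi> ` ?P"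
  proof
    fix v assume "v \<in> B"
    then show "v \<in> \<pi> ` ?P" by (intro image_eqI[of _ _ "indeterminate v"]) (auto simp: indeterminate_def canonical_map_single)
  qed
  then have "gr R 1 \<subseteq> \<pi> ` ?P" using span_minimal[OF BP sub] basis_span by simp
  ultimately have "subalgebra R hull gr R 1 \<subseteq> \<pi> ` ?P" by (rule hull_minimal[rotated])
  then have "x \<in> \<pi> ` ?P" using gr_1_generates by blast
  then show ?thesis by auto
qed

text \<open>In a preimage p of x only the part of degree i contributes, because homogeneous decompositions in R are
  unique.\<close>

lemma canonical_map_gr_surj:
  assumes x: "x \<in> gr R i" shows "\<exists>p \<in> gr (sym_alg B) i. \<pi> p = x"
proof -
  obtain p where p: "\<And>m. m \<in> keys p \<Longrightarrow> keys m \<subseteq> B" "\<pi> p = x" using canonical_map_surj by blast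
  define part where "part = (\<lambda>j. \<Sum>m\<in>{m \<in> keys p. monomial_degree m = j}. single m (lookup p m))"
  define D where "D = monomial_degree ` keys p"
  have part: "part j \<in> gr (sym_alg B) j" for j
  proof -
    have "keys (part j) \<subseteq> {m \<in> keys p. monomial_degree m = j}"
      unfolding part_def
      using Poly_Mapping.keys_sum[of "\<lambda>m. single m (lookup p m)"] by fastforce
    then show ?thesis using p(1) by (auto simp: gr_sym[OF basis_finite])
  qed
  define h where "h = (\<lambda>j. if j \<in> D then \<pi> (part j) else 0)"
  have "finite {j. h j \<noteq> 0}"  proof (rule finite_subset[of _ D])
    show "{j. h j \<noteq> 0} \<subseteq> D" unfolding h_def by auto
    show "finite D" by (simp add: D_def)
  qed
  then have h: "lookup (Abs_poly_mapping h) = h" by simp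
  have "p = (\<Sum>j\<in>D. part j)"
    unfolding D_def part_def
    by (subst sum.group) (auto intro: poly_mapping_sum_single)
  then have "x = (\<Sum>j\<in>D. \<pi> (part j))" using p(2) canonical_map_sum by metis
  also have "\<dots> = (\<Sum>j\<in>keys (Abs_poly_mapping h). lookup (Abs_poly_mapping h) j)"
  proof (rule sum.mono_neutral_cong_right)
    show "keys (Abs_poly_mapping h) \<subseteq> D" unfolding in_keys_iff subset_iff h by (simp add: h_def)
    show "\<forall>j\<in>D - keys (Abs_poly_mapping h). \<pi> (part j) = 0" unfolding in_keys_iff Diff_iff Ball_def h by (simp add: h_def)
    show "\<pi> (part j) = lookup (Abs_poly_mapping h) j" if "j \<in> keys (Abs_poly_mapping h)" for j
      using that unfolding in_keys_iff h by (simp add: h_def split: if_splits)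
  qed (simp add: D_def)
  finally have sum: "x = (\<Sum>j\<in>keys (Abs_poly_mapping h). lookup (Abs_poly_mapping h) j)" .
  have hgr: "h j \<in> gr R j" for j
    using part canonical_map_gr subspace_0[OF gr_subspace] by (auto simp: h_def)
  have "Abs_poly_mapping h = single i x"
    by (rule homogeneous_decomposition_unique)
      (use x hgr subspace_0[OF gr_subspace] sum in \<open>auto simp: h lookup_single when_def\<close>)
  then have "h i = x" using h by (metis lookup_single_eq)
  then show ?thesis
  proof (cases "i \<in> D")
    case True
    then show ?thesis using \<open>h i = x\<close> part[of i] by (auto simp: h_def)
  next
    case False
    then have "x = 0" using \<open>h i = x\<close> by (simp add: h_def)
    then show ?thesis by (intro bexI[of _ 0]) (auto simp: gr_sym[OF basis_finite])
  qed
qed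

lemma connected_algebra: "graded_connected_algebra R"
proof unfold_locales
    show "augmentation R (scl R c 1) = c" for c
      by (rule augmentation_eqI) (simp add: irrelevant_def span_zero)
    show "augmentation R x = 0" if "0 < i" "x \<in> gr R i" for x i
      by (rule augmentation_eqI) (use irrelevant_gr[OF that] in simp)
    show "\<exists>C. countable C \<and> gr R i \<subseteq> span C" for i
    proof (intro exI conjI subsetI)
      show "countable (monomial_value ` {m. keys m \<subseteq> B})"
        by (intro countable_image countable_monomials[OF basis_finite])
      fix x assume "x \<in> gr R i"
      then obtain p where p: "p \<in> gr (sym_alg B) i" "x = \<pi> p" using canonical_map_gr_surj by blast
      show "x \<in> span (monomial_value ` {m. keys m \<subseteq> B})"
        unfolding p(2) canonical_map_eq
        by (intro span_sum span_scale span_base) (use p(1) in \<open>auto simp: gr_sym[OF basis_finite]\<close>)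
    qed
qed (rule scl_mult gr_subspace gr_0 gr_mult; assumption?)+

text \<open>Each monomial of positive degree is a multiple of a variable.\<close>

lemma gr_Suc_generated:
  assumes "x \<in> gr R (Suc i)"
  shows "\<exists>h. (\<forall>v\<in>B. h v \<in> gr R i) \<and> x = (\<Sum>v\<in>B. v * h v)"
proof -
  have sub: "\<exists>h. (\<forall>v\<in>B. h v \<in> gr R i) \<and> (\<Sum>m\<in>M. scl R (c m) (monomial_value m)) = (\<Sum>v\<in>B. v * h v)"
    if "finite M" "\<And>m. m \<in> M \<Longrightarrow> keys m \<subseteq> B \<and> monomial_degree m = Suc i" for M c
    using that
  proof (induction M rule: finite_induct)
    case empty
    show ?case using subspace_0[OF gr_subspace] by (intro exI[of _ "\<lambda>_. 0"]) simp
  next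
    case (insert m M)
    obtain h where h: "\<forall>v\<in>B. h v \<in> gr R i" "(\<Sum>m\<in>M. scl R (c m) (monomial_value m)) = (\<Sum>v\<in>B. v * h v)"
      using insert by auto
    have m: "keys m \<subseteq> B" "monomial_degree m = Suc i" using insert.prems by auto
    then have "m \<noteq> 0" by (auto simp: monomial_degree_def)
    then obtain w where w: "w \<in> keys m" by (metis ex_in_conv keys_eq_empty)
    have split: "m = single w 1 + (m - single w 1)"
      using w by (intro poly_mapping_eqI) (auto simp: lookup_add lookup_minus lookup_single when_def in_keys_iff)
    have deg: "monomial_degree (m - single w 1) = i"
      using m(2) monomial_degree_add[of "single w 1" "m - single w 1"] split by simp
    have "keys (m - single w 1) \<subseteq> B" using m(1) split keys_add_nat by (metis Un_subset_iff)
    then have q: "monomial_value (m - single w 1) \<in> gr R i"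
      using monomial_value_gr[of "m - single w 1"] basis_gr deg by auto
    let ?q = "scl R (c m) (monomial_value (m - single w 1))"
    have q: "?q \<in> gr R i" using subspace_scale[OF gr_subspace q] .
    have "monomial_value m = w * monomial_value (m - single w 1)"
      using split monomial_value_add[of "single w 1" "m - single w 1"] by simp
    then have mw: "scl R (c m) (monomial_value m) = w * ?q" by (metis mult.commute scl_mult)
    let ?h = "\<lambda>v. (if v = w then ?q else 0) + h v"
    have "\<forall>v\<in>B. ?h v \<in> gr R i" using h(1) q subspace_add[OF gr_subspace] by auto
    moreover have "(\<Sum>v\<in>B. v * ?h v) = w * ?q + (\<Sum>v\<in>B. v * h v)"
      using w m(1) basis_finite by (simp add: distrib_left sum.distrib if_distrib[of "\<lambda>x. _ * x"] subset_iff cong: if_cong)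
    ultimately show ?case using insert.hyps h(2) mw by (intro exI[of _ ?h]) simp
  qed
  obtain p where p: "p \<in> gr (sym_alg B) (Suc i)" "x = \<pi> p" using canonical_map_gr_surj[OF assms] by blast
  show ?thesis unfolding p(2) canonical_map_eq
    by (rule sub) (use p(1) in \<open>auto simp: gr_sym[OF basis_finite]\<close>)
qed

end

end

section \<open>Quotients annihilated by the irrelevant ideal\<close>

lemma (in graded_connected_algebra) decompose_subspace:
  assumes C: "free.subspace V" "free.subspace W" "V \<subseteq> W"
  obtains D E where "free.independent (D \<union> E)" "free.span D = V" "free.span (D \<union> E) = W" "D \<inter> E = {}"
proof -
  obtain D where D: "D \<subseteq> V" "free.independent D" "V \<subseteq> free.span D"
    using free.maximal_independent_subset[of V] by blast
  have "D \<subseteq> W" using D(1) C(3) by blast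
  then obtain D' where D': "D \<subseteq> D'" "D' \<subseteq> W" "free.independent D'" "W \<subseteq> free.span D'"
    using free.maximal_independent_subset_extend[of D W] D(2) by metis
  show thesis
  proof (rule that[of D "D' - D"])
    have "D \<union> (D' - D) = D'" using D'(1) by blast
    then show "free.independent (D \<union> (D' - D))" "free.span (D \<union> (D' - D)) = W"
      using D' free.span_minimal[OF D'(2) C(2)] by auto
    show "free.span D = V" using D free.span_minimal[OF D(1) C(1)] by auto
  qed auto
qed

lemma act_residue [simp]: "act (residue_mod A) x c = augmentation A x * c"
  and hcomp_residue: "hcomp (residue_mod A) j = (if j = 0 then UNIV else {0})"
  by (simp_all add: residue_mod_def)

text \<open>If the irrelevant ideal takes Z into V, then Z/V is a sum of shifted copies of the residue
  field: a basis of a complement of V in Z gives coordinates on the quotient.\<close>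

lemma (in graded_connected_algebra) residue_quotient:
  assumes res: "graded_module A (residue_mod A)"
    and Z: "graded_submodule A X e Z" and V: "graded_submodule A X e V" and VZ: "\<And>j. V j \<subseteq> Z j"
    and ann: "\<And>x i j q. x \<in> gr A i \<Longrightarrow> 0 < i \<Longrightarrow> q \<in> Z j \<Longrightarrow> smul x q \<in> V (int i + j)"
  shows "\<exists>(Y :: (int \<times> (nat \<Rightarrow>\<^sub>0 'a)) set) d \<phi>.
    graded_hom A (submodule_mod Z) (copower Y d (residue_mod A)) \<phi> \<and>
    (\<forall>j. hcomp (copower Y d (residue_mod A)) j \<subseteq> \<phi> j ` Z j) \<and>
    graded_hom.kernel (submodule_mod Z) \<phi> = submodule_mod V \<and>
    (\<forall>y\<in>Y. \<not> Z (d y) \<subseteq> V (d y))"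
proof -
  interpret Z: graded_submodule A X e Z by fact
  interpret V: graded_submodule A X e V by fact
  interpret res: graded_module A "residue_mod A" by fact
  have "\<exists>D E. free.independent (D \<union> E) \<and> free.span D = V j \<and> free.span (D \<union> E) = Z j \<and> D \<inter> E = {}" for j
    using decompose_subspace[OF V.sub_subspace Z.sub_subspace VZ] by metis
  then obtain D E where DE: "\<And>j. free.independent (D j \<union> E j)" "\<And>j. free.span (D j) = V j"
      "\<And>j. free.span (D j \<union> E j) = Z j" "\<And>j. D j \<inter> E j = {}" by metis
  define rep where "rep j = free.representation (D j \<union> E j)" for j
  define Y where "Y = Sigma (UNIV :: int set) E"
  define \<phi> where "\<phi> j q = Abs_poly_mapping (\<lambda>y. if y \<in> Y \<and> fst y = j then rep j q (snd y) else 0)" for j q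
  let ?Q = "copower Y fst (residue_mod A)"
  interpret Q: graded_module A ?Q by (rule res.copower_module)
  have lookup_\<phi>: "lookup (\<phi> j q) y = (if y \<in> Y \<and> fst y = j then rep j q (snd y) else 0)" for j q y
  proof -
    have "finite (Pair j ` {b. rep j q b \<noteq> 0})" unfolding rep_def by (intro finite_imageI free.finite_representation)
    then have "finite {y. (if y \<in> Y \<and> fst y = j then rep j q (snd y) else 0) \<noteq> 0}"
      by (rule rev_finite_subset) (auto split: if_splits)
    then show ?thesis by (simp add: \<phi>_def)
  qed
  have \<phi>V: "\<phi> j q = 0" if "q \<in> V j" for j q
  proof (rule poly_mapping_eqI)
    fix y
    have q: "q \<in> free.span (D j)" using that DE(2) by simp
    have "rep j q (snd y) = 0" if "y \<in> Y" "fst y = j"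
    proof (rule ccontr)
      assume "rep j q (snd y) \<noteq> 0"
      then have "free.representation (D j) q (snd y) \<noteq> 0"
        unfolding rep_def using free.representation_extend[OF DE(1) q] by simp
      then have "snd y \<in> D j" by (rule free.representation_ne_zero)
      then show False using that DE(4)[of j] by (auto simp: Y_def)
    qed
    then show "lookup (\<phi> j q) y = lookup 0 y" by (simp add: lookup_\<phi>)
  qed
  have inZ: "q \<in> free.span (D j \<union> E j)" if "q \<in> Z j" for q j using that DE(3) by simp
  have \<phi>_scale: "lookup (\<phi> j (scale_free c q)) y = c * lookup (\<phi> j q) y" if "q \<in> Z j" for j c q y
    using free.representation_scale[OF DE(1) inZ[OF that], of c] by (simp add: lookup_\<phi> rep_def)
  have mod: "graded_module A (submodule_mod Z)" by (rule Z.submodule_module)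
  have hom: "graded_hom A (submodule_mod Z) ?Q \<phi>"
  proof (intro graded_hom.intro graded_hom_axioms.intro mod Q.graded_module_axioms)
    fix q j assume q: "q \<in> hcomp (submodule_mod Z) j"
    show "\<phi> j q \<in> hcomp ?Q j"
    proof (rule hcomp_copowerI)
      show "keys (\<phi> j q) \<subseteq> Y" by (auto simp: in_keys_iff lookup_\<phi> split: if_splits)
      show "lookup (\<phi> j q) y \<in> hcomp (residue_mod A) (j - fst y)" for y
        by (auto simp: lookup_\<phi> hcomp_residue)
    qed
  next
    fix q q' j assume "q \<in> hcomp (submodule_mod Z) j" "q' \<in> hcomp (submodule_mod Z) j"
    then have "rep j (q + q') = (\<lambda>b. rep j q b + rep j q' b)"
      unfolding rep_def using free.representation_add[OF DE(1)] inZ by simp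
    then show "\<phi> j (q + q') = \<phi> j q + \<phi> j q'"
      by (intro poly_mapping_eqI) (simp add: lookup_\<phi> lookup_add)
  next
    fix x i q j assume x: "x \<in> gr A i" and q: "q \<in> hcomp (submodule_mod Z) j"
    show "\<phi> (int i + j) (act (submodule_mod Z) x q) = act ?Q x (\<phi> j q)"
    proof (cases "i = 0")
      case True
      then obtain c where c: "x = scl A c 1" using x by (auto simp: gr_0)
      then have "smul x q = scale_free c q" by (simp add: scale_free_def)
      then show ?thesis using \<phi>_scale[of q j c] q True c
        by (intro poly_mapping_eqI) (simp add: augmentation_scl)
    next
      case False
      then have "\<phi> (int i + j) (smul x q) = 0" using ann[OF x _ , of q j] q \<phi>V by simp
      moreover have "augmentation A x = 0" using augmentation_pos x False by simp
      ultimately show ?thesis by (intro poly_mapping_eqI) simp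
    qed
  qed
  interpret h: graded_hom A "submodule_mod Z" ?Q \<phi> by (rule hom)
  show ?thesis
  proof (intro exI[of _ Y] exI[of _ fst] exI[of _ \<phi>] conjI allI ballI hom)
    fix j show "hcomp ?Q j \<subseteq> \<phi> j ` Z j"
    proof
      fix r assume r: "r \<in> hcomp ?Q j"
      have y: "y \<in> Y \<and> fst y = j \<and> snd y \<in> E j \<and> snd y \<in> Z j" if "y \<in> keys r" for y
      proof -
        have yY: "y \<in> Y" using hcomp_copower_keys[OF r] that by blast
        from hcomp_copower_lookup[OF r yY] that have "fst y = j"
          by (auto simp: hcomp_residue in_keys_iff split: if_splits)
        moreover have yE: "snd y \<in> E j" using yY \<open>fst y = j\<close> by (auto simp: Y_def)
        then have "snd y \<in> free.span (D j \<union> E j)" by (intro free.span_base) simp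
        ultimately show ?thesis using yY yE by (simp add: DE(3))
      qed
      let ?q = "\<Sum>y\<in>keys r. scale_free (lookup r y) (snd y)"
      have sc: "scale_free (lookup r y) (snd y) \<in> Z j" if "y \<in> keys r" for y
        using y[OF that] free.subspace_scale[OF Z.sub_subspace] by blast
      have "\<phi> j ?q = r"
      proof (rule poly_mapping_eqI)
        fix w
        have "lookup (\<phi> j ?q) w = (\<Sum>y\<in>keys r. lookup (\<phi> j (scale_free (lookup r y) (snd y))) w)"
          using h.hom_sum[of "keys r" "\<lambda>y. scale_free (lookup r y) (snd y)" j] sc by (simp add: lookup_sum)
        also have "\<dots> = (\<Sum>y\<in>keys r. if w = y then lookup r y else 0)"
        proof (rule sum.cong[OF refl])
          fix y assume yr: "y \<in> keys r"
          have "rep j (snd y) = (\<lambda>v. if v = snd y then 1 else 0)"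
            unfolding rep_def by (rule free.representation_basis[OF DE(1)]) (use y[OF yr] in blast)
          then show "lookup (\<phi> j (scale_free (lookup r y) (snd y))) w = (if w = y then lookup r y else 0)"
            using \<phi>_scale[of "snd y" j "lookup r y" w] y[OF yr] by (cases w, cases y) (auto simp: lookup_\<phi>)
        qed
        also have "\<dots> = lookup r w" by (simp add: in_keys_iff)
        finally show "lookup (\<phi> j ?q) w = lookup r w" .
      qed
      moreover have "?q \<in> Z j" using free.subspace_sum[OF Z.sub_subspace sc] .
      ultimately show "r \<in> \<phi> j ` Z j" by (intro image_eqI[of r "\<phi> j" ?q]) simp_all
    qed
  next
    have "{q \<in> Z j. \<phi> j q = 0} = V j" for j
    proof (intro equalityI subsetI)
      fix q assume q: "q \<in> {q \<in> Z j. \<phi> j q = 0}"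
      have "b \<in> D j" if "rep j q b \<noteq> 0" for b
      proof (rule ccontr)
        assume "b \<notin> D j"
        then have "b \<in> E j" using that free.representation_ne_zero[of "D j \<union> E j" q b] unfolding rep_def by blast
        then have "lookup (\<phi> j q) (j, b) = rep j q b" by (simp add: lookup_\<phi> Y_def)
        then show False using q that by simp
      qed
      then have "(\<Sum>b | rep j q b \<noteq> 0. scale_free (rep j q b) b) \<in> free.span (D j)"
        by (intro free.span_sum free.span_scale free.span_base) auto
      moreover have "(\<Sum>b | rep j q b \<noteq> 0. scale_free (rep j q b) b) = q"
        unfolding rep_def by (rule free.sum_nonzero_representation_eq[OF DE(1)]) (use q inZ in blast)
      ultimately show "q \<in> V j" using DE(2) by simp
    next
      fix q assume "q \<in> V j"
      then show "q \<in> {q \<in> Z j. \<phi> j q = 0}" using \<phi>V VZ by blast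
    qed
    then show "h.kernel = submodule_mod V" unfolding h.kernel_def by (simp add: submodule_mod_def)
  next
    fix y assume "y \<in> Y"
    then have y: "snd y \<in> E (fst y)" by (auto simp: Y_def)
    have "snd y \<in> Z (fst y)" using y DE(3) free.span_base[of "snd y" "D (fst y) \<union> E (fst y)"] by auto
    moreover have "snd y \<notin> V (fst y)"
    proof
      assume "snd y \<in> V (fst y)"
      then have "snd y \<in> free.span (D (fst y))" using DE(2) by simp
      moreover have "D (fst y) \<subseteq> (D (fst y) \<union> E (fst y)) - {snd y}" using y DE(4) by blast
      ultimately have "snd y \<in> free.span ((D (fst y) \<union> E (fst y)) - {snd y})"
        using free.span_mono by blast
      then show False using DE(1)[of "fst y"] y unfolding free.dependent_def by blast
    qed
    ultimately show "\<not> Z (fst y) \<subseteq> V (fst y)" by blast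
  qed
qed

section \<open>The Koszul complex over a standard graded algebra\<close>

text \<open>The module over the polynomial ring obtained from a module over R along the canonical map.\<close>

definition restriction ::
  "('k::field, 'a::comm_ring_1) graded_alg \<Rightarrow> ('a, 'm) graded_mod \<Rightarrow> (('a \<Rightarrow>\<^sub>0 nat) \<Rightarrow>\<^sub>0 'k, 'm) graded_mod" where
  "restriction R N = \<lparr>hcomp = hcomp N, act = (\<lambda>p. act N (canonical_map R p))\<rparr>"

lemma restriction_simps [simp]:
  "hcomp (restriction R N) = hcomp N" "act (restriction R N) p = act N (canonical_map R p)"
  by (simp_all add: restriction_def)

lemma sym_mod_eq: "sym_mod R = restriction R (regular_mod R)"
  by (simp add: sym_mod_def restriction_def regular_mod_def)

locale koszul_algebra = graded_connected_algebra R
  for R :: "('k::field, 'a::comm_ring_1) graded_alg" +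
  fixes B :: "'a set" and b :: "nat \<Rightarrow> 'a" and n :: nat
    and S :: "('k, ('a \<Rightarrow>\<^sub>0 nat) \<Rightarrow>\<^sub>0 'k) graded_alg"
  assumes std: "standard_graded_algebra R" and basis: "is_basis (scl R) (gr R 1) B"
    and bij: "bij_betw b {..<n} B" and S: "S = sym_alg B"
begin

sublocale P: koszul_polynomial B b n S
  by unfold_locales (rule bij, rule S)

abbreviation K :: "('k, ('a \<Rightarrow>\<^sub>0 nat) \<Rightarrow>\<^sub>0 'k) free_complex" where "K \<equiv> koszul b n"

lemmas canonical_map_ring_hom = standard_graded_algebra.canonical_map_add[OF std]
  standard_graded_algebra.canonical_map_mult[OF std] standard_graded_algebra.canonical_map_1[OF std]
  standard_graded_algebra.canonical_map_indeterminate[OF std]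
  standard_graded_algebra.canonical_map_shuffle_sign[OF std]

lemma b_gr: "u < n \<Longrightarrow> b u \<in> gr R 1"
  using standard_graded_algebra.basis_gr[OF std basis] P.b_in by blast

lemma shuffle_sign_gr: "shuffle_sign J L \<in> int_gr R 0"
  using int_gr_uminus[OF one_int_gr] by (cases "even (card {(j, l). j \<in> J \<and> l \<in> L \<and> l < j})")
    (simp_all add: shuffle_sign_def)

lemma restriction_module:
  assumes "graded_module R N" shows "graded_module S (restriction R N)"
proof -
  interpret graded_module R N by fact
  show ?thesis
    by unfold_locales
      (auto simp: hcomp_add hcomp_uminus act_add add_act mult_act canonical_map_ring_hom S
        intro: act_hcomp standard_graded_algebra.canonical_map_gr[OF std basis])
qed

lemma restriction_hom:
  assumes "graded_hom R G N \<phi>" shows "graded_hom S (restriction R G) (restriction R N) \<phi>"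
proof -
  interpret graded_hom R G N \<phi> by fact
  show ?thesis
    by (intro graded_hom.intro graded_hom_axioms.intro restriction_module dom.graded_module_axioms
        cod.graded_module_axioms)
      (auto simp: hom_hcomp hom_add S intro: hom_act standard_graded_algebra.canonical_map_gr[OF std basis])
qed

lemma restriction_kernel:
  "graded_hom.kernel (restriction R G) \<phi> = restriction R (graded_hom.kernel G \<phi>)"
  if "graded_hom R G N \<phi>"
proof -
  interpret graded_hom R G N \<phi> by fact
  interpret r: graded_hom S "restriction R G" "restriction R N" \<phi> by (rule restriction_hom[OF that])
  show ?thesis unfolding r.kernel_def kernel_def by (simp add: restriction_def)
qed

lemma lookup_bd_restriction:
  assumes N: "graded_module R N" and J: "finite J" and f: "f \<in> chains K (restriction R N) i j"
  shows "lookup (bd K (restriction R N) i' f) (set_encode J) =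
    (\<Sum>u\<in>{..<n} - J. act N (shuffle_sign {u} J * b u) (lookup f (set_encode (insert u J))))"
  using lookup_bd_koszul[OF restriction_module[OF N] J chains_koszul_keys[OF f]]
  by (simp add: canonical_map_ring_hom)

abbreviation koszul_chains :: "int \<Rightarrow> int \<Rightarrow> (nat \<Rightarrow>\<^sub>0 'a) set" where
  "koszul_chains p j \<equiv> chains K (sym_mod R) p j"

abbreviation koszul_bd :: "int \<Rightarrow> (nat \<Rightarrow>\<^sub>0 'a) \<Rightarrow> (nat \<Rightarrow>\<^sub>0 'a)" where
  "koszul_bd p \<equiv> bd K (sym_mod R) p"

definition cycles :: "int \<Rightarrow> int \<Rightarrow> (nat \<Rightarrow>\<^sub>0 'a) set" where
  "cycles p j = {f \<in> koszul_chains p j. koszul_bd p f = 0}"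

definition boundaries :: "int \<Rightarrow> int \<Rightarrow> (nat \<Rightarrow>\<^sub>0 'a) set" where
  "boundaries p j = koszul_bd (p + 1) ` koszul_chains (p + 1) j"

text \<open>The terms of the Koszul complex over R, as R-modules.\<close>

definition free_term :: "int \<Rightarrow> ('a, nat \<Rightarrow>\<^sub>0 'a) graded_mod" where
  "free_term p = copower (gens K p) (\<lambda>_. p) (regular_mod R)"

lemma hcomp_free_term [simp]: "hcomp (free_term p) j = koszul_chains p j"
  and act_free_term [simp]: "act (free_term p) = smul"
  by (simp_all add: free_term_def sym_mod_eq chains_def) (simp add: copower_def)

lemma sym_module: "graded_module S (sym_mod R)"
  unfolding sym_mod_eq by (rule restriction_module[OF regular_module])

sublocale M: graded_module S "sym_mod R"
  by (rule sym_module)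

lemma sym_mod_simps [simp]: "hcomp (sym_mod R) = int_gr R" "act (sym_mod R) p x = canonical_map R p * x"
  by (simp_all add: sym_mod_eq)

lemma free_term_module: "graded_module R (free_term p)"
  unfolding free_term_def by (rule free_module)

lemma lookup_koszul_bd:
  assumes "finite J" "f \<in> koszul_chains p j"
  shows "lookup (koszul_bd p' f) (set_encode J) =
     (\<Sum>u\<in>{..<n} - J. shuffle_sign {u} J * b u * lookup f (set_encode (insert u J)))"
  using lookup_bd_restriction[OF regular_module assms(1), of f p j] assms(2) by (simp add: sym_mod_eq)

lemma koszul_bd_smul: "koszul_bd p (smul a f) = smul a (koszul_bd p f)"
proof (rule poly_mapping_eqI)
  fix y
  have "keys (smul a f) \<subseteq> keys f" unfolding smul_def by (rule keys_mapp)
  then show "lookup (koszul_bd p (smul a f)) y = lookup (smul a (koszul_bd p f)) y"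
    by (simp add: M.lookup_bd_superset[of "keys f"] M.lookup_bd[of _ _ f] sum_distrib_left mult.left_commute)
qed

lemmas koszul_bd_chains = M.bd_chains[OF P.koszul_free]

lemmas koszul_bd_chains_Suc = M.bd_chains_Suc[OF P.koszul_free]

lemma koszul_bd_bd: "f \<in> koszul_chains (p + 1) j \<Longrightarrow> koszul_bd p (koszul_bd (p + 1) f) = 0"
  using M.bd_bd[OF resolution.complex[OF P.koszul_resolution]] chains_keys by blast

lemma koszul_bd_hom: "graded_hom R (free_term p) (free_term (p - 1)) (\<lambda>_. koszul_bd p)"
  by (intro graded_hom.intro graded_hom_axioms.intro free_term_module)
    (auto simp: koszul_bd_smul M.bd_add intro: koszul_bd_chains)

lemma cycles_submodule: "graded_submodule R (gens K p) (\<lambda>_. p) (cycles p)"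
  and kernel_koszul_bd: "graded_hom.kernel (free_term p) (\<lambda>_. koszul_bd p) = submodule_mod (cycles p)"
proof -
  have "cycles p = (\<lambda>j. {m \<in> hcomp (free_term p) j. koszul_bd p m = 0})"
    by (intro ext) (simp add: cycles_def)
  then show "graded_submodule R (gens K p) (\<lambda>_. p) (cycles p)"
     "graded_hom.kernel (free_term p) (\<lambda>_. koszul_bd p) = submodule_mod (cycles p)"
    using kernel_submodule[OF koszul_bd_hom[of p, unfolded free_term_def]] unfolding free_term_def by auto
qed

lemma boundaries_cycles: "boundaries p j \<subseteq> cycles p j"
  using koszul_bd_bd koszul_bd_chains_Suc by (auto simp: boundaries_def cycles_def)

lemma boundaries_submodule: "graded_submodule R (gens K p) (\<lambda>_. p) (boundaries p)"
proof -
  interpret F: graded_module R "free_term (p + 1)" by (rule free_term_module)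
  interpret Z: graded_submodule R "gens K p" "\<lambda>_. p" "cycles p" by (rule cycles_submodule)
  show ?thesis
  proof unfold_locales
    fix j show "boundaries p j \<subseteq> hcomp (copower (gens K p) (\<lambda>_. p) (regular_mod R)) j"
      using boundaries_cycles Z.sub_free by blast
    show "0 \<in> boundaries p j" unfolding boundaries_def by (rule image_eqI[of _ _ 0]) auto
  next
    fix q q' j assume "q \<in> boundaries p j" "q' \<in> boundaries p j"
    then show "q + q' \<in> boundaries p j"
      unfolding boundaries_def by (auto simp flip: M.bd_add intro: imageI M.chains_add)
  next
    fix q j assume "q \<in> boundaries p j"
    then show "- q \<in> boundaries p j"
      unfolding boundaries_def by (auto simp flip: M.bd_uminus intro: imageI M.chains_uminus)
  next
    fix x i q j assume "x \<in> gr R i" "q \<in> boundaries p j"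
    then show "smul x q \<in> boundaries p (int i + j)"
      unfolding boundaries_def using F.act_hcomp by (auto simp flip: koszul_bd_smul)
  qed
qed

lemma koszul_bd_onto_hom: "graded_hom R (free_term (p + 1)) (submodule_mod (boundaries p)) (\<lambda>_. koszul_bd (p + 1))"
proof -
  interpret V: graded_submodule R "gens K p" "\<lambda>_. p" "boundaries p" by (rule boundaries_submodule)
  show ?thesis
    by (intro graded_hom.intro graded_hom_axioms.intro free_term_module V.submodule_module)
      (auto simp: koszul_bd_smul M.bd_add boundaries_def)
qed

lemma kernel_koszul_bd_onto:
  "graded_hom.kernel (free_term (p + 1)) (\<lambda>_. koszul_bd (p + 1)) = submodule_mod (cycles (p + 1))"
  using kernel_koszul_bd[of "p + 1"] .

subsection \<open>The exterior product and the contractions\<close>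

definition wedge :: "(nat \<Rightarrow>\<^sub>0 'a) \<Rightarrow> (nat \<Rightarrow>\<^sub>0 'a) \<Rightarrow> (nat \<Rightarrow>\<^sub>0 'a)" where
  "wedge y z = (\<Sum>I\<in>Pow {..<n}. single (set_encode I)
     (\<Sum>J\<in>Pow I. shuffle_sign J (I - J) * lookup y (set_encode J) * lookup z (set_encode (I - J))))"

lemma lookup_wedge:
  "I \<subseteq> {..<n} \<Longrightarrow> lookup (wedge y z) (set_encode I) =
     (\<Sum>J\<in>Pow I. shuffle_sign J (I - J) * lookup y (set_encode J) * lookup z (set_encode (I - J)))"
  unfolding wedge_def by (rule lookup_sum_faces)

lemma chain_face:
  assumes "f \<in> koszul_chains p j" "finite J"
  shows "lookup f (set_encode J) \<in> int_gr R (j - p)"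
    and "lookup f (set_encode J) \<noteq> 0 \<Longrightarrow> J \<subseteq> {..<n} \<and> int (card J) = p"
proof -
  show "lookup f (set_encode J) \<noteq> 0 \<Longrightarrow> J \<subseteq> {..<n} \<and> int (card J) = p"
    using chains_outside[OF assms(1), of "set_encode J"] assms(2) by (auto simp: set_encode_gens)
  show "lookup f (set_encode J) \<in> int_gr R (j - p)"
    using chains_lookup[OF assms(1), of "set_encode J"] chains_outside[OF assms(1), of "set_encode J"]
    by (cases "set_encode J \<in> gens K p") auto
qed

lemma koszul_chainsI:
  assumes "keys f \<subseteq> set_encode ` {I. I \<subseteq> {..<n} \<and> int (card I) = p}"
    and "\<And>I. I \<subseteq> {..<n} \<Longrightarrow> finite I \<Longrightarrow> int (card I) = p \<Longrightarrow> lookup f (set_encode I) \<in> int_gr R (j - p)"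
  shows "f \<in> koszul_chains p j"
  by (rule chainsI) (use assms in \<open>auto simp: gens_koszul subset_lessThan_finite\<close>)

lemma int_gr_sum: "(\<And>x. x \<in> X \<Longrightarrow> h x \<in> int_gr R i) \<Longrightarrow> sum h X \<in> int_gr R i"
  using augmentation_sum_int_gr[of X h i] by blast

lemma wedge_chains:
  assumes y: "y \<in> koszul_chains p j" and z: "z \<in> koszul_chains q l"
  shows "wedge y z \<in> koszul_chains (p + q) (j + l)"
proof (rule koszul_chainsI)
  let ?h = "\<lambda>I. \<Sum>J\<in>Pow I. shuffle_sign J (I - J) * lookup y (set_encode J) * lookup z (set_encode (I - J))"
  have "int (card I) = p + q" if I: "I \<subseteq> {..<n}" "?h I \<noteq> 0" for I
  proof -
    have fI: "finite I" using I subset_lessThan_finite by blast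
    obtain J where J: "J \<in> Pow I" "shuffle_sign J (I - J) * lookup y (set_encode J) * lookup z (set_encode (I - J)) \<noteq> 0"
      using I(2) by (meson sum.neutral)
    have fJ: "finite J" using J(1) fI finite_subset by blast
    have "lookup y (set_encode J) \<noteq> 0" "lookup z (set_encode (I - J)) \<noteq> 0" using J(2) by auto
    then have "int (card J) = p" "int (card (I - J)) = q"
      using chain_face(2)[OF y fJ] chain_face(2)[OF z, of "I - J"] fI by auto
    moreover have "card I = card J + card (I - J)"
      using J(1) fI fJ card_Un_disjoint[of J "I - J"] by (simp add: Un_absorb1)
    ultimately show ?thesis by simp
  qed
  then show "keys (wedge y z) \<subseteq> set_encode ` {I. I \<subseteq> {..<n} \<and> int (card I) = p + q}"
    using keys_sum_faces[of ?h] unfolding wedge_def by blast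
  fix I assume I: "I \<subseteq> {..<n}" "finite I"
  show "lookup (wedge y z) (set_encode I) \<in> int_gr R (j + l - (p + q))"
    unfolding lookup_wedge[OF I(1)]
  proof (rule int_gr_sum)
    fix J assume "J \<in> Pow I"
    then have "finite J" "finite (I - J)" using I finite_subset by blast+
    then have "shuffle_sign J (I - J) * lookup y (set_encode J) * lookup z (set_encode (I - J)) \<in> int_gr R (0 + (j - p) + (l - q))"
      by (intro int_gr_mult shuffle_sign_gr chain_face(1)[OF y] chain_face(1)[OF z])
    then show "shuffle_sign J (I - J) * lookup y (set_encode J) * lookup z (set_encode (I - J)) \<in> int_gr R (j + l - (p + q))"
      by (simp add: algebra_simps)
  qed
qed

end

lemma sum_Pow_insert:
  assumes "finite I" "u \<notin> I"
  shows "(\<Sum>J\<in>Pow (insert u I). g J) = (\<Sum>J\<in>Pow I. g J) + (\<Sum>J\<in>Pow I. (g (insert u J) :: 'b::comm_monoid_add))"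
proof -
  have "inj_on (insert u) (Pow I)" using assms(2) by (auto simp: inj_on_def)
  moreover have "Pow I \<inter> insert u ` Pow I = {}" using assms(2) by auto
  ultimately show ?thesis using assms(1) by (simp add: Pow_insert sum.union_disjoint sum.reindex)
qed

lemma sum_Pow_pairs:
  assumes "finite I"
  shows "(\<Sum>J\<in>Pow I. \<Sum>u\<in>J. d J u) = (\<Sum>J\<in>Pow I. \<Sum>u\<in>I - J. (d (insert u J) u :: 'b::comm_monoid_add))"
proof -
  have fin: "finite (Pow I)" "\<And>J. J \<in> Pow I \<Longrightarrow> finite J" "\<And>J. finite (I - J)"
    using assms finite_subset by auto
  have "(\<Sum>J\<in>Pow I. \<Sum>u\<in>J. d J u) = (\<Sum>(J, u)\<in>(SIGMA J:Pow I. J). d J u)"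
    using fin by (intro sum.Sigma) auto
  also have "\<dots> = (\<Sum>(J, u)\<in>(SIGMA J:Pow I. I - J). d (insert u J) u)"
    by (rule sum.reindex_bij_witness[of _ "\<lambda>(J, u). (insert u J, u)" "\<lambda>(J, u). (J - {u}, u)"])
      (auto simp: insert_absorb)
  also have "\<dots> = (\<Sum>J\<in>Pow I. \<Sum>u\<in>I - J. d (insert u J) u)"
    using fin by (intro sum.Sigma[symmetric]) auto
  finally show ?thesis .
qed

declare set_encode_insert [simp del]

lemma smul_0 [simp]: "smul a 0 = 0"
  by (rule poly_mapping_eqI) simp

context koszul_algebra
begin

lemma koszul_eqI:
  assumes "f \<in> koszul_chains p j" "g \<in> koszul_chains p j'"
    and "\<And>I. I \<subseteq> {..<n} \<Longrightarrow> finite I \<Longrightarrow> lookup f (set_encode I) = lookup g (set_encode I)"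
  shows "f = g"
proof (rule poly_mapping_eqI)
  fix c show "lookup f c = lookup g c"
  proof (cases "c \<in> gens K p")
    case True
    then show ?thesis using assms(3) by (auto elim!: gens_cases)
  next
    case False
    then show ?thesis using chains_outside[OF assms(1) False] chains_outside[OF assms(2) False] by simp
  qed
qed

lemma single_chain:
  assumes "J \<subseteq> {..<n}" "x \<in> int_gr R i"
  shows "single (set_encode J) x \<in> koszul_chains (int (card J)) (i + int (card J))"
proof (rule koszul_chainsI)
  show "keys (single (set_encode J) x) \<subseteq> set_encode ` {I. I \<subseteq> {..<n} \<and> int (card I) = int (card J)}"
    using assms(1) by (simp only: keys_single) auto
qed (use assms(2) in \<open>auto simp: lookup_single when_def\<close>)

lemma smul_neg_one_power: "smul ((- 1) ^ k) f = (if even k then f else - f)"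
  by (rule poly_mapping_eqI) simp

text \<open>The Koszul differential is a skew derivation. At the exterior monomial on I, the terms on the right
  that come from removing an index outside I from one factor are the terms on the left; those in which
  the index removed from one factor still occurs in the other cancel in pairs.\<close>

lemma koszul_bd_wedge:
  assumes y: "y \<in> koszul_chains p j" and z: "z \<in> koszul_chains q l"
  shows "koszul_bd (p + q) (wedge y z) =
     wedge (koszul_bd p y) z + smul ((- 1) ^ nat p) (wedge y (koszul_bd q z))"
proof (rule koszul_eqI)
  have yz: "wedge y z \<in> koszul_chains (p + q) (j + l)" by (rule wedge_chains[OF y z])
  show "koszul_bd (p + q) (wedge y z) \<in> koszul_chains (p + q - 1) (j + l)" by (rule koszul_bd_chains[OF yz])
  have idx: "p - 1 + q = p + q - 1" "p + (q - 1) = p + q - 1" by simp_all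
  have "wedge (koszul_bd p y) z \<in> koszul_chains (p + q - 1) (j + l)"
    "wedge y (koszul_bd q z) \<in> koszul_chains (p + q - 1) (j + l)"
    using wedge_chains[OF koszul_bd_chains[OF y] z] wedge_chains[OF y koszul_bd_chains[OF z]]
    by (simp_all only: idx)
  then show "wedge (koszul_bd p y) z + smul ((- 1) ^ nat p) (wedge y (koszul_bd q z)) \<in> koszul_chains (p + q - 1) (j + l)"
    by (auto simp: smul_neg_one_power intro: M.chains_add M.chains_diff)
  fix I assume I: "I \<subseteq> {..<n}" "finite I"
  define N where "N = {..<n}"
  define Y where "Y J = lookup y (set_encode J)" for J
  define Z where "Z J = lookup z (set_encode J)" for J
  let ?s = "shuffle_sign :: nat set \<Rightarrow> nat set \<Rightarrow> 'a"
  let ?e = "(- 1) ^ nat p :: 'a"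
  have cY: "nat p = card J" if "Y J \<noteq> 0" "finite J" for J
    using chain_face(2)[OF y that(2)] that(1) by (auto simp: Y_def)
  have fin: "finite J" "finite (I - J)" if "J \<in> Pow I" for J using that I finite_subset by auto
  define c where "c J u = ?s J (I - J) * (?s {u} J * b u * Y (insert u J)) * Z (I - J)" for J u
  define d where "d J u = ?s J (I - J) * Y J * (?s {u} (I - J) * b u * Z (insert u (I - J)))" for J u
  have "lookup (koszul_bd (p + q) (wedge y z)) (set_encode I) =
      (\<Sum>u\<in>N - I. ?s {u} I * b u * (\<Sum>J\<in>Pow (insert u I). ?s J (insert u I - J) * Y J * Z (insert u I - J)))"
    unfolding lookup_koszul_bd[OF I(2) yz] N_def
    by (rule sum.cong[OF refl], subst lookup_wedge) (use I in \<open>auto simp: Y_def Z_def\<close>)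
  also have "\<dots> = (\<Sum>u\<in>N - I. (\<Sum>J\<in>Pow I. c J u) + ?e * (\<Sum>J\<in>Pow I. d J u))"
  proof (rule sum.cong[OF refl])
    fix u assume u: "u \<in> N - I"
    have "?s {u} I * b u * (?s J (insert u I - J) * Y J * Z (insert u I - J)) = ?e * d J u" if J: "J \<in> Pow I" for J
    proof (cases "Y J = 0")
      case False
      have uJ: "insert u I - J = insert u (I - J)" "u \<notin> J" "u \<notin> I - J" using u J by auto
      have "?s {u} I = ?s {u} (J \<union> (I - J))" using J by (simp add: Un_absorb1)
      also have "\<dots> = ?s {u} J * ?s {u} (I - J)" using fin[OF J] by (intro shuffle_sign_Un_right) auto
      also have "?s {u} J = ?e * ?s J {u}"
        using shuffle_sign_swap[of J u, where ?'r = 'a] fin[OF J] uJ cY[OF False] by simp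
      finally have 1: "?s {u} I = ?e * ?s J {u} * ?s {u} (I - J)" .
      have 2: "?s J (insert u (I - J)) = ?s J {u} * ?s J (I - J)"
        using fin[OF J] uJ by (intro shuffle_sign_insert_right) auto
      have "?s {u} I * b u * (?s J (insert u I - J) * Y J * Z (insert u I - J)) = (?s J {u} * ?s J {u}) * (?e * d J u)"
        unfolding uJ 1 2 d_def by (simp add: ac_simps)
      then show ?thesis by (simp add: shuffle_sign_square)
    qed (simp add: d_def)
    moreover have "?s {u} I * b u * (?s (insert u J) (insert u I - insert u J) * Y (insert u J) * Z (insert u I - insert u J)) = c J u"
      if J: "J \<in> Pow I" for J
    proof -
      have uJ: "insert u I - insert u J = I - J" "u \<notin> J" "u \<notin> I - J" using u J by auto
      have "?s {u} I = ?s {u} (J \<union> (I - J))" using J by (simp add: Un_absorb1)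
      also have "\<dots> = ?s {u} J * ?s {u} (I - J)" using fin[OF J] by (intro shuffle_sign_Un_right) auto
      finally have 1: "?s {u} I = ?s {u} J * ?s {u} (I - J)" .
      have 2: "?s (insert u J) (I - J) = ?s {u} (I - J) * ?s J (I - J)"
        using fin[OF J] uJ by (intro shuffle_sign_insert_left) auto
      have "?s {u} I * b u * (?s (insert u J) (insert u I - insert u J) * Y (insert u J) * Z (insert u I - insert u J)) =
         (?s {u} (I - J) * ?s {u} (I - J)) * c J u"
        unfolding uJ 1 2 c_def by (simp add: ac_simps)
      then show ?thesis by (simp add: shuffle_sign_square)
    qed
    ultimately show "?s {u} I * b u * (\<Sum>J\<in>Pow (insert u I). ?s J (insert u I - J) * Y J * Z (insert u I - J)) =
        (\<Sum>J\<in>Pow I. c J u) + ?e * (\<Sum>J\<in>Pow I. d J u)"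
      using u I(2) by (simp add: sum_Pow_insert sum_distrib_left distrib_left)
  qed
  also have "\<dots> = (\<Sum>J\<in>Pow I. \<Sum>u\<in>N - I. c J u) + ?e * (\<Sum>J\<in>Pow I. \<Sum>u\<in>N - I. d J u)"
    unfolding sum.distrib sum_distrib_left[symmetric]
    by (subst (1 2) sum.swap[of _ "Pow I"]) (rule refl)
  also have "\<dots> = (\<Sum>J\<in>Pow I. \<Sum>u\<in>N - J. c J u) + ?e * (\<Sum>J\<in>Pow I. \<Sum>u\<in>N - (I - J). d J u)"
  proof -
    have split: "(\<Sum>u\<in>N - J. c J u) = (\<Sum>u\<in>N - I. c J u) + (\<Sum>u\<in>I - J. c J u)"
      "(\<Sum>u\<in>N - (I - J). d J u) = (\<Sum>u\<in>N - I. d J u) + (\<Sum>u\<in>J. d J u)" if J: "J \<in> Pow I" for J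
    proof -
      have "N - J = (N - I) \<union> (I - J)" "N - (I - J) = (N - I) \<union> J" using J I by (auto simp: N_def)
      then show "(\<Sum>u\<in>N - J. c J u) = (\<Sum>u\<in>N - I. c J u) + (\<Sum>u\<in>I - J. c J u)"
        "(\<Sum>u\<in>N - (I - J). d J u) = (\<Sum>u\<in>N - I. d J u) + (\<Sum>u\<in>J. d J u)"
        using fin[OF J] J by (auto simp: N_def intro!: sum.union_disjoint)
    qed
    have "c J u + ?e * d (insert u J) u = 0" if J: "J \<in> Pow I" and u: "u \<in> I - J" for J u
    proof (cases "Y (insert u J) = 0")
      case False
      let ?L = "I - insert u J"
      have fL: "finite ?L" "u \<notin> ?L" and IJ: "I - J = insert u ?L" and uJ: "u \<notin> J" using I u by auto
      have e: "?e = - ((- 1) ^ card J)" using cY[OF False] fin[OF J] uJ by simp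
      have 1: "?s J (I - J) = ?s J {u} * ?s J ?L" unfolding IJ using fin[OF J] fL by (intro shuffle_sign_insert_right)
      have 2: "?s (insert u J) ?L = ?s {u} ?L * ?s J ?L" using fin[OF J] fL uJ by (intro shuffle_sign_insert_left)
      have 3: "?s {u} J = (- 1) ^ card J * ?s J {u}" using fin[OF J] uJ by (intro shuffle_sign_swap)
      have "c J u = (?s J {u} * ?s J {u}) * ((- 1) ^ card J * ?s J ?L * b u * Y (insert u J) * Z (I - J))"
        unfolding c_def 1 3 by (simp add: ac_simps)
      moreover have "d (insert u J) u = (?s {u} ?L * ?s {u} ?L) * (?s J ?L * b u * Y (insert u J) * Z (I - J))"
        unfolding d_def 2 IJ[symmetric] by (simp add: ac_simps)
      ultimately show ?thesis by (simp add: shuffle_sign_square e mult.assoc)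
    qed (simp add: c_def d_def)
    then have "(\<Sum>J\<in>Pow I. \<Sum>u\<in>I - J. c J u) + ?e * (\<Sum>J\<in>Pow I. \<Sum>u\<in>J. d J u) = 0"
      unfolding sum_Pow_pairs[OF I(2)] by (simp add: sum_distrib_left flip: sum.distrib)
    moreover have "(\<Sum>J\<in>Pow I. \<Sum>u\<in>N - J. c J u) = (\<Sum>J\<in>Pow I. \<Sum>u\<in>N - I. c J u) + (\<Sum>J\<in>Pow I. \<Sum>u\<in>I - J. c J u)"
      "(\<Sum>J\<in>Pow I. \<Sum>u\<in>N - (I - J). d J u) = (\<Sum>J\<in>Pow I. \<Sum>u\<in>N - I. d J u) + (\<Sum>J\<in>Pow I. \<Sum>u\<in>J. d J u)"
      by (simp_all add: split sum.distrib)
    ultimately show ?thesis by (simp add: distrib_left algebra_simps)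
  qed
  also have "(\<Sum>J\<in>Pow I. \<Sum>u\<in>N - J. c J u) = lookup (wedge (koszul_bd p y) z) (set_encode I)"
    unfolding lookup_wedge[OF I(1)]
    by (rule sum.cong[OF refl])
      (use fin in \<open>simp add: lookup_koszul_bd[OF _ y] c_def Y_def Z_def N_def sum_distrib_left sum_distrib_right\<close>)
  also have "(\<Sum>J\<in>Pow I. \<Sum>u\<in>N - (I - J). d J u) = lookup (wedge y (koszul_bd q z)) (set_encode I)"
    unfolding lookup_wedge[OF I(1)]
    by (rule sum.cong[OF refl])
      (use fin in \<open>simp add: lookup_koszul_bd[OF _ z] d_def Y_def Z_def N_def sum_distrib_left\<close>)
  finally show "lookup (koszul_bd (p + q) (wedge y z)) (set_encode I) =
      lookup (wedge (koszul_bd p y) z + smul ((- 1) ^ nat p) (wedge y (koszul_bd q z))) (set_encode I)"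
    by (simp add: lookup_add)
qed

lemma wedge_0 [simp]: "wedge 0 z = 0" "wedge y 0 = 0"
  by (simp_all add: wedge_def)

lemma wedge_boundary_left:
  assumes y: "y \<in> boundaries p j" and z: "z \<in> cycles q l"
  shows "wedge y z \<in> boundaries (p + q) (j + l)"
proof -
  obtain y' where y': "y' \<in> koszul_chains (p + 1) j" "y = koszul_bd (p + 1) y'" using y by (auto simp: boundaries_def)
  have z': "z \<in> koszul_chains q l" "koszul_bd q z = 0" using z by (auto simp: cycles_def)
  have "koszul_bd (p + 1 + q) (wedge y' z) = wedge y z"
    unfolding koszul_bd_wedge[OF y'(1) z'(1)] z'(2) y'(2) by (simp add: smul_neg_one_power)
  moreover have "p + 1 + q = p + q + 1" by simp
  ultimately show ?thesis using wedge_chains[OF y'(1) z'(1)] unfolding boundaries_def by (metis imageI)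
qed

lemma wedge_boundary_right:
  assumes y: "y \<in> cycles p j" and z: "z \<in> boundaries q l"
  shows "wedge y z \<in> boundaries (p + q) (j + l)"
proof -
  interpret V: graded_submodule R "gens K (p + q)" "\<lambda>_. p + q" "boundaries (p + q)" by (rule boundaries_submodule)
  obtain z' where z': "z' \<in> koszul_chains (q + 1) l" "z = koszul_bd (q + 1) z'" using z by (auto simp: boundaries_def)
  have y': "y \<in> koszul_chains p j" "koszul_bd p y = 0" using y by (auto simp: cycles_def)
  have "koszul_bd (p + (q + 1)) (wedge y z') = smul ((- 1) ^ nat p) (wedge y z)"
    unfolding koszul_bd_wedge[OF y'(1) z'(1)] y'(2) z'(2) by simp
  moreover have "p + (q + 1) = p + q + 1" by simp
  ultimately have "smul ((- 1) ^ nat p) (wedge y z) \<in> boundaries (p + q) (j + l)"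
    using wedge_chains[OF y'(1) z'(1)] unfolding boundaries_def by (metis imageI)
  then show ?thesis using V.sub_uminus by (fastforce simp: smul_neg_one_power split: if_splits)
qed

lemma wedge_scalar:
  assumes z: "z \<in> koszul_chains q l" and x: "x \<in> int_gr R i"
  shows "wedge (single (set_encode {}) x) z = smul x z"
proof (rule koszul_eqI)
  have s: "single (set_encode {}) x \<in> koszul_chains 0 i"
    using single_chain[of "{}", OF _ x] by simp
  show "wedge (single (set_encode {}) x) z \<in> koszul_chains q (i + l)" using wedge_chains[OF s z] by simp
  show "smul x z \<in> koszul_chains q (i + l)"
    using graded_module.act_int_gr[OF free_term_module x, of z q l] z by simp
  fix I assume I: "I \<subseteq> {..<n}" "finite I"
  have "lookup (wedge (single (set_encode {}) x) z) (set_encode I) =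
      (\<Sum>J\<in>Pow I. if J = {} then x * lookup z (set_encode I) else 0)"
    unfolding lookup_wedge[OF I(1)]
  proof (rule sum.cong[OF refl])
    fix J assume "J \<in> Pow I"
    then have "set_encode {} = set_encode J \<longleftrightarrow> J = {}"
      using set_encode_eq_iff[of "{}" J] I finite_subset by auto
    then show "shuffle_sign J (I - J) * lookup (single (set_encode {}) x) (set_encode J) * lookup z (set_encode (I - J)) =
       (if J = {} then x * lookup z (set_encode I) else 0)" by (auto simp: lookup_single when_def)
  qed
  then show "lookup (wedge (single (set_encode {}) x) z) (set_encode I) = lookup (smul x z) (set_encode I)"
    using I by simp
qed

text \<open>Koszul homology is annihilated by the irrelevant ideal: multiplication by the variable \<open>b u\<close> is
  null-homotopic, with left multiplication by the exterior generator \<open>e_u\<close> as the homotopy.\<close>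

lemma variable_annihilates:
  assumes u: "u < n" and z: "z \<in> cycles p j"
  shows "smul (b u) z \<in> boundaries p (1 + j)"
proof -
  let ?e = "single (set_encode {u}) (1 :: 'a)"
  have z': "z \<in> koszul_chains p j" "koszul_bd p z = 0" using z by (auto simp: cycles_def)
  have e: "?e \<in> koszul_chains 1 1"
    using single_chain[of "{u}", OF _ one_int_gr] u by simp
  have bu: "b u \<in> int_gr R 1" using gr_int_gr[OF b_gr[OF u]] by simp
  have "koszul_bd 1 ?e = single (set_encode {}) (b u)"
  proof (rule koszul_eqI)
    show "koszul_bd 1 ?e \<in> koszul_chains 0 1" using koszul_bd_chains[OF e] by simp
    show "single (set_encode {}) (b u) \<in> koszul_chains 0 1"
      using single_chain[of "{}", OF _ bu] by simp
    fix I assume I: "I \<subseteq> {..<n}" "finite I"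
    have "lookup (koszul_bd 1 ?e) (set_encode I) = (\<Sum>w\<in>{..<n} - I. if w = u \<and> I = {} then b u else 0)"
      unfolding lookup_koszul_bd[OF I(2) e]
    proof (rule sum.cong[OF refl])
      fix w assume w: "w \<in> {..<n} - I"
      have "set_encode {u} = set_encode (insert w I) \<longleftrightarrow> w = u \<and> I = {}"
        using set_encode_eq_iff[of "{u}" "insert w I"] I w by auto
      then show "shuffle_sign {w} I * b w * lookup ?e (set_encode (insert w I)) = (if w = u \<and> I = {} then b u else 0)"
        by (auto simp: lookup_single when_def)
    qed
    also have "\<dots> = (if I = {} then b u else 0)" using u by (cases "I = {}") auto
    also have "\<dots> = lookup (single (set_encode {}) (b u)) (set_encode I)"
      using set_encode_eq_iff[of "{}" I] I by (auto simp: lookup_single when_def)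
    finally show "lookup (koszul_bd 1 ?e) (set_encode I) = lookup (single (set_encode {}) (b u)) (set_encode I)" .
  qed
  then have "koszul_bd (1 + p) (wedge ?e z) = smul (b u) z"
    unfolding koszul_bd_wedge[OF e z'(1)] z'(2) using wedge_scalar[OF z'(1) bu] by (simp add: smul_neg_one_power)
  moreover have "1 + p = p + 1" by simp
  ultimately show ?thesis using wedge_chains[OF e z'(1)] unfolding boundaries_def by (metis imageI)
qed

lemma irrelevant_annihilates:
  assumes x: "x \<in> gr R i" and i: "0 < i" and z: "z \<in> cycles p j"
  shows "smul x z \<in> boundaries p (int i + j)"
proof -
  interpret Z: graded_submodule R "gens K p" "\<lambda>_. p" "cycles p" by (rule cycles_submodule)
  interpret V: graded_submodule R "gens K p" "\<lambda>_. p" "boundaries p" by (rule boundaries_submodule)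
  interpret VM: graded_module R "submodule_mod (boundaries p)" by (rule V.submodule_module)
  obtain i' where i': "i = Suc i'" using i gr0_implies_Suc by blast
  obtain h where h: "\<And>v. v \<in> B \<Longrightarrow> h v \<in> gr R i'" "x = (\<Sum>v\<in>B. v * h v)"
    using standard_graded_algebra.gr_Suc_generated[OF std basis] x i' by blast
  have "smul x z = (\<Sum>v\<in>B. smul v (smul (h v) z))"
    by (rule poly_mapping_eqI) (simp add: lookup_sum h(2) sum_distrib_right mult.assoc)
  moreover have "smul v (smul (h v) z) \<in> boundaries p (int i + j)" if "v \<in> B" for v
  proof -
    obtain u where "u < n" "v = b u" using P.b_surj \<open>v \<in> B\<close> by blast
    then show ?thesis
      using variable_annihilates[OF _ Z.sub_smul[OF h(1)[OF \<open>v \<in> B\<close>] z], of u] i' by (simp add: add.assoc)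
  qed
  ultimately show ?thesis using VM.hcomp_sum[of B _ "int i + j"] by simp
qed

text \<open>The coefficient of \<open>e_J\<close> in the comultiplication of the exterior algebra applied to z.\<close>

definition contraction :: "nat set \<Rightarrow> (nat \<Rightarrow>\<^sub>0 'a) \<Rightarrow> (nat \<Rightarrow>\<^sub>0 'a)" where
  "contraction J z = (\<Sum>L\<in>Pow {..<n}. single (set_encode L)
     (if J \<inter> L = {} then shuffle_sign J L * lookup z (set_encode (J \<union> L)) else 0))"

lemma lookup_contraction:
  "L \<subseteq> {..<n} \<Longrightarrow> lookup (contraction J z) (set_encode L) =
     (if J \<inter> L = {} then shuffle_sign J L * lookup z (set_encode (J \<union> L)) else 0)"
  unfolding contraction_def by (rule lookup_sum_faces)

lemma contraction_0 [simp]: "contraction J 0 = 0"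
  unfolding contraction_def by (intro sum.neutral) auto

lemma contraction_chains:
  assumes z: "z \<in> koszul_chains p j" and J: "finite J"
  shows "contraction J z \<in> koszul_chains (p - int (card J)) (j - int (card J))"
proof (rule koszul_chainsI)
  let ?h = "\<lambda>L. if J \<inter> L = {} then shuffle_sign J L * lookup z (set_encode (J \<union> L)) else 0"
  have "int (card L) = p - int (card J)" if L: "L \<subseteq> {..<n}" "?h L \<noteq> 0" for L
  proof -
    have fL: "finite L" using L subset_lessThan_finite by blast
    have "J \<inter> L = {}" "lookup z (set_encode (J \<union> L)) \<noteq> 0" using L(2) by (auto split: if_splits)
    then show ?thesis using chain_face(2)[OF z, of "J \<union> L"] J fL by (auto simp: card_Un_disjoint)
  qed
  then show "keys (contraction J z) \<subseteq> set_encode ` {I. I \<subseteq> {..<n} \<and> int (card I) = p - int (card J)}"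
    using keys_sum_faces[of ?h] unfolding contraction_def by blast
  fix L assume L: "L \<subseteq> {..<n}" "finite L"
  have "shuffle_sign J L * lookup z (set_encode (J \<union> L)) \<in> int_gr R (0 + (j - p))"
    using J L by (intro int_gr_mult shuffle_sign_gr chain_face(1)[OF z]) simp
  then show "lookup (contraction J z) (set_encode L) \<in> int_gr R (j - int (card J) - (p - int (card J)))"
    by (simp add: lookup_contraction[OF L(1)])
qed

text \<open>Contractions commute with the differential up to sign, as the latter is itself a contraction.\<close>

lemma contraction_cycle:
  assumes z: "z \<in> cycles p j" and J: "J \<subseteq> {..<n}"
  shows "contraction J z \<in> cycles (p - int (card J)) (j - int (card J))"
proof -
  have fJ: "finite J" using J subset_lessThan_finite by blast
  have z': "z \<in> koszul_chains p j" "koszul_bd p z = 0" using z by (auto simp: cycles_def)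
  have c: "contraction J z \<in> koszul_chains (p - int (card J)) (j - int (card J))"
    by (rule contraction_chains[OF z'(1) fJ])
  have "koszul_bd (p - int (card J)) (contraction J z) = 0"
  proof (rule koszul_eqI)
    show "koszul_bd (p - int (card J)) (contraction J z) \<in> koszul_chains (p - int (card J) - 1) (j - int (card J))"
      by (rule koszul_bd_chains[OF c])
    show "0 \<in> koszul_chains (p - int (card J) - 1) j" by simp
    fix L assume L: "L \<subseteq> {..<n}" "finite L"
    let ?s = "shuffle_sign :: nat set \<Rightarrow> nat set \<Rightarrow> 'a"
    have bdL: "lookup (koszul_bd (p - int (card J)) (contraction J z)) (set_encode L) =
       (\<Sum>u\<in>{..<n} - L. ?s {u} L * b u * (if J \<inter> insert u L = {} then ?s J (insert u L) * lookup z (set_encode (J \<union> insert u L)) else 0))"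
      unfolding lookup_koszul_bd[OF L(2) c]
      by (rule sum.cong[OF refl], subst lookup_contraction) (use L in auto)
    show "lookup (koszul_bd (p - int (card J)) (contraction J z)) (set_encode L) = lookup 0 (set_encode L)"
    proof (cases "J \<inter> L = {}")
      case False
      then show ?thesis unfolding bdL by (auto intro!: sum.neutral)
    next
      case disj: True
      have "lookup (koszul_bd (p - int (card J)) (contraction J z)) (set_encode L) =
        (\<Sum>u\<in>{..<n} - (J \<union> L). (- 1) ^ card J * ?s J L * (?s {u} (J \<union> L) * b u * lookup z (set_encode (insert u (J \<union> L)))))"
        unfolding bdL
      proof (rule sum.mono_neutral_cong_right)
        fix u assume u: "u \<in> {..<n} - (J \<union> L)"
        have 1: "?s J (insert u L) = ?s J {u} * ?s J L" using u L fJ by (intro shuffle_sign_insert_right) auto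
        have 2: "?s {u} (J \<union> L) = ?s {u} J * ?s {u} L" using disj L fJ by (intro shuffle_sign_Un_right) auto
        have 3: "?s {u} J = (- 1) ^ card J * ?s J {u}" using u fJ by (intro shuffle_sign_swap) auto
        have 4: "(- 1) ^ card J * (- 1) ^ card J = (1 :: 'a)" by (metis minus_one_mult_self)
        have "(- 1) ^ card J * ?s J L * (?s {u} (J \<union> L) * b u * lookup z (set_encode (insert u (J \<union> L)))) =
           ((- 1) ^ card J * (- 1) ^ card J) * (?s {u} L * b u * (?s J {u} * ?s J L * lookup z (set_encode (insert u (J \<union> L)))))"
          unfolding 2 3 by (simp only: ac_simps)
        then show "?s {u} L * b u * (if J \<inter> insert u L = {} then ?s J (insert u L) * lookup z (set_encode (J \<union> insert u L)) else 0) =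
          (- 1) ^ card J * ?s J L * (?s {u} (J \<union> L) * b u * lookup z (set_encode (insert u (J \<union> L))))"
          using u disj unfolding 4 1 by simp
      qed auto
      also have "\<dots> = (- 1) ^ card J * ?s J L * lookup (koszul_bd p z) (set_encode (J \<union> L))"
        using lookup_koszul_bd[OF _ z'(1), of "J \<union> L" p] fJ L(2) by (simp add: sum_distrib_left)
      also have "\<dots> = 0" by (simp add: z'(2))
      finally show ?thesis by simp
    qed
  qed
  then show ?thesis using c by (simp add: cycles_def)
qed

text \<open>The component of the comultiplication in which the first factor has exterior degree a.\<close>

definition comultiplication :: "nat \<Rightarrow> (nat \<Rightarrow>\<^sub>0 'a) \<Rightarrow> (nat \<Rightarrow>\<^sub>0 (nat \<Rightarrow>\<^sub>0 'a))" where
  "comultiplication a z = (\<Sum>J\<in>Pow {..<n}. single (set_encode J) (if card J = a then contraction J z else 0))"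

lemma lookup_comultiplication:
  "J \<subseteq> {..<n} \<Longrightarrow> lookup (comultiplication a z) (set_encode J) = (if card J = a then contraction J z else 0)"
  unfolding comultiplication_def by (rule lookup_sum_faces)

text \<open>Applying the differential to either factor after the comultiplication is the same, up to sign, as applying
  the comultiplication after the differential. Hence a cycle goes to an element that is a cycle with respect to both
  factors, that is, to a cycle with coefficients in the q-cycles.\<close>

lemma comultiplication_cycle:
  assumes z: "z \<in> cycles (int a + q) j"
  defines "C \<equiv> restriction R (submodule_mod (cycles q))"
  shows "comultiplication a z \<in> chains K C (int a) j" "bd K C (int a) (comultiplication a z) = 0"
proof -
  let ?w = "comultiplication a z"
  interpret Z: graded_submodule R "gens K q" "\<lambda>_. q" "cycles q" by (rule cycles_submodule)
  interpret C: graded_module S C unfolding C_def by (rule restriction_module[OF Z.submodule_module])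
  have z': "z \<in> koszul_chains (int a + q) j" "koszul_bd (int a + q) z = 0" using z by (auto simp: cycles_def)
  show w: "?w \<in> chains K C (int a) j"
  proof (rule chainsI)
    show "keys ?w \<subseteq> gens K (int a)"
      using keys_sum_faces[of "\<lambda>J. if card J = a then contraction J z else 0" n]
      unfolding comultiplication_def gens_koszul by (auto split: if_splits)
    fix c assume "c \<in> gens K (int a)"
    then obtain J where J: "J \<subseteq> {..<n}" "finite J" "int (card J) = int a" "c = set_encode J" by (rule gens_cases)
    then show "lookup ?w c \<in> hcomp C (j - gdeg K (int a) c)"
      using contraction_cycle[OF z J(1)] by (simp add: lookup_comultiplication C_def)
  qed
  show "bd K C (int a) ?w = 0"
  proof (rule koszul_chain_eqI)
    show "bd K C (int a) ?w \<in> chains K C (int a - 1) j" by (rule C.bd_chains[OF P.koszul_free w])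
    show "0 \<in> chains K C (int a - 1) j" by simp
    fix J assume J: "J \<subseteq> {..<n}" "finite J" "int (card J) = int a - 1"
    have "lookup (bd K C (int a) ?w) (set_encode J) =
        (\<Sum>u\<in>{..<n} - J. smul (shuffle_sign {u} J * b u) (contraction (insert u J) z))"
      unfolding C_def lookup_bd_restriction[OF Z.submodule_module J(2) w[unfolded C_def]]
    proof (rule sum.cong[OF refl])
      fix u assume u: "u \<in> {..<n} - J"
      have "insert u J \<subseteq> {..<n}" "card (insert u J) = a" using u J by auto
      then show "act (submodule_mod (cycles q)) (shuffle_sign {u} J * b u) (lookup ?w (set_encode (insert u J))) =
          smul (shuffle_sign {u} J * b u) (contraction (insert u J) z)"
        by (simp add: lookup_comultiplication)
    qed
    also have "\<dots> = 0"
    proof (rule koszul_eqI)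
      have "smul (shuffle_sign {u} J * b u) (contraction (insert u J) z) \<in> koszul_chains q (1 + (j - int a))"
        if "u \<in> {..<n} - J" for u
      proof -
        have 1: "shuffle_sign {u} J * b u \<in> int_gr R 1"
          using int_gr_mult[OF shuffle_sign_gr gr_int_gr[OF b_gr], of u] that by simp
        have "contraction (insert u J) z \<in> koszul_chains q (j - int a)"
          using contraction_chains[OF z'(1), of "insert u J"] J that by simp
        then show ?thesis using graded_module.act_int_gr[OF free_term_module 1, of _ q "j - int a"] by simp
      qed
      then show "(\<Sum>u\<in>{..<n} - J. smul (shuffle_sign {u} J * b u) (contraction (insert u J) z)) \<in> koszul_chains q (1 + (j - int a))"
        by (rule M.chains_sum)
      show "0 \<in> koszul_chains q j" by simp
      fix L assume L: "L \<subseteq> {..<n}" "finite L"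
      let ?s = "shuffle_sign :: nat set \<Rightarrow> nat set \<Rightarrow> 'a"
      have sumL: "lookup (\<Sum>u\<in>{..<n} - J. smul (?s {u} J * b u) (contraction (insert u J) z)) (set_encode L) =
         (\<Sum>u\<in>{..<n} - J. ?s {u} J * b u * (if insert u J \<inter> L = {} then ?s (insert u J) L * lookup z (set_encode (insert u J \<union> L)) else 0))"
        by (simp add: lookup_sum lookup_contraction[OF L(1)])
      show "lookup (\<Sum>u\<in>{..<n} - J. smul (?s {u} J * b u) (contraction (insert u J) z)) (set_encode L) = lookup 0 (set_encode L)"
      proof (cases "J \<inter> L = {}")
        case False
        then show ?thesis unfolding sumL by (auto intro!: sum.neutral)
      next
        case disj: True
        have "(\<Sum>u\<in>{..<n} - J. ?s {u} J * b u * (if insert u J \<inter> L = {} then ?s (insert u J) L * lookup z (set_encode (insert u J \<union> L)) else 0)) =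
          (\<Sum>u\<in>{..<n} - (J \<union> L). ?s J L * (?s {u} (J \<union> L) * b u * lookup z (set_encode (insert u (J \<union> L)))))"
        proof (rule sum.mono_neutral_cong_right)
          fix u assume u: "u \<in> {..<n} - (J \<union> L)"
          have 1: "?s (insert u J) L = ?s {u} L * ?s J L" using u L J by (intro shuffle_sign_insert_left) auto
          have 2: "?s {u} (J \<union> L) = ?s {u} J * ?s {u} L" using disj L J by (intro shuffle_sign_Un_right) auto
          show "?s {u} J * b u * (if insert u J \<inter> L = {} then ?s (insert u J) L * lookup z (set_encode (insert u J \<union> L)) else 0) =
            ?s J L * (?s {u} (J \<union> L) * b u * lookup z (set_encode (insert u (J \<union> L))))"
            using u disj unfolding 1 2 by (simp add: ac_simps)
        qed auto
        also have "\<dots> = ?s J L * lookup (koszul_bd (int a + q) z) (set_encode (J \<union> L))"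
          using lookup_koszul_bd[OF _ z'(1), of "J \<union> L" "int a + q"] J(2) L(2) by (simp add: sum_distrib_left)
        also have "\<dots> = 0" by (simp add: z'(2))
        finally show ?thesis unfolding sumL by simp
      qed
    qed
    finally show "lookup (bd K C (int a) ?w) (set_encode J) = lookup 0 (set_encode J)" by simp
  qed
qed

definition multiplication :: "(nat \<Rightarrow>\<^sub>0 (nat \<Rightarrow>\<^sub>0 'a)) \<Rightarrow> (nat \<Rightarrow>\<^sub>0 'a)" where
  "multiplication w = (\<Sum>I\<in>Pow {..<n}. single (set_encode I)
     (\<Sum>J\<in>Pow I. shuffle_sign J (I - J) * lookup (lookup w (set_encode J)) (set_encode (I - J))))"

lemma lookup_multiplication:
  "I \<subseteq> {..<n} \<Longrightarrow> lookup (multiplication w) (set_encode I) =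
     (\<Sum>J\<in>Pow I. shuffle_sign J (I - J) * lookup (lookup w (set_encode J)) (set_encode (I - J)))"
  unfolding multiplication_def by (rule lookup_sum_faces)

lemma multiplication_add: "multiplication (w + w') = multiplication w + multiplication w'"
  by (simp add: multiplication_def lookup_add distrib_left sum.distrib single_add)

lemma multiplication_0 [simp]: "multiplication 0 = 0"
  by (simp add: multiplication_def)

text \<open>Each of the subsets J of size a of an index set I of size a + q contributes once, the two signs being equal.\<close>

lemma multiplication_comultiplication:
  assumes z: "z \<in> koszul_chains (int a + int q) j"
  shows "multiplication (comultiplication a z) = smul (of_nat ((a + q) choose a)) z"
proof (rule poly_mapping_eqI)
  fix c
  show "lookup (multiplication (comultiplication a z)) c = lookup (smul (of_nat ((a + q) choose a)) z) c"
  proof (cases "c \<in> set_encode ` Pow {..<n}")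
    case False
    then have "c \<notin> keys z" using chains_koszul_keys[OF z] by blast
    moreover have "c \<notin> keys (multiplication (comultiplication a z))"
      using False unfolding multiplication_def by (auto dest!: subsetD[OF keys_sum_faces])
    ultimately show ?thesis by (simp add: in_keys_iff)
  next
    case True
    then obtain I where I: "I \<subseteq> {..<n}" "c = set_encode I" by blast
    have fI: "finite I" using I subset_lessThan_finite by blast
    have "lookup (multiplication (comultiplication a z)) c = (\<Sum>J\<in>Pow I. if card J = a then lookup z c else 0)"
      unfolding I(2) lookup_multiplication[OF I(1)]
    proof (rule sum.cong[OF refl])
      fix J assume J: "J \<in> Pow I"
      have "J \<subseteq> {..<n}" "I - J \<subseteq> {..<n}" "J \<union> (I - J) = I" "J \<inter> (I - J) = {}" using J I by auto
      then show "shuffle_sign J (I - J) * lookup (lookup (comultiplication a z) (set_encode J)) (set_encode (I - J)) =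
          (if card J = a then lookup z (set_encode I) else 0)"
        by (simp add: lookup_comultiplication lookup_contraction shuffle_sign_square_left)
    qed
    also have "\<dots> = (\<Sum>J | J \<subseteq> I \<and> card J = a. lookup z c)"
      using fI by (intro sum.mono_neutral_cong_right) auto
    also have "\<dots> = of_nat (card I choose a) * lookup z c"
      by (simp add: n_subsets[OF fI])
    also have "\<dots> = of_nat ((a + q) choose a) * lookup z c"
    proof (cases "lookup z c = 0")
      case False
      then have "card I = a + q" using chain_face(2)[OF z fI] I(2) by simp
      then show ?thesis by simp
    qed simp
    finally show ?thesis by simp
  qed
qed

end

section \<open>Cycles with coefficients and the change of rings\<close>

lemma restriction_copower: "restriction R (copower X e M) = copower X e (restriction R M)"
  by (simp add: restriction_def copower_def)

context koszul_algebra
begin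

text \<open>As \<open>tensor\<close>, but for a Koszul chain z with coefficients in R instead of the polynomial ring.\<close>

definition pure_tensor :: "(nat \<Rightarrow>\<^sub>0 'a) \<Rightarrow> (nat \<Rightarrow>\<^sub>0 'a) \<Rightarrow> (nat \<Rightarrow>\<^sub>0 (nat \<Rightarrow>\<^sub>0 'a))" where
  "pure_tensor z m = mapp (\<lambda>_ a. smul a m) z"

lemma lookup_pure_tensor [simp]: "lookup (pure_tensor z m) x = smul (lookup z x) m"
  unfolding pure_tensor_def by (rule lookup_mapp0) (auto intro: poly_mapping_eqI)

lemma pure_tensor_add: "pure_tensor z (m + m') = pure_tensor z m + pure_tensor z m'"
  by (intro poly_mapping_eqI) (simp add: lookup_add distrib_left)

lemma pure_tensor_smul: "pure_tensor z (smul x m) = pure_tensor (smul x z) m"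
  by (intro poly_mapping_eqI) (simp add: ac_simps)

lemma pure_tensor_0 [simp]: "pure_tensor z 0 = 0"
  by (intro poly_mapping_eqI) simp

lemma multiplication_pure_tensor: "multiplication (pure_tensor z m) = wedge z m"
  by (simp add: multiplication_def wedge_def mult.assoc)

abbreviation coefficients :: "(int \<Rightarrow> (nat \<Rightarrow>\<^sub>0 'a) set) \<Rightarrow> (('a \<Rightarrow>\<^sub>0 nat) \<Rightarrow>\<^sub>0 'k, nat \<Rightarrow>\<^sub>0 'a) graded_mod" where
  "coefficients H \<equiv> restriction R (submodule_mod H)"

lemma bd_pure_tensor:
  assumes H: "graded_submodule R X e H"
  shows "bd K (coefficients H) p (pure_tensor z m) = pure_tensor (koszul_bd p z) m"
proof (rule poly_mapping_eqI)
  fix y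
  interpret H: graded_submodule R X e H by fact
  interpret C: graded_module S "coefficients H" by (rule restriction_module[OF H.submodule_module])
  have "keys (pure_tensor z m) \<subseteq> keys z" unfolding pure_tensor_def by (rule keys_mapp)
  then show "lookup (bd K (coefficients H) p (pure_tensor z m)) y = lookup (pure_tensor (koszul_bd p z) m) y"
    by (simp add: C.lookup_bd_superset[of "keys z"] M.lookup_bd)
      (intro poly_mapping_eqI, simp add: lookup_sum sum_distrib_right mult.assoc)
qed

lemma pure_tensor_chains:
  assumes H: "graded_submodule R X e H" and z: "z \<in> koszul_chains p l" and m: "m \<in> H k"
  shows "pure_tensor z m \<in> chains K (coefficients H) p (l + k)"
proof (rule chainsI)
  interpret H: graded_submodule R X e H by fact
  interpret HM: graded_module R "submodule_mod H" by (rule H.submodule_module)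
  have "keys (pure_tensor z m) \<subseteq> keys z" unfolding pure_tensor_def by (rule keys_mapp)
  then show "keys (pure_tensor z m) \<subseteq> gens K p" using chains_keys[OF z] by blast
  fix x assume "x \<in> gens K p"
  then have "lookup z x \<in> int_gr R (l - p)" using chains_lookup[OF z, of x] by simp
  then show "lookup (pure_tensor z m) x \<in> hcomp (coefficients H) (l + k - gdeg K p x)"
    using HM.act_int_gr[of "lookup z x" "l - p" m k] m by (simp add: algebra_simps)
qed

text \<open>The image of the tensor product of the p-cycles of the Koszul complex with a module.\<close>

inductive_set cycle_tensors :: "(int \<Rightarrow> (nat \<Rightarrow>\<^sub>0 'a) set) \<Rightarrow> int \<Rightarrow> int \<Rightarrow> (nat \<Rightarrow>\<^sub>0 (nat \<Rightarrow>\<^sub>0 'a)) set"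
  for H p d where
  cycle_tensors_0: "0 \<in> cycle_tensors H p d"
| cycle_tensors_step: "z \<in> cycles p l \<Longrightarrow> m \<in> H (d - l) \<Longrightarrow> w \<in> cycle_tensors H p d \<Longrightarrow>
    pure_tensor z m + w \<in> cycle_tensors H p d"

lemma cycle_tensors_sum:
  "finite Y \<Longrightarrow> (\<And>x. x \<in> Y \<Longrightarrow> z x \<in> cycles p (l x) \<and> m x \<in> H (d - l x)) \<Longrightarrow>
    (\<Sum>x\<in>Y. pure_tensor (z x) (m x)) \<in> cycle_tensors H p d"
  by (induction Y rule: finite_induct) (auto intro: cycle_tensors_0 cycle_tensors_step)

definition vanishes :: "int \<Rightarrow> int \<Rightarrow> bool" where
  "vanishes p j \<longleftrightarrow> cycles p j \<subseteq> boundaries p j"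

lemma cycles_0: "cycles 0 j = koszul_chains 0 j"
proof -
  have "koszul_bd 0 f = 0" if "f \<in> koszul_chains 0 j" for f
    using chains_keys[OF koszul_bd_chains[OF that]] by (simp add: gens_koszul)
  then show ?thesis by (auto simp: cycles_def)
qed

lemma one_cycle: "single (set_encode {}) 1 \<in> cycles 0 0"
  using single_chain[of "{}", OF _ one_int_gr] by (simp add: cycles_0)

text \<open>Nakayama's lemma for a module bounded below: if all elements of degree above c are decomposable, the module is
  generated in degrees up to c.\<close>

lemma cover_bounded:
  assumes H: "graded_submodule R X e H" and low: "\<And>j. j < lo \<Longrightarrow> H j \<subseteq> {0}"
    and gen: "\<And>j. c < j \<Longrightarrow> H j \<subseteq> decomposables R (submodule_mod H) j"
  shows "\<exists>X' e' \<nu>. (\<forall>x\<in>X'. lo \<le> e' x \<and> e' x \<le> c) \<and> (\<forall>x\<in>X'. \<nu> x \<in> H (e' x)) \<and>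
    (\<forall>l. H l \<subseteq> combination (submodule_mod H) \<nu> ` hcomp (copower X' e' (regular_mod R)) l)"
proof -
  interpret H: graded_submodule R X e H by fact
  interpret HM: graded_module R "submodule_mod H" by (rule H.submodule_module)
  obtain X' e' \<nu> where c: "\<And>x. x \<in> X' \<Longrightarrow> e' x \<in> {lo..c}" "\<And>x. x \<in> X' \<Longrightarrow> \<nu> x \<in> H (e' x)"
    "\<And>l. l \<in> {lo..c} \<Longrightarrow> H l \<subseteq> combination (submodule_mod H) \<nu> ` hcomp (copower X' e' (regular_mod R)) l"
    using H.free_cover[of "{lo..c}"] by metis
  let ?c = "combination (submodule_mod H) \<nu>" and ?F = "hcomp (copower X' e' (regular_mod R))"
  interpret C: graded_module R "copower X' e' (regular_mod R)" by (rule free_module)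
  have "H l \<subseteq> ?c ` ?F l" for l
  proof (induction "nat (l - lo + 1)" arbitrary: l rule: less_induct)
    case less
    consider "l < lo" | "l \<in> {lo..c}" | "lo \<le> l" "c < l" by force
    then show ?case
    proof cases
      case 1
      then show ?thesis using low[of l] by (auto intro!: image_eqI[of _ _ 0])
    next
      case 2
      then show ?thesis by (rule c(3))
    next
      case 3
      have "m \<in> ?c ` ?F l" if "m \<in> decomposables R (submodule_mod H) l" for m
        using that
      proof (induction m rule: decomposables.induct)
        case decomposables_0
        show ?case by (auto intro!: image_eqI[of _ _ 0])
      next
        case (decomposables_step x i n m)
        have "H (l - int i) \<subseteq> ?c ` ?F (l - int i)" using less[of "l - int i"] decomposables_step.hyps(2) 3 by simp
        then obtain g where g: "g \<in> ?F (l - int i)" "n = ?c g" using decomposables_step.hyps(3) by auto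
        obtain g' where g': "g' \<in> ?F l" "m = ?c g'" using decomposables_step.IH by blast
        have "smul x g \<in> ?F l" using C.act_hcomp[OF decomposables_step.hyps(1) g(1)] by simp
        then have "smul x g + g' \<in> ?F l" using C.hcomp_add g'(1) by blast
        moreover have "?c (smul x g + g') = act (submodule_mod H) x n + m"
          by (simp only: HM.combination_add HM.combination_smul g(2) g'(2))
        ultimately show ?case by (metis imageI)
      qed
      then show ?thesis using gen[OF 3(2)] by blast
    qed
  qed
  then show ?thesis using c(1,2) by (intro exI[of _ X'] exI[of _ e'] exI[of _ \<nu>]) simp
qed

text \<open>The change of rings argument. The Koszul cycles with coefficients in H come from the cycles
  with coefficients in R up to a contribution of the higher Tor of H over R, which is excluded in
  high degrees. In a free cover of H a lift of such a cycle w has a boundary with coefficients in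
  the syzygies of H; inductively this boundary is in the image of the cycles of R, and in the given
  degree those are boundaries. Hence the lift can be corrected to a cycle, whose coordinates are
  cycles with coefficients in R.\<close>

lemma koszul_cycles_tensor:
  assumes F: "resolution R F"
  shows "graded_submodule R X e H \<Longrightarrow> (\<And>j. j < lo \<Longrightarrow> H j \<subseteq> {0}) \<Longrightarrow>
    (\<And>i j. i \<le> a \<Longrightarrow> c + int i < j \<Longrightarrow> tor_vanishes F (submodule_mod H) (int i) j) \<Longrightarrow>
    (\<And>p l. p < a \<Longrightarrow> d - c - int (a - p) \<le> l \<Longrightarrow> vanishes (int p) l) \<Longrightarrow>
    w \<in> chains K (coefficients H) (int a) d \<Longrightarrow> bd K (coefficients H) (int a) w = 0 \<Longrightarrow>
    w \<in> cycle_tensors H (int a) d"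
proof (induction a arbitrary: X e H c w)
  case (0 X e H c w)
  have w: "w \<in> chains K (coefficients H) 0 d" using 0 by simp
  have g: "set_encode {} \<in> gens K 0" by (simp add: P.koszul_gens_0)
  have eq: "w = pure_tensor (single (set_encode {}) 1) (lookup w (set_encode {}))"
  proof (rule poly_mapping_eqI)
    fix x
    show "lookup w x = lookup (pure_tensor (single (set_encode {}) 1) (lookup w (set_encode {}))) x"
      using chains_outside[OF w, of x]
      by (cases "x = set_encode {}") (auto simp: P.koszul_gens_0 lookup_single lookup_one when_def intro!: poly_mapping_eqI)
  qed
  have "lookup w (set_encode {}) \<in> H (d - 0)" using chains_lookup[OF w g] by simp
  from cycle_tensors_step[where d = d and H = H and p = 0, OF one_cycle this cycle_tensors_0]
  have "pure_tensor (single (set_encode {}) 1) (lookup w (set_encode {})) \<in> cycle_tensors H 0 d" by simp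
  then show ?case by (simp only: eq[symmetric] of_nat_0)
next
  case (Suc a X e H c w)
  interpret F: resolution R F by fact
  interpret H: graded_submodule R X e H by fact
  interpret HM: resolution_module R F "submodule_mod H"
    by (intro resolution_module.intro F H.submodule_module)
  have gen: "H j \<subseteq> decomposables R (submodule_mod H) j" if "c < j" for j
    using HM.tor_vanishes_0_iff[of j] Suc.prems(3)[of 0 j] that by simp
  have "\<exists>X' e' \<nu>. (\<forall>x\<in>X'. lo \<le> e' x \<and> e' x \<le> c) \<and> (\<forall>x\<in>X'. \<nu> x \<in> H (e' x)) \<and>
      (\<forall>l. H l \<subseteq> combination (submodule_mod H) \<nu> ` hcomp (copower X' e' (regular_mod R)) l)"
    by (rule cover_bounded[OF Suc.prems(1,2) gen])
  then obtain X' e' \<nu> where cov': "\<forall>x\<in>X'. lo \<le> e' x \<and> e' x \<le> c" "\<forall>x\<in>X'. \<nu> x \<in> H (e' x)"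
      "\<forall>l. H l \<subseteq> combination (submodule_mod H) \<nu> ` hcomp (copower X' e' (regular_mod R)) l"
    by (elim exE conjE) (rule that)
  note cov = bspec[OF cov'(1)] bspec[OF cov'(2)] spec[OF cov'(3)]
  let ?G = "copower X' e' (regular_mod R)" and ?\<phi> = "\<lambda>_::int. combination (submodule_mod H) \<nu>"
  interpret h: graded_hom R ?G "submodule_mod H" ?\<phi>
    by (rule combination_hom[OF H.submodule_module]) (use cov(2) in simp)
  obtain H' where H': "h.kernel = submodule_mod H'" "graded_submodule R X' e' H'"
    using kernel_submodule[OF h.graded_hom_axioms] by blast
  interpret H': graded_submodule R X' e' H' by (rule H'(2))
  interpret H'M: resolution_module R F "submodule_mod H'"
    by (intro resolution_module.intro F H'.submodule_module)
  have surj: "hcomp (submodule_mod H) j \<subseteq> ?\<phi> j ` hcomp ?G j" for j using cov(3) by simp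
  have low': "H' j \<subseteq> {0}" if "j < lo" for j
  proof
    fix g assume "g \<in> H' j"
    then have g: "g \<in> hcomp ?G j" using H'.sub_free by blast
    have "lookup g x = 0" for x
      using hcomp_copower_lookup[OF g, of x] hcomp_copower_outside[OF g, of x] cov(1)[of x] that
      by (cases "x \<in> X'") (auto simp: int_gr_def split: if_splits)
    then show "g \<in> {0}" by (auto intro: poly_mapping_eqI)
  qed
  have tor': "tor_vanishes F (submodule_mod H') (int i) j" if "i \<le> a" "c + 1 + int i < j" for i j
  proof -
    have "tor_vanishes F (submodule_mod H) (int i + 1) j"
      using Suc.prems(3)[of "Suc i" j] that by (simp add: add.commute)
    moreover have "tor_vanishes F ?G (int i) j"
      by (rule F.tor_vanishes_free) (use cov(1) that in force)
    ultimately show ?thesis using h.tor_vanishes_kernel[OF F.complex surj] by (simp add: H'(1))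
  qed
  interpret hS: graded_hom S "restriction R ?G" "coefficients H" ?\<phi>
    by (rule restriction_hom) (rule h.graded_hom_axioms)
  have ker: "hS.kernel = coefficients H'"
    using restriction_kernel[OF h.graded_hom_axioms] by (simp add: H'(1))
  have idx: "int (Suc a) = int a + 1" by simp
  have w: "w \<in> chains K (coefficients H) (int a + 1) d" "bd K (coefficients H) (int a + 1) w = 0"
    using Suc.prems(5,6) by (simp_all add: add.commute)
  have "hcomp (coefficients H) j \<subseteq> ?\<phi> j ` hcomp (restriction R ?G) j" for j using cov(3) by simp
  from hS.chain_map_lift[OF this w(1)]
  obtain z0 where z0: "z0 \<in> chains K (restriction R ?G) (int a + 1) d" "hS.chain_map K (int a + 1) d z0 = w" by blast
  let ?t = "bd K (restriction R ?G) (int a + 1) z0"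
  have "?t \<in> chains K (restriction R ?G) (int a) d" by (rule hS.dom.bd_chains_Suc[OF P.koszul_free z0(1)])
  moreover have "hS.chain_map K (int a) d ?t = 0" using hS.chain_map_bd_Suc[OF P.koszul_free z0(1)] z0(2) w(2) by simp
  ultimately have t: "?t \<in> chains K (coefficients H') (int a) d" using hS.chains_kernel_iff[of ?t] by (simp add: ker)
  have bdker: "bd K (coefficients H') = bd K (restriction R ?G)" using hS.bd_kernel[of K] by (simp add: ker)
  have "bd K (coefficients H') (int a) ?t = 0"
    unfolding bdker
    using hS.dom.bd_bd[OF resolution.complex[OF P.koszul_resolution]] chains_keys[OF z0(1)] by blast
  then have tt: "?t \<in> cycle_tensors H' (int a) d"
    using Suc.IH[OF H'(2) low' tor' _ t] Suc.prems(4) by (simp add: Suc_diff_le)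
  interpret C': graded_module S "coefficients H'" by (rule restriction_module[OF H'.submodule_module])
  let ?I = "bd K (coefficients H') (int a + 1) ` chains K (coefficients H') (int a + 1) d"
  have I_add: "x + y \<in> ?I" if xy: "x \<in> ?I" "y \<in> ?I" for x y
  proof -
    obtain x' y' where "x = bd K (coefficients H') (int a + 1) x'" "y = bd K (coefficients H') (int a + 1) y'"
      "x' \<in> chains K (coefficients H') (int a + 1) d" "y' \<in> chains K (coefficients H') (int a + 1) d"
      using xy by blast
    then show ?thesis using C'.chains_add[of x' K "int a + 1" d y'] by (auto simp flip: C'.bd_add)
  qed
  have I_0: "0 \<in> ?I" by (rule image_eqI[of _ _ 0]) auto
  interpret Zc: graded_submodule R "gens K (int a)" "\<lambda>_. int a" "cycles (int a)" by (rule cycles_submodule)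
  \<comment> \<open>The syzygies are generated in degrees up to c + 1, which leaves z a degree in which all cycles are boundaries.\<close>
  have pure: "pure_tensor z m \<in> ?I" if "z \<in> cycles (int a) l" "m \<in> H' (d - l)" for z m l
    using that
  proof (induction "nat (d - l - lo + 1)" arbitrary: l z m rule: less_induct)
    case (less l z m)
    consider "d - l < lo" | "d - l \<le> c + 1" | "lo \<le> d - l" "c + 1 < d - l" by linarith
    then show ?case
    proof cases
      case 1
      then have "m = 0" using low' less.prems(2) by auto
      then show ?thesis using I_0 by simp
    next
      case 2
      then have "vanishes (int a) l" using Suc.prems(4)[of a l] by simp
      then obtain y where y: "y \<in> koszul_chains (int a + 1) l" "z = koszul_bd (int a + 1) y"
        using less.prems(1) by (auto simp: vanishes_def boundaries_def)
      have "pure_tensor y m \<in> chains K (coefficients H') (int a + 1) d"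
        using pure_tensor_chains[OF H'(2) y(1) less.prems(2)] by simp
      then show ?thesis using bd_pure_tensor[OF H'(2), of "int a + 1" y m] y(2) by (metis imageI)
    next
      case 3
      have "m \<in> decomposables R (submodule_mod H') (d - l)"
        using H'M.tor_vanishes_0_iff[of "d - l"] tor'[of 0 "d - l"] 3 less.prems(2) by auto
      then show ?thesis
      proof (induction m rule: decomposables.induct)
        case (decomposables_step x i n m)
        have "pure_tensor (smul x z) n \<in> ?I"
          by (rule less.hyps[of "int i + l"])
            (use 3 decomposables_step.hyps Zc.sub_smul[OF _ less.prems(1)] in \<open>auto simp: algebra_simps\<close>)
        then show ?case using I_add decomposables_step.IH by (simp add: pure_tensor_add pure_tensor_smul)
      qed (use I_0 in simp)
    qed
  qed
  have "t \<in> ?I" if "t \<in> cycle_tensors H' (int a) d" for t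
    using that by (induction t rule: cycle_tensors.induct) (use I_0 I_add pure in auto)
  from this[OF tt] obtain y where y: "y \<in> chains K (coefficients H') (int a + 1) d" "?t = bd K (coefficients H') (int a + 1) y"
    by blast
  have yk: "y \<in> chains K (restriction R ?G) (int a + 1) d" "hS.chain_map K (int a + 1) d y = 0"
    using y(1) hS.chains_kernel_iff[of y K "int a + 1" d] by (simp_all add: ker)
  define z1 where "z1 = z0 - y"
  have z1: "z1 \<in> chains K (restriction R ?G) (int a + 1) d" unfolding z1_def by (rule hS.dom.chains_diff[OF z0(1) yk(1)])
  have bdz1: "bd K (restriction R ?G) (int a + 1) z1 = 0" unfolding z1_def using y(2) by (simp add: hS.dom.bd_diff bdker)
  have wz1: "hS.chain_map K (int a + 1) d z1 = w"
    unfolding z1_def using hS.chain_map_diff[OF z0(1) yk(1)] z0(2) yk(2) by simp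
  have G: "restriction R ?G = copower X' e' (sym_mod R)" by (simp add: restriction_copower sym_mod_eq)
  define Y where "Y = (\<Union>c\<in>keys z1. keys (lookup z1 c))"
  have Y: "finite Y" "Y \<subseteq> X'"
    unfolding Y_def using hcomp_copower_keys[OF chains_lookup[OF z1[unfolded G]]] chains_keys[OF z1] by auto
  have "w = (\<Sum>x\<in>Y. pure_tensor (M.coordinate x z1) (\<nu> x))"
  proof (rule poly_mapping_eqI)
    fix c
    have "keys (lookup z1 c) \<subseteq> Y"
    proof (cases "c \<in> keys z1")
      case False
      then have "lookup z1 c = 0" by (simp add: in_keys_iff)
      then show ?thesis by simp
    qed (auto simp: Y_def)
    then have "combination (submodule_mod H) \<nu> (lookup z1 c) = (\<Sum>x\<in>Y. smul (lookup (lookup z1 c) x) (\<nu> x))"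
      using HM.N.combination_superset[OF Y(1)] by simp
    moreover have "lookup w c = combination (submodule_mod H) \<nu> (lookup z1 c)" by (simp flip: wz1)
    ultimately show "lookup w c = lookup (\<Sum>x\<in>Y. pure_tensor (M.coordinate x z1) (\<nu> x)) c" by (simp add: lookup_sum)
  qed
  also have "\<dots> \<in> cycle_tensors H (int (Suc a)) d"
  proof (rule cycle_tensors_sum[OF Y(1)])
    fix x assume "x \<in> Y"
    then have x: "x \<in> X'" using Y(2) by blast
    have "M.coordinate x z1 \<in> koszul_chains (int a + 1) (d - e' x)"
      by (rule M.coordinate_chains[OF z1[unfolded G] x])
    moreover have "koszul_bd (int a + 1) (M.coordinate x z1) = M.coordinate x 0"
      using M.coordinate_bd[of x K X' e' "int a + 1" z1] bdz1 by (simp add: G)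
    moreover have "M.coordinate x 0 = 0" by (rule poly_mapping_eqI) simp
    ultimately have "M.coordinate x z1 \<in> cycles (int (Suc a)) (d - e' x)" unfolding cycles_def idx by simp
    then show "M.coordinate x z1 \<in> cycles (int (Suc a)) (d - e' x) \<and> \<nu> x \<in> H (d - (d - e' x))"
      using cov(2)[OF x] by simp
  qed
  finally show ?case .
qed

section \<open>The Tor of the modules of Koszul cycles\<close>

lemma cycles_low: "j < p \<Longrightarrow> cycles p j \<subseteq> {0}"
proof
  fix f assume "j < p" "f \<in> cycles p j"
  then have f: "f \<in> koszul_chains p j" by (simp add: cycles_def)
  have "lookup f x = 0" for x
    using chains_lookup[OF f, of x] chains_outside[OF f, of x] \<open>j < p\<close>
    by (cases "x \<in> gens K p") (auto simp: int_gr_def split: if_splits)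
  then show "f \<in> {0}" by (auto intro: poly_mapping_eqI)
qed

text \<open>Dimension shifting along the cycles and boundaries of the Koszul complex. Each step from the
  q-cycles to the next ones replaces the i-th Tor by the next one, and lets in the Tor of
  the Koszul homology in degree q, which is a sum of shifted copies of the residue field.\<close>

lemma tor_cycles:
  assumes F: "resolution R F"
    and res: "\<And>i j. i \<le> N \<Longrightarrow> int i < j \<Longrightarrow> tor_vanishes F (residue_mod R) (int i) j"
  shows "i + q + 1 \<le> N \<Longrightarrow> (i = 0 \<Longrightarrow> int q < j) \<Longrightarrow>
    (\<And>p l. p < q \<Longrightarrow> j - int (i + q + 1 - p) \<le> l \<Longrightarrow> vanishes (int p) l) \<Longrightarrow>
    tor_vanishes F (submodule_mod (cycles (int q))) (int i) j"
proof (induction q arbitrary: i)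
  case (0 i)
  interpret F: resolution R F by fact
  have "submodule_mod (cycles 0) = free_term 0"
  proof -
    have "free_term 0 = \<lparr>hcomp = hcomp (free_term 0), act = act (free_term 0)\<rparr>" by simp
    then show ?thesis unfolding submodule_mod_def act_free_term by (simp add: cycles_0 fun_eq_iff)
  qed
  moreover have "0 < i \<or> i = 0 \<and> 0 < j" using 0 by auto
  ultimately show ?case
    using F.tor_vanishes_free[of "int i" "gens K 0" "\<lambda>_. 0" j] by (auto simp: free_term_def)
next
  case (Suc q i)
  interpret F: resolution R F by fact
  interpret res: graded_module R "residue_mod R" by (rule standard_graded_algebra.residue_module[OF std])
  have "\<exists>(Y :: (int \<times> (nat \<Rightarrow>\<^sub>0 'a)) set) e \<phi>.
      graded_hom R (submodule_mod (cycles (int q))) (copower Y e (residue_mod R)) \<phi> \<and>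
      (\<forall>j. hcomp (copower Y e (residue_mod R)) j \<subseteq> \<phi> j ` cycles (int q) j) \<and>
      graded_hom.kernel (submodule_mod (cycles (int q))) \<phi> = submodule_mod (boundaries (int q)) \<and>
      (\<forall>y\<in>Y. \<not> cycles (int q) (e y) \<subseteq> boundaries (int q) (e y))"
    by (rule residue_quotient[OF res.graded_module_axioms cycles_submodule boundaries_submodule boundaries_cycles])
      (rule irrelevant_annihilates)
  then obtain Y :: "(int \<times> (nat \<Rightarrow>\<^sub>0 'a)) set" and e \<phi> where
    hom: "graded_hom R (submodule_mod (cycles (int q))) (copower Y e (residue_mod R)) \<phi>" and
    surj: "\<forall>j. hcomp (copower Y e (residue_mod R)) j \<subseteq> \<phi> j ` cycles (int q) j" and
    ker: "graded_hom.kernel (submodule_mod (cycles (int q))) \<phi> = submodule_mod (boundaries (int q))" and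
    Y: "\<forall>y\<in>Y. \<not> cycles (int q) (e y) \<subseteq> boundaries (int q) (e y)"
    by (elim exE conjE) (rule that)
  interpret h: graded_hom R "submodule_mod (cycles (int q))" "copower Y e (residue_mod R)" \<phi> by (rule hom)
  have "tor_vanishes F (copower Y e (residue_mod R)) (int i + 1 + 1) j"
  proof (rule res.tor_vanishes_copower)
    fix y assume y: "y \<in> Y"
    have "e y < j - int (i + 2)"
    proof (rule ccontr)
      assume "\<not> ?thesis"
      then have "vanishes (int q) (e y)" using Suc.prems(3)[of q "e y"] by simp
      then show False using Y y by (simp add: vanishes_def)
    qed
    then show "tor_vanishes F (residue_mod R) (int i + 1 + 1) (j - e y)"
      using res[of "i + 2" "j - e y"] Suc.prems(1) by (simp add: add.commute)
  qed
  moreover have "tor_vanishes F (submodule_mod (cycles (int q))) (int i + 1) j"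
    using Suc.IH[of "Suc i"] Suc.prems(1,3) by (simp add: add.commute)
  ultimately have bnd: "tor_vanishes F (submodule_mod (boundaries (int q))) (int i + 1) j"
    using h.tor_vanishes_kernel[OF F.complex, of "int i + 1" j] surj by (simp add: ker)
  interpret g: graded_hom R "free_term (int q + 1)" "submodule_mod (boundaries (int q))" "\<lambda>_. koszul_bd (int q + 1)"
    by (rule koszul_bd_onto_hom)
  have "tor_vanishes F (free_term (int q + 1)) (int i) j"
    unfolding free_term_def by (rule F.tor_vanishes_free) (use Suc.prems(2) in force)
  from g.tor_vanishes_kernel[OF F.complex _ bnd this]
  have "tor_vanishes F g.kernel (int i) j" by (simp add: boundaries_def)
  then show ?case unfolding kernel_koszul_bd_onto by (simp add: add.commute)
qed

section \<open>Vanishing of Koszul homology\<close>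

text \<open>A product of two cycles is a boundary as soon as one of them is.\<close>

lemma cycle_tensors_multiplication:
  assumes w: "w \<in> cycle_tensors (cycles q) p d"
    and vanish: "\<And>l. vanishes p l \<or> vanishes q (d - l)"
  shows "multiplication w \<in> boundaries (p + q) d"
  using w
proof (induction w rule: cycle_tensors.induct)
  case cycle_tensors_0
  interpret V: graded_submodule R "gens K (p + q)" "\<lambda>_. p + q" "boundaries (p + q)" by (rule boundaries_submodule)
  show ?case by (simp add: V.sub_0)
next
  case (cycle_tensors_step z l m w)
  interpret V: graded_submodule R "gens K (p + q)" "\<lambda>_. p + q" "boundaries (p + q)" by (rule boundaries_submodule)
  have "wedge z m \<in> boundaries (p + q) (l + (d - l))"
    using vanish[of l] wedge_boundary_left[OF _ cycle_tensors_step.hyps(2), of z p l]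
      wedge_boundary_right[OF cycle_tensors_step.hyps(1), of m q "d - l"] cycle_tensors_step.hyps(1,2)
    by (auto simp: vanishes_def)
  then show ?case using cycle_tensors_step.IH V.sub_add
    by (simp add: multiplication_add multiplication_pure_tensor)
qed

text \<open>The heart of the matter. A cycle z is recovered, up to the invertible binomial coefficient, by multiplying out
  its comultiplication, which is a sum of tensors of cycles by \<open>koszul_cycles_tensor\<close>. In each summand one
  factor has a degree in which all cycles are boundaries.\<close>

lemma vanishes_sum:
  fixes a b' :: nat and ta tb ta' tb' d :: int
  assumes F: "resolution R F"
    and res: "\<And>i j. i \<le> a + b' + 1 \<Longrightarrow> int i < j \<Longrightarrow> tor_vanishes F (residue_mod R) (int i) j"
    and unit: "(of_nat ((a + b') choose a) :: 'k) \<noteq> 0"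
    and a: "\<And>p l. p < a \<Longrightarrow> ta' - int (a - 1 - p) < l \<Longrightarrow> vanishes (int p) l" "\<And>l. ta < l \<Longrightarrow> vanishes (int a) l"
    and b: "\<And>p l. p < b' \<Longrightarrow> tb' - int (b' - 1 - p) < l \<Longrightarrow> vanishes (int p) l" "\<And>l. tb < l \<Longrightarrow> vanishes (int b') l"
    and low: "int b' - 1 \<le> tb'"
    and d: "ta + tb < d" "ta' + tb' + 3 < d"
  shows "vanishes (int a + int b') d"
  unfolding vanishes_def
proof
  \<comment> \<open>By \<open>tor_cycles\<close> the i-th Tor of the cycles vanishes in degrees above ?c + i.\<close>
  let ?c = "tb' + 2"
  fix z assume z: "z \<in> cycles (int a + int b') d"
  interpret V: graded_submodule R "gens K (int a + int b')" "\<lambda>_. int a + int b'" "boundaries (int a + int b')"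
    by (rule boundaries_submodule)
  have tor: "tor_vanishes F (submodule_mod (cycles (int b'))) (int i) j" if i: "i \<le> a" "?c + int i < j" for i j
  proof (rule tor_cycles[OF F res])
    show "i + b' + 1 \<le> a + b' + 1" using i by simp
    show "int b' < j" if "i = 0" using i low by simp
    show "vanishes (int p) l" if "p < b'" "j - int (i + b' + 1 - p) \<le> l" for p l
      by (rule b(1)) (use that i in auto)
  qed
  have "comultiplication a z \<in> cycle_tensors (cycles (int b')) (int a) d"
  proof (rule koszul_cycles_tensor[OF F cycles_submodule, where lo = "int b'" and c = ?c])
    show "vanishes (int p) l" if "p < a" "d - ?c - int (a - p) \<le> l" for p l
      by (rule a(1)) (use that d in auto)
  qed (use cycles_low tor comultiplication_cycle[OF z] in auto)
  then have "multiplication (comultiplication a z) \<in> boundaries (int a + int b') d"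
  proof (rule cycle_tensors_multiplication)
    fix l show "vanishes (int a) l \<or> vanishes (int b') (d - l)"
      using a(2)[of l] b(2)[of "d - l"] d(1) by linarith
  qed
  then have *: "smul (of_nat ((a + b') choose a)) z \<in> boundaries (int a + int b') d"
    using multiplication_comultiplication[of z a b' d] z by (simp add: cycles_def)
  let ?k = "of_nat ((a + b') choose a) :: 'k"
  have "scl R (of_nat k) 1 = of_nat k" for k
    by (induction k) (simp_all add: scale_left_distrib)
  then have "scl R (inverse ?k) 1 * of_nat ((a + b') choose a) = scl R (inverse ?k * ?k) 1"
    by (metis scl_eq scale_scale)
  then have "smul (scl R (inverse ?k) 1) (smul (of_nat ((a + b') choose a)) z) = z"
    using unit by (intro poly_mapping_eqI) (simp flip: mult.assoc)
  moreover have "scl R (inverse ?k) 1 \<in> gr R 0" by (simp add: gr_0)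
  ultimately show "z \<in> boundaries (int a + int b') d" using V.sub_smul[OF _ *, of _ 0] by fastforce
qed

text \<open>For i = 0 the dimension shift \<open>tor_cycles\<close> bounds the degrees of the generators of the cycles, and
  decomposable cycles are boundaries.\<close>

lemma vanishes_Suc:
  fixes a :: nat and ta d :: int
  assumes F: "resolution R F"
    and res: "\<And>i j. i \<le> a + 2 \<Longrightarrow> int i < j \<Longrightarrow> tor_vanishes F (residue_mod R) (int i) j"
    and a: "\<And>p l. p \<le> a \<Longrightarrow> ta - int (a - p) < l \<Longrightarrow> vanishes (int p) l"
    and low: "int a \<le> ta" and d: "ta + 2 < d"
  shows "vanishes (int a + 1) d"
proof -
  interpret Z: graded_submodule R "gens K (int (Suc a))" "\<lambda>_. int (Suc a)" "cycles (int (Suc a))" by (rule cycles_submodule)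
  interpret V: graded_submodule R "gens K (int (Suc a))" "\<lambda>_. int (Suc a)" "boundaries (int (Suc a))" by (rule boundaries_submodule)
  interpret ZM: resolution_module R F "submodule_mod (cycles (int (Suc a)))"
    by (intro resolution_module.intro F Z.submodule_module)
  have "tor_vanishes F (submodule_mod (cycles (int (Suc a)))) (int 0) d"
  proof (rule tor_cycles[OF F res])
    show "vanishes (int p) l" if "p < Suc a" "d - int (0 + Suc a + 1 - p) \<le> l" for p l
      by (rule a) (use that d in auto)
  qed (use low d in auto)
  then have "cycles (int (Suc a)) d \<subseteq> decomposables R (submodule_mod (cycles (int (Suc a)))) d"
    using ZM.tor_vanishes_0_iff by simp
  moreover have "m \<in> boundaries (int (Suc a)) d" if "m \<in> decomposables R (submodule_mod (cycles (int (Suc a)))) d" for m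
    using that
  proof (induction m rule: decomposables.induct)
    case (decomposables_step x i n m)
    then have "smul x n \<in> boundaries (int (Suc a)) d"
      using irrelevant_annihilates[of x i n "int (Suc a)" "d - int i"] by (simp del: of_nat_Suc)
    then show ?case using V.sub_add decomposables_step.IH by (simp del: of_nat_Suc)
  qed (rule V.sub_0)
  ultimately show ?thesis by (auto simp: vanishes_def add.commute)
qed

end

section \<open>The degrees of the syzygies\<close>

lemma carrier_quotient_trivial_iff:
  fixes Z W :: "'b::ab_group_add set"
  assumes Z: "0 \<in> Z" and W: "0 \<in> W" "\<And>x y. x \<in> W \<Longrightarrow> y \<in> W \<Longrightarrow> x + y \<in> W" "\<And>x. x \<in> W \<Longrightarrow> - x \<in> W"
  shows "carrier (additive_monoid Z Mod W) = {\<one>\<^bsub>additive_monoid Z Mod W\<^esub>} \<longleftrightarrow> Z \<subseteq> W"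
proof -
  have coset: "W #>\<^bsub>additive_monoid Z\<^esub> z = (\<lambda>h. h + z) ` W" for z
    by (auto simp: r_coset_def additive_monoid_def)
  have carrier: "carrier (additive_monoid Z Mod W) = (\<lambda>z. (\<lambda>h. h + z) ` W) ` Z"
    unfolding FactGroup_def RCOSETS_def coset by (auto simp: additive_monoid_def)
  have one: "\<one>\<^bsub>additive_monoid Z Mod W\<^esub> = W" by (simp add: FactGroup_def)
  have trans: "(\<lambda>h. h + z) ` W = W \<longleftrightarrow> z \<in> W" for z
  proof
    assume "(\<lambda>h. h + z) ` W = W"
    then show "z \<in> W" using W(1) by (metis add_0 imageI)
  next
    assume z: "z \<in> W"
    show "(\<lambda>h. h + z) ` W = W"
    proof (intro equalityI subsetI)
      fix x assume "x \<in> W"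
      then have "x + - z \<in> W" using W z by blast
      then show "x \<in> (\<lambda>h. h + z) ` W" by (intro image_eqI[of _ _ "x + - z"]) auto
    qed (use W(2) z in auto)
  qed
  have image_const: "f ` Z = {W} \<longleftrightarrow> (\<forall>z\<in>Z. f z = W)" for f :: "'b \<Rightarrow> 'b set" using Z by blast
  show ?thesis unfolding carrier one image_const trans by blast
qed

lemma carrier_Tor_trivial_iff:
  assumes "graded_module A N"
  shows "carrier (Tor A N i j) = {\<one>\<^bsub>Tor A N i j\<^esub>} \<longleftrightarrow> tor_vanishes (free_resolution A) N i j"
proof -
  interpret graded_module A N by fact
  let ?F = "free_resolution A"
  let ?W = "bd ?F N (i + 1) ` chains ?F N (i + 1) j"
  have "carrier (Tor A N i j) = {\<one>\<^bsub>Tor A N i j\<^esub>} \<longleftrightarrow> {z \<in> chains ?F N i j. bd ?F N i z = 0} \<subseteq> ?W"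
    unfolding Tor_def Let_def
  proof (rule carrier_quotient_trivial_iff)
    show "0 \<in> ?W" by (rule image_eqI[of _ _ 0]) auto
    show "x + y \<in> ?W" if "x \<in> ?W" "y \<in> ?W" for x y
      using that by (auto simp flip: bd_add intro: imageI chains_add)
    show "- x \<in> ?W" if "x \<in> ?W" for x
      using that by (auto simp flip: bd_uminus intro: imageI chains_uminus)
  qed simp
  then show ?thesis by (auto simp: tor_vanishes_def)
qed

lemma t_top_eq:
  assumes "graded_module A N"
  shows "t_top A N i = Sup {ereal (of_int j) | j. \<not> tor_vanishes (free_resolution A) N i j}"
  unfolding t_top_def top_degree_def carrier_Tor_trivial_iff[OF assms] ..

lemma Sup_ereal_int_attained:
  assumes "Sup {ereal (of_int j) | j. P j} = x" "x \<noteq> \<infinity>" "x \<noteq> - \<infinity>"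
  shows "\<exists>k. x = ereal (of_int k)"
proof -
  let ?S = "{ereal (of_int j) | j. P j}"
  obtain r where r: "x = ereal r" using assms(2,3) by (cases x) auto
  have "ereal (r - 1) < Sup ?S" using assms(1) r by simp
  then obtain j where j: "P j" "r - 1 < of_int j" by (auto simp: less_Sup_iff)
  have "j' \<le> j" if "P j'" for j'
  proof -
    have "ereal (of_int j') \<le> Sup ?S" using that by (intro Sup_upper) blast
    then have "of_int j' \<le> r" using assms(1) r by simp
    then have "real_of_int j' < of_int j + 1" using j(2) by simp
    then show ?thesis by linarith
  qed
  then have "Sup ?S = ereal (of_int j)" by (intro Sup_eqI) (use j in auto)
  then show ?thesis using assms(1) by auto
qed

context koszul_algebra
begin

lemma tor_vanishes_koszul_iff: "tor_vanishes K (sym_mod R) p j \<longleftrightarrow> vanishes p j"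
  by (auto simp: tor_vanishes_def vanishes_def cycles_def boundaries_def)

text \<open>The algebra R is a cyclic module over the polynomial ring. Hence its first syzygy module is a submodule of a
  free module, to which \<open>tor_vanishes_change_resolution\<close> applies.\<close>

lemma tor_vanishes_sym_mod_change:
  assumes F: "resolution S F" "resolution S F'" and tor: "tor_vanishes F (sym_mod R) (int p) j"
  shows "tor_vanishes F' (sym_mod R) (int p) j"
proof (cases p)
  case 0
  interpret F: resolution_module S F "sym_mod R" by (intro resolution_module.intro F sym_module)
  interpret F': resolution_module S F' "sym_mod R" by (intro resolution_module.intro F sym_module)
  show ?thesis using tor F.tor_vanishes_0_iff F'.tor_vanishes_0_iff by (simp add: 0)
next
  case (Suc i)
  let ?\<phi> = "\<lambda>_::int. combination (sym_mod R) (\<lambda>_. 1)"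
  let ?G = "copower {0::nat} (\<lambda>_. 0) (regular_mod S)"
  have hom: "graded_hom S ?G (sym_mod R) ?\<phi>"
    by (rule P.combination_hom[OF sym_module]) simp
  have surj: "hcomp (sym_mod R) j \<subseteq> ?\<phi> j ` hcomp ?G j" for j
  proof
    fix x assume x: "x \<in> hcomp (sym_mod R) j"
    have "\<exists>q \<in> int_gr S j. canonical_map R q = x"
    proof (cases "0 \<le> j")
      case True
      then show ?thesis
        using x standard_graded_algebra.canonical_map_gr_surj[OF std basis, of x "nat j"] by (auto simp: int_gr_def S)
    next
      case False
      then show ?thesis using x standard_graded_algebra.canonical_map_0[OF std] by (auto simp: int_gr_def)
    qed
    then obtain q where q: "q \<in> int_gr S j" "canonical_map R q = x" by blast
    have "single 0 q \<in> hcomp ?G j" by (rule hcomp_copowerI) (use q in auto)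
    moreover have "?\<phi> j (single 0 q) = x" using q by (simp add: M.combination_single)
    ultimately show "x \<in> ?\<phi> j ` hcomp ?G j" by (metis imageI)
  qed
  obtain H where H: "graded_hom.kernel ?G ?\<phi> = submodule_mod H" "graded_submodule S {0} (\<lambda>_. 0) H"
    using P.kernel_submodule[OF hom] by blast
  have "tor_vanishes F' (sym_mod R) (int i + 1) j"
  proof (rule tor_vanishes_change_step[OF F hom surj])
    show "tor_vanishes F' (graded_hom.kernel ?G ?\<phi>) (int i) j" if "tor_vanishes F (graded_hom.kernel ?G ?\<phi>) (int i) j"
      using that tor_vanishes_change_resolution[OF F H(2)] by (simp add: H(1))
    show "tor_vanishes F (sym_mod R) (int i + 1) j" using tor by (simp add: Suc add.commute)
  qed
  then show ?thesis by (simp add: Suc add.commute)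
qed

lemma t_syz_eq: "t_syz R B (int p) = Sup {ereal (of_int j) | j. \<not> vanishes (int p) j}"
proof -
  have "tor_vanishes (free_resolution S) (sym_mod R) (int p) j \<longleftrightarrow> vanishes (int p) j" for j
    using tor_vanishes_sym_mod_change[OF P.free_resolution P.koszul_resolution]
      tor_vanishes_sym_mod_change[OF P.koszul_resolution P.free_resolution] tor_vanishes_koszul_iff by blast
  then show ?thesis unfolding t_syz_def using t_top_eq[OF sym_module] by (simp add: S)
qed

lemma vanishes_above: "t_syz R B (int p) < ereal (of_int l) \<Longrightarrow> vanishes (int p) l"
  unfolding t_syz_eq by (rule ccontr) (metis (mono_tags, lifting) Sup_upper linorder_not_le mem_Collect_eq)

lemma t_syz_leI:
  assumes "\<And>j. t < ereal (of_int j) \<Longrightarrow> vanishes (int p) j" shows "t_syz R B (int p) \<le> t"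
  unfolding t_syz_eq by (rule Sup_least) (use assms in \<open>auto simp: not_le[symmetric]\<close>)

lemma t_syz_0: "t_syz R B 0 = 0"
proof -
  have "vanishes 0 j \<longleftrightarrow> j \<noteq> 0" for j
  proof
    assume v: "vanishes 0 j"
    show "j \<noteq> 0"
    proof
      assume "j = 0"
      then have "single (set_encode {}) 1 \<in> boundaries 0 0" using v one_cycle by (auto simp: vanishes_def)
      then obtain f where f: "f \<in> koszul_chains (0 + 1) 0" "koszul_bd (0 + 1) f = single (set_encode {}) 1"
        by (auto simp: boundaries_def)
      have "lookup f x = 0" for x
        using chains_lookup[OF f(1), of x] chains_outside[OF f(1), of x]
        by (cases "x \<in> gens K (0 + 1)") (auto simp: int_gr_def)
      then have "f = 0" by (auto intro: poly_mapping_eqI)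
      then show False using f(2) by (metis M.bd_0 lookup_single_eq lookup_zero zero_neq_one)
    qed
  next
    assume j: "j \<noteq> 0"
    show "vanishes 0 j"
    proof (cases "0 < j")
      case True
      have "f \<in> boundaries 0 j" if f: "f \<in> cycles 0 j" for f
      proof -
        let ?x = "lookup f (set_encode {})"
        have f': "f \<in> koszul_chains 0 j" using f by (simp add: cycles_0)
        have "?x \<in> int_gr R j" using chain_face(1)[OF f', of "{}"] by simp
        then have x: "?x \<in> gr R (nat j)" using True by (simp add: int_gr_def)
        have "f = smul ?x (single (set_encode {}) 1)"
        proof (rule poly_mapping_eqI)
          fix c show "lookup f c = lookup (smul ?x (single (set_encode {}) 1)) c"
            using chains_outside[OF f', of c]
            by (cases "c = set_encode {}") (auto simp: P.koszul_gens_0 lookup_single lookup_one when_def)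
        qed
        then show ?thesis using irrelevant_annihilates[OF x _ one_cycle] True by simp
      qed
      then show ?thesis by (auto simp: vanishes_def)
    next
      case False
      interpret V: graded_submodule R "gens K 0" "\<lambda>_. 0" "boundaries 0" by (rule boundaries_submodule)
      show ?thesis using cycles_low[of j 0] False j V.sub_0 by (auto simp: vanishes_def)
    qed
  qed
  then have "t_syz R B (int 0) = Sup {0}" unfolding t_syz_eq by (simp add: zero_ereal_def)
  then show ?thesis by simp
qed

text \<open>By the minimality of \<open>m_num R B\<close> the top degrees increase strictly below it, starting from 0. So if the one at q is
  finite, all those before it are integers.\<close>

lemma t_syz_below_m_num:
  assumes q: "q \<le> m_num R B" and fin: "t_syz R B (int q) \<noteq> \<infinity>"
  shows "\<exists>t :: nat \<Rightarrow> int. (\<forall>p\<le>q. t_syz R B (int p) = ereal (of_int (t p)) \<and> int p \<le> t p) \<and>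
    (\<forall>p p'. p \<le> p' \<longrightarrow> p' \<le> q \<longrightarrow> t p + int (p' - p) \<le> t p')"
proof -
  have less: "t_syz R B (int p) < t_syz R B (int p + 1)" if "p < q" for p
  proof -
    have "p < (LEAST i. t_syz R B (int i) \<ge> t_syz R B (int i + 1))" using that q by (simp add: m_num_def)
    from not_less_Least[OF this] show ?thesis by simp
  qed
  have ub: "p \<le> q \<Longrightarrow> t_syz R B (int p) \<le> t_syz R B (int q)" for p
  proof (induction "q - p" arbitrary: p)
    case (Suc k)
    then have "t_syz R B (int (Suc p)) \<le> t_syz R B (int q)" by (simp del: of_nat_Suc)
    moreover have "t_syz R B (int p) < t_syz R B (int (Suc p))"
      using less[of p] Suc.hyps(2) by (simp add: add.commute)
    ultimately show ?case by simp
  qed simp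
  have lb: "p \<le> q \<Longrightarrow> 0 \<le> t_syz R B (int p)" for p
  proof (induction p)
    case (Suc p)
    then have "0 \<le> t_syz R B (int p)" "t_syz R B (int p) < t_syz R B (int p + 1)" using less[of p] by auto
    then show ?case by (simp add: add.commute)
  qed (simp add: t_syz_0)
  have "\<exists>k. t_syz R B (int p) = ereal (of_int k)" if "p \<le> q" for p
  proof (rule Sup_ereal_int_attained[OF t_syz_eq[symmetric]])
    show "t_syz R B (int p) \<noteq> \<infinity>" using ub[OF that] fin by (metis ereal_infty_less_eq(1))
    show "t_syz R B (int p) \<noteq> - \<infinity>" using lb[OF that] by auto
  qed
  then obtain t where t: "\<And>p. p \<le> q \<Longrightarrow> t_syz R B (int p) = ereal (of_int (t p))" by metis
  have step: "t p + 1 \<le> t (Suc p)" if "Suc p \<le> q" for p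
    using less[of p] t[of p] t[of "Suc p"] that by (simp add: add.commute)
  have mono: "p \<le> p' \<Longrightarrow> p' \<le> q \<Longrightarrow> t p + int (p' - p) \<le> t p'" for p p'
  proof (induction "p' - p" arbitrary: p)
    case (Suc k)
    have "t (Suc p) + int (p' - Suc p) \<le> t p'" by (rule Suc.hyps(1)) (use Suc.hyps(2) Suc.prems in auto)
    moreover have "t p + 1 \<le> t (Suc p)" using step[of p] Suc by simp
    ultimately show ?case using Suc by simp
  qed simp
  have "t 0 = 0" using t[of 0] t_syz_0 by (simp add: zero_ereal_def)
  then have "int p \<le> t p" if "p \<le> q" for p using mono[of 0 p] that by simp
  then show ?thesis using t mono by blast
qed

lemma t_syz_vanishes:
  assumes "\<forall>p\<le>q. t_syz R B (int p) = ereal (of_int (t p)) \<and> int p \<le> t p"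
    and "\<forall>p p'. p \<le> p' \<longrightarrow> p' \<le> q \<longrightarrow> t p + int (p' - p) \<le> t p'"
    and "p \<le> q'" "q' \<le> q" "t q' - int (q' - p) < l"
  shows "vanishes (int p) l"
proof (rule vanishes_above)
  have "t p < l" using assms(2)[rule_format, of p q'] assms(3-5) by simp
  then show "t_syz R B (int p) < ereal (of_int l)" using assms(1)[rule_format, of p] assms(3,4) by simp
qed

lemma t_syz_add_le:
  fixes a a' :: nat
  assumes unit: "(of_nat ((a + a') choose a) :: 'k) \<noteq> 0"
    and res: "\<And>i j. i \<le> a + a' + 1 \<Longrightarrow> int i < j \<Longrightarrow> tor_vanishes (free_resolution R) (residue_mod R) (int i) j"
    and m: "a \<le> m_num R B" "a' \<le> m_num R B" and pos: "0 < a" "0 < a'"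
    and fin: "t_syz R B (int a) \<noteq> \<infinity>" "t_syz R B (int a') \<noteq> \<infinity>"
  shows "t_syz R B (int a + int a') \<le> max (t_syz R B (int a) + t_syz R B (int a'))
     (t_syz R B (int a - 1) + t_syz R B (int a' - 1) + 3)"
proof -
  obtain t where t: "\<forall>p\<le>a. t_syz R B (int p) = ereal (of_int (t p)) \<and> int p \<le> t p"
    "\<forall>p p'. p \<le> p' \<longrightarrow> p' \<le> a \<longrightarrow> t p + int (p' - p) \<le> t p'"
    using t_syz_below_m_num[OF m(1) fin(1)] by (elim exE conjE) (rule that)
  obtain s where s: "\<forall>p\<le>a'. t_syz R B (int p) = ereal (of_int (s p)) \<and> int p \<le> s p"
    "\<forall>p p'. p \<le> p' \<longrightarrow> p' \<le> a' \<longrightarrow> s p + int (p' - p) \<le> s p'"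
    using t_syz_below_m_num[OF m(2) fin(2)] by (elim exE conjE) (rule that)
  have idx: "int a - 1 = int (a - 1)" "int a' - 1 = int (a' - 1)" using pos by auto
  have "max (t_syz R B (int a) + t_syz R B (int a')) (t_syz R B (int a - 1) + t_syz R B (int a' - 1) + 3) =
      ereal (of_int (max (t a + s a') (t (a - 1) + s (a' - 1) + 3)))"
    unfolding idx using t(1) s(1)
    by (simp add: max_def)
  moreover have "t_syz R B (int (a + a')) \<le> ereal (of_int (max (t a + s a') (t (a - 1) + s (a' - 1) + 3)))"
  proof (rule t_syz_leI)
    fix d :: int assume "ereal (of_int (max (t a + s a') (t (a - 1) + s (a' - 1) + 3))) < ereal (of_int d)"
    then have d: "t a + s a' < d" "t (a - 1) + s (a' - 1) + 3 < d" by auto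
    have "vanishes (int a + int a') d"
    proof (rule vanishes_sum[OF free_resolution res unit _ _ _ _ _ d])
      show "vanishes (int p) l" if "p < a" "t (a - 1) - int (a - 1 - p) < l" for p l
        by (rule t_syz_vanishes[OF t, of p "a - 1"]) (use that in auto)
      show "vanishes (int a) l" if "t a < l" for l
        by (rule t_syz_vanishes[OF t, of a a]) (use that in auto)
      show "vanishes (int p) l" if "p < a'" "s (a' - 1) - int (a' - 1 - p) < l" for p l
        by (rule t_syz_vanishes[OF s, of p "a' - 1"]) (use that in auto)
      show "vanishes (int a') l" if "s a' < l" for l
        by (rule t_syz_vanishes[OF s, of a' a']) (use that in auto)
      show "int a' - 1 \<le> s (a' - 1)" using s(1)[rule_format, of "a' - 1"] pos by simp
    qed auto
    then show "vanishes (int (a + a')) d" by simp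
  qed
  ultimately show ?thesis by simp
qed

lemma t_syz_Suc_le:
  assumes res: "\<And>i j. i \<le> a + 2 \<Longrightarrow> int i < j \<Longrightarrow> tor_vanishes (free_resolution R) (residue_mod R) (int i) j"
    and m: "a \<le> m_num R B"
  shows "t_syz R B (int a + 1) \<le> t_syz R B (int a) + 2"
proof (cases "t_syz R B (int a) = \<infinity>")
  case False
  obtain t where t: "\<forall>p\<le>a. t_syz R B (int p) = ereal (of_int (t p)) \<and> int p \<le> t p"
    "\<forall>p p'. p \<le> p' \<longrightarrow> p' \<le> a \<longrightarrow> t p + int (p' - p) \<le> t p'"
    using t_syz_below_m_num[OF m False] by (elim exE conjE) (rule that)
  have "t_syz R B (int (Suc a)) \<le> ereal (of_int (t a + 2))"
  proof (rule t_syz_leI)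
    fix d :: int assume "ereal (of_int (t a + 2)) < ereal (of_int d)"
    then have d: "t a + 2 < d" by simp
    have "vanishes (int a + 1) d"
    proof (rule vanishes_Suc[OF free_resolution res _ _ d])
      show "vanishes (int p) l" if "p \<le> a" "t a - int (a - p) < l" for p l
        by (rule t_syz_vanishes[OF t, of p a]) (use that in auto)
    qed (use t(1) in auto)
    then show "vanishes (int (Suc a)) d" by (simp add: add.commute)
  qed
  then show ?thesis using t(1) by (simp add: add.commute)
qed simp

end

lemma reg_upto_residue:
  assumes R: "standard_graded_algebra R" and reg: "reg_upto (int N) R (residue_mod R) = 0"
    and ij: "i \<le> N" "int i < j"
  shows "tor_vanishes (free_resolution R) (residue_mod R) (int i) j"
proof (rule ccontr)
  assume n: "\<not> ?thesis"
  have "t_top R (residue_mod R) (int i) - ereal (of_int (int i)) \<le> 0"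
    unfolding reg[symmetric] reg_upto_def by (rule SUP_upper) (use ij in simp)
  moreover have "ereal (of_int j) \<le> t_top R (residue_mod R) (int i)"
    unfolding t_top_eq[OF standard_graded_algebra.residue_module[OF R]] by (rule Sup_upper) (use n in blast)
  ultimately show False using ij(2)
    by (cases "t_top R (residue_mod R) (int i)") auto
qed

theorem theorem5p2:
  fixes R :: "('k::field, 'a::comm_ring_1) graded_alg"
    and B :: "'a set" and a b :: nat
  assumes "standard_graded_algebra R"
    and "is_basis (scl R) (gr R 1) B"
    and "(of_nat ((a + b) choose a) :: 'k) dvd 1"
    and "reg_upto (int a + int b + 1) R (residue_mod R) = 0"
    and "max a b \<le> m_num R B"
  shows "t_syz R B (int a + int b) \<le>
           max (t_syz R B (int a) + t_syz R B (int b))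
               (t_syz R B (int a - 1) + t_syz R B (int b - 1) + 3)
       \<and> (b = 1 \<longrightarrow> t_syz R B (int a + 1) \<le> t_syz R B (int a) + 2)
       \<and> (b \<ge> 2 \<longrightarrow> t_syz R B (int a + int b) \<le> t_syz R B (int a) + t_syz R B (int b) + 1)"
proof -
  interpret std: standard_graded_algebra R by fact
  have "finite B" by (rule std.basis_finite[OF assms(2)])
  then obtain e where "bij_betw e {0..<card B} B" using ex_bij_betw_nat_finite by blast
  then have e: "bij_betw e {..<card B} B" by (simp add: lessThan_atLeast0)
  interpret koszul_algebra R B e "card B" "sym_alg B"
    by (intro koszul_algebra.intro koszul_algebra_axioms.intro std.connected_algebra[OF assms(2)] assms(1,2) e refl)
  let ?t = "t_syz R B"
  have unit: "(of_nat ((a + b) choose a) :: 'k) \<noteq> 0" using assms(3) by auto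
  have m: "a \<le> m_num R B" "b \<le> m_num R B" using assms(5) by auto
  have res: "tor_vanishes (free_resolution R) (residue_mod R) (int i) j" if "i \<le> a + b + 1" "int i < j" for i j
    by (rule reg_upto_residue[OF assms(1), of "a + b + 1"]) (use assms(4) that in \<open>auto simp: algebra_simps\<close>)
  have nonneg: "0 \<le> ?t (int q)" if q: "q \<le> m_num R B" for q
  proof (cases "?t (int q) = \<infinity>")
    case False
    obtain t where "?t (int q) = ereal (of_int (t q))" "int q \<le> t q"
      using t_syz_below_m_num[OF q False] by (metis order_refl)
    then show ?thesis by simp
  qed simp
  have first: "?t (int a + int b) \<le> max (?t (int a) + ?t (int b)) (?t (int a - 1) + ?t (int b - 1) + 3)"
  proof -
    consider "a = 0 \<or> b = 0" | "?t (int a) = \<infinity> \<or> ?t (int b) = \<infinity>"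
      | "0 < a" "0 < b" "?t (int a) \<noteq> \<infinity>" "?t (int b) \<noteq> \<infinity>" by blast
    then show ?thesis
    proof cases
      case 1
      then show ?thesis using t_syz_0 by (auto simp: le_max_iff_disj)
    next
      case 2
      then have e: "?t (int a) + ?t (int b) = \<infinity>" by auto
      have "?t (int a + int b) \<le> ?t (int a) + ?t (int b)" unfolding e by simp
      then show ?thesis by (rule max.coboundedI1)
    next
      case 3
      then show ?thesis using t_syz_add_le[OF unit res m] by simp
    qed
  qed
  moreover have "?t (int a + 1) \<le> ?t (int a) + 2" if "b = 1"
    by (rule t_syz_Suc_le[OF res m(1)]) (use that in auto)
  moreover have "?t (int a + int b) \<le> ?t (int a) + ?t (int b) + 1" if "2 \<le> b"
  proof -
    consider "a = 0" | "?t (int a) = \<infinity> \<or> ?t (int b) = \<infinity>"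
      | "0 < a" "?t (int a) \<noteq> \<infinity>" "?t (int b) \<noteq> \<infinity>" by blast
    then show ?thesis
    proof cases
      case 1
      have "?t (int b) + 0 \<le> ?t (int b) + 1" by (intro add_left_mono) simp
      then show ?thesis using 1 t_syz_0 by simp
    next
      case 2
      then have e: "?t (int a) + ?t (int b) + 1 = \<infinity>" by auto
      show ?thesis unfolding e by simp
    next
      case 3
      have prev: "\<exists>k l. ?t (int q) = ereal (of_int k) \<and> ?t (int q - 1) = ereal (of_int l) \<and> l + 1 \<le> k"
        if q: "q \<le> m_num R B" "?t (int q) \<noteq> \<infinity>" "0 < q" for q
      proof -
        obtain t where t: "\<forall>p\<le>q. ?t (int p) = ereal (of_int (t p)) \<and> int p \<le> t p"
          "\<forall>p p'. p \<le> p' \<longrightarrow> p' \<le> q \<longrightarrow> t p + int (p' - p) \<le> t p'"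
          using t_syz_below_m_num[OF q(1) q(2)] by (elim exE conjE) (rule that)
        have "int q - 1 = int (q - 1)" using q(3) by simp
        then show ?thesis using t(1)[rule_format, of q] t(1)[rule_format, of "q - 1"] t(2)[rule_format, of "q - 1" q] q(3) by auto
      qed
      have "0 < b" using that by simp
      then obtain k l k' l' where kl:
        "?t (int a) = ereal (of_int k)" "?t (int a - 1) = ereal (of_int l)" "l + 1 \<le> k"
        "?t (int b) = ereal (of_int k')" "?t (int b - 1) = ereal (of_int l')" "l' + 1 \<le> k'"
        using prev[OF m(1) 3(2,1)] prev[OF m(2) 3(3)] by metis
      have "max (?t (int a) + ?t (int b)) (?t (int a - 1) + ?t (int b - 1) + 3) \<le> ?t (int a) + ?t (int b) + 1"
        using kl by simp
      with first show ?thesis by (rule order_trans)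
    qed
  qed
  ultimately show ?thesis by blast
qed

end
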